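(* Let $m\in I_{n-1}$. Then the Lie algebras of vector fields $\mathfrak r(m)$ and $\mathfrak r$ integrate, respectively, to algebraic actions of the algebraic tori $A_{\mathfrak r}(m)$ and $A_{\mathfrak r}$ on $M_\Omega(n,\mathfrak e)$; that is, the action maps $A_{\mathfrak r}(m)\times M_\Omega(n,\mathfrak e)\to M_\Omega(n,\mathfrak e)$ and $A_{\mathfrak r}\times M_\Omega(n,\mathfrak e)\to M_\Omega(n,\mathfrak e)$, in which the element of coordinates $\zeta_j=e^{q_j}$ acts as $\prod_j \exp q_j\,\xi_{r_j}$, are morphisms of algebraic varieties.
   Context: Fix a positive integer $n$. For $k\ge 0$ put $d(k)=k(k+1)/2$, $I_k=\{1,\dots,k\}$, and for $m\in I_n$ let $I_{[m]}=I_{d(m)}\setminus I_{d(m-1)}$. $M(n)$ is the space of complex $n\times n$ matrices; for $x\in M(n)$ and $m\in I_n$, $x_m$ is the upper left $m\times m$ block of $x$. $M_\Omega(n)$ is the Zariski open set of all $x\in M(n)$ such that $x_m$ has $m$ distinct eigenvalues for every $m\in I_n$, and $x_m,x_{m+1}$ have no common eigenvalue for every $m\in I_{n-1}$. $\mathfrak e_{\Omega(n)}$ is the set of all $\nu=(\nu(1),\dots,\nu(n))$, $\nu(m)=\mathrm{diag}(\nu_{1\,m},\dots,\nu_{m\,m})$, such that for each $m\in I_n$ the numbers $\nu_{1\,m},\dots,\nu_{m\,m}$ are distinct and $\nu_{i\,m}\ne\nu_{j\,m+1}$ for all $m\in I_{n-1}$, $i\in I_m$, $j\in I_{m+1}$;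 it is a Zariski open subset of $\mathbb C^{d(n)}$. Let $$M_\Omega(n,\mathfrak e)=\{(\nu,x)\in\mathfrak e_{\Omega(n)}\times M_\Omega(n)\mid \nu(m)\text{ is } Gl(m)\text{-conjugate to }x_m\ \forall m\in I_n\},$$ with projection $\pi_n(\nu,x)=x$; it is a nonsingular affine variety of dimension $n^2$. For $m\in I_n$, $k\in I_m$ let $r_{d(m-1)+k}(\nu,x)=\nu_{k\,m}$. Poisson structure: on $M(n)$, $[f,g](x)=\mathrm{tr}(x[\nabla f(x),\nabla g(x)])$, where $\mathrm{tr}(\nabla f(x)v)=df_x(v)$. Since $\pi_n$ is a local analytic isomorphism onto $M_\Omega(n)$, the structure lifts to $M_\Omega(n,\mathfrak e)$. For a function $\varphi$, $\xi_\varphi$ is the vector field with $\xi_\varphi\psi=[\varphi,\psi]$. $\mathfrak r(m)$ (for $m\in I_{n-1}$) is the $m$-dimensional commutative Lie algebra spanned by $\xi_{r_j}$, $j\in I_{[m]}$, and $\mathfrak r=\mathfrak r(1)\oplus\cdots\oplus\mathfrak r(n-1)$ is spanned by $\xi_{r_j}$, $j\in I_{d(n-1)}$. Each $\xi_{r_j}$, $j\in I_{d(n-1)}$, has a globally defined complex flow $\exp q\,\xi_{r_j}$, $q\in\mathbb C$, trivial for $q\in2\pi i\,\mathbb Z$. For each $j\in I_{d(n-1)}$, $A_{\mathfrak r,j}$ is a one-dimensional torus with coordinate isomorphism $\zeta_j:A_{\mathfrak r,j}\to\mathbb C^\times$ and $\mathrm{Lie}\,A_{\mathfrak r,j}=\mathbb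 C\,\xi_{r_j}$, the element with $\zeta_j=e^q$ acting as $\exp q\,\xi_{r_j}$; $A_{\mathfrak r}(m)=\prod_{j\in I_{[m]}}A_{\mathfrak r,j}\cong(\mathbb C^\times)^m$ and $A_{\mathfrak r}=A_{\mathfrak r}(1)\times\cdots\times A_{\mathfrak r}(n-1)\cong(\mathbb C^\times)^{d(n-1)}$. *)

theory Defs
  imports
    Complex_Main
    "HOL-Library.FuncSet"
    "HOL-Algebra.Group_Action"
    "HOL-Algebra.Product_Groups"
    "Jordan_Normal_Form.Matrix"
    "Jordan_Normal_Form.Spectral_Radius"
begin

section \<open>Quasi-affine varieties and their morphisms\<close>

text \<open>A quasi-affine variety is given by its set of points together with the set of coordinate
  functions of an embedding into an affine space; reducible varieties are allowed.\<close>

inductive_set poly_fun :: "('p \<Rightarrow> complex) set \<Rightarrow> ('p \<Rightarrow> complex) set"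
  for C :: "('p \<Rightarrow> complex) set" where
  const: "(\<lambda>_. a) \<in> poly_fun C"
| coord: "f \<in> C \<Longrightarrow> f \<in> poly_fun C"
| add: "f \<in> poly_fun C \<Longrightarrow> g \<in> poly_fun C \<Longrightarrow> (\<lambda>p. f p + g p) \<in> poly_fun C"
| mult: "f \<in> poly_fun C \<Longrightarrow> g \<in> poly_fun C \<Longrightarrow> (\<lambda>p. f p * g p) \<in> poly_fun C"

definition zariski_open :: "('p \<Rightarrow> complex) set \<Rightarrow> 'p set \<Rightarrow> 'p set \<Rightarrow> bool" where
  "zariski_open C S U \<longleftrightarrow> (\<exists>F \<subseteq> poly_fun C. U = {p \<in> S. \<exists>f\<in>F. f p \<noteq> 0})"

definition regular_on :: "('p \<Rightarrow> complex) set \<Rightarrow> 'p set \<Rightarrow> ('p \<Rightarrow> complex) \<Rightarrow> bool" where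
  "regular_on C U f \<longleftrightarrow>
     (\<forall>p\<in>U. \<exists>V P Q. zariski_open C U V \<and> p \<in> V \<and> P \<in> poly_fun C \<and> Q \<in> poly_fun C \<and>
        (\<forall>q\<in>V. Q q \<noteq> 0 \<and> f q = P q / Q q))"

definition variety_morphism ::
    "('p \<Rightarrow> complex) set \<Rightarrow> 'p set \<Rightarrow> ('q \<Rightarrow> complex) set \<Rightarrow> 'q set \<Rightarrow> ('p \<Rightarrow> 'q) \<Rightarrow> bool" where
  "variety_morphism C S D T F \<longleftrightarrow>
     F \<in> S \<rightarrow> T \<and>
     (\<forall>V. zariski_open D T V \<longrightarrow>
        zariski_open C S (S \<inter> F -` V) \<and>
        (\<forall>f. regular_on D V f \<longrightarrow> regular_on C (S \<inter> F -` V) (f \<circ> F)))"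

definition prod_coords ::
    "('p \<Rightarrow> complex) set \<Rightarrow> ('q \<Rightarrow> complex) set \<Rightarrow> ('p \<times> 'q \<Rightarrow> complex) set" where
  "prod_coords C D = (\<lambda>f. f \<circ> fst) ` C \<union> (\<lambda>g. g \<circ> snd) ` D"


section \<open>The variety of pairs (eigenvalue data, matrix)\<close>

definition tri :: "nat \<Rightarrow> nat" where
  "tri k = k * (k + 1) div 2"

definition I :: "nat \<Rightarrow> nat set" where
  "I k = {1..k}"

definition I_block :: "nat \<Rightarrow> nat set" where
  "I_block m = I (tri m) - I (tri (m - 1))"

definition cutoff :: "nat \<Rightarrow> complex mat \<Rightarrow> complex mat" where
  "cutoff m x = Matrix.mat m m (\<lambda>(i, j). x $$ (i, j))"

definition M_Omega :: "nat \<Rightarrow> complex mat set" where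
  "M_Omega n = {x \<in> carrier_mat n n.
     (\<forall>m\<in>I n. card (spectrum (cutoff m x)) = m) \<and>
     (\<forall>m\<in>I (n - 1). spectrum (cutoff m x) \<inter> spectrum (cutoff (m + 1) x) = {})}"

text \<open>A tuple of complex numbers indexed by the triangular array is stored linearly: the entry
  with indices k, m (k at most m) has position \<open>tri (m - 1) + k\<close>. Outside \<open>I (tri n)\<close> the value
  is \<open>undefined\<close> (extensional functions).\<close>

definition nu_entry :: "(nat \<Rightarrow> complex) \<Rightarrow> nat \<Rightarrow> nat \<Rightarrow> complex" where
  "nu_entry \<nu> k m = \<nu> (tri (m - 1) + k)"

text \<open>Matrix indices start at 0, hence the shift.\<close>

definition nu_diag :: "(nat \<Rightarrow> complex) \<Rightarrow> nat \<Rightarrow> complex mat" where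
  "nu_diag \<nu> m = mat_diag m (\<lambda>i. nu_entry \<nu> (i + 1) m)"

definition e_Omega :: "nat \<Rightarrow> (nat \<Rightarrow> complex) set" where
  "e_Omega n = {\<nu> \<in> I (tri n) \<rightarrow>\<^sub>E UNIV.
     (\<forall>m\<in>I n. inj_on (\<lambda>k. nu_entry \<nu> k m) (I m)) \<and>
     (\<forall>m\<in>I (n - 1). \<forall>i\<in>I m. \<forall>j\<in>I (m + 1). nu_entry \<nu> i m \<noteq> nu_entry \<nu> j (m + 1))}"

type_synonym pt = "(nat \<Rightarrow> complex) \<times> complex mat"

definition M_Omega_e :: "nat \<Rightarrow> pt set" where
  "M_Omega_e n = {(\<nu>, x). \<nu> \<in> e_Omega n \<and> x \<in> M_Omega n \<and>
     (\<forall>m\<in>I n. similar_mat (nu_diag \<nu> m) (cutoff m x))}"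

definition r_fun :: "nat \<Rightarrow> pt \<Rightarrow> complex" where
  "r_fun j = (\<lambda>(\<nu>, x). \<nu> j)"

definition M_coords :: "nat \<Rightarrow> (pt \<Rightarrow> complex) set" where
  "M_coords n = r_fun ` I (tri n) \<union>
     (\<lambda>(i, j). \<lambda>p. snd p $$ (i, j)) ` ({..<n} \<times> {..<n})"


section \<open>Poisson structure\<close>

definition mat_trace :: "complex mat \<Rightarrow> complex" where
  "mat_trace A = (\<Sum>i<dim_row A. A $$ (i, i))"

definition mat_norm :: "complex mat \<Rightarrow> real" where
  "mat_norm A = (\<Sum>i<dim_row A. \<Sum>j<dim_col A. cmod (A $$ (i, j)))"

text \<open>Complex Frechet differentiability at x of a function on matrices, with the differential
  represented by the matrix G through the trace form.\<close>

definition has_gradient :: "nat \<Rightarrow> (complex mat \<Rightarrow> complex) \<Rightarrow> complex mat \<Rightarrow> complex mat \<Rightarrow> bool" where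
  "has_gradient n f x G \<longleftrightarrow> G \<in> carrier_mat n n \<and>
     (\<forall>\<epsilon>>0. \<exists>\<delta>>0. \<forall>y\<in>carrier_mat n n. mat_norm (y - x) < \<delta> \<longrightarrow>
        cmod (f y - f x - mat_trace (G * (y - x))) \<le> \<epsilon> * mat_norm (y - x))"

definition gradient :: "nat \<Rightarrow> (complex mat \<Rightarrow> complex) \<Rightarrow> complex mat \<Rightarrow> complex mat" where
  "gradient n f x = (THE G. has_gradient n f x G)"

definition poisson ::
    "nat \<Rightarrow> (complex mat \<Rightarrow> complex) \<Rightarrow> (complex mat \<Rightarrow> complex) \<Rightarrow> complex mat \<Rightarrow> complex" where
  "poisson n f g x =
     mat_trace (x * (gradient n f x * gradient n g x - gradient n g x * gradient n f x))"

text \<open>The projection to the matrix is \<open>snd\<close>. The Poisson bracket is lifted along its local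
  analytic inverse near p. The germ of that inverse is unique, so the choice made in
  \<open>local_inv\<close> affects neither values nor gradients at the base point.\<close>

definition is_local_inv :: "nat \<Rightarrow> pt \<Rightarrow> (complex mat \<Rightarrow> pt) \<Rightarrow> bool" where
  "is_local_inv n p \<sigma> \<longleftrightarrow> \<sigma> (snd p) = p \<and>
     (\<exists>e>0. \<forall>y\<in>carrier_mat n n. mat_norm (y - snd p) < e \<longrightarrow>
        \<sigma> y \<in> M_Omega_e n \<and> snd (\<sigma> y) = y \<and>
        (\<forall>j\<in>I (tri n). \<exists>G. has_gradient n (\<lambda>z. fst (\<sigma> z) j) y G))"

definition local_inv :: "nat \<Rightarrow> pt \<Rightarrow> complex mat \<Rightarrow> pt" where
  "local_inv n p = (SOME \<sigma>. is_local_inv n p \<sigma>)"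

definition poisson_e :: "nat \<Rightarrow> (pt \<Rightarrow> complex) \<Rightarrow> (pt \<Rightarrow> complex) \<Rightarrow> pt \<Rightarrow> complex" where
  "poisson_e n \<phi> \<psi> p = poisson n (\<phi> \<circ> local_inv n p) (\<psi> \<circ> local_inv n p) (snd p)"

definition analytic_fun :: "nat \<Rightarrow> (pt \<Rightarrow> complex) \<Rightarrow> bool" where
  "analytic_fun n \<psi> \<longleftrightarrow>
     (\<forall>p\<in>M_Omega_e n. \<exists>G. has_gradient n (\<psi> \<circ> local_inv n p) (snd p) G)"


section \<open>Vector fields and flows\<close>

text \<open>Vector fields are regarded as operators on analytic functions.\<close>

type_synonym vfield = "(pt \<Rightarrow> complex) \<Rightarrow> pt \<Rightarrow> complex"

definition \<xi> :: "nat \<Rightarrow> (pt \<Rightarrow> complex) \<Rightarrow> vfield" where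
  "\<xi> n \<phi> = (\<lambda>\<psi>. poisson_e n \<phi> \<psi>)"

definition integral_curve :: "nat \<Rightarrow> vfield \<Rightarrow> (complex \<Rightarrow> pt) \<Rightarrow> bool" where
  "integral_curve n X c \<longleftrightarrow> (\<forall>q. c q \<in> M_Omega_e n) \<and>
     (\<forall>\<psi>. analytic_fun n \<psi> \<longrightarrow>
        (\<forall>q. ((\<lambda>s. \<psi> (c s)) has_field_derivative X \<psi> (c q)) (at q)))"

definition complete_field :: "nat \<Rightarrow> vfield \<Rightarrow> bool" where
  "complete_field n X \<longleftrightarrow> (\<forall>p\<in>M_Omega_e n. \<exists>!c. integral_curve n X c \<and> c 0 = p)"

text \<open>\<open>flow n X q\<close> is \<open>exp (q X)\<close>; it is meaningful for complete fields.\<close>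

definition flow :: "nat \<Rightarrow> vfield \<Rightarrow> complex \<Rightarrow> pt \<Rightarrow> pt" where
  "flow n X q p = (THE c. integral_curve n X c \<and> c 0 = p) q"

text \<open>The general element of the Lie algebra spanned by the Hamiltonian fields of the
  \<open>r_fun j\<close>, \<open>j \<in> J\<close>.\<close>

definition r_field :: "nat \<Rightarrow> nat set \<Rightarrow> (nat \<Rightarrow> complex) \<Rightarrow> vfield" where
  "r_field n J a = (\<lambda>\<psi> p. \<Sum>j\<in>J. a j * \<xi> n (r_fun j) \<psi> p)"


section \<open>Tori and their actions\<close>

definition Cstar :: "complex monoid" where
  "Cstar = \<lparr>carrier = - {0}, monoid.mult = (*), one = 1\<rparr>"

definition torus :: "nat set \<Rightarrow> (nat \<Rightarrow> complex) monoid" where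
  "torus J = product_group J (\<lambda>_. Cstar)"

definition torus_coords :: "nat set \<Rightarrow> ((nat \<Rightarrow> complex) \<Rightarrow> complex) set" where
  "torus_coords J = (\<lambda>j z. z j) ` J"

definition torus_exp :: "nat set \<Rightarrow> (nat \<Rightarrow> complex) \<Rightarrow> nat \<Rightarrow> complex" where
  "torus_exp J q = (\<lambda>j\<in>J. exp (q j))"

definition algebraic_torus_action ::
    "nat \<Rightarrow> nat set \<Rightarrow> ((nat \<Rightarrow> complex) \<Rightarrow> pt \<Rightarrow> pt) \<Rightarrow> bool" where
  "algebraic_torus_action n J \<alpha> \<longleftrightarrow>
     group_action (torus J) (M_Omega_e n) \<alpha> \<and>
     variety_morphism
       (prod_coords (torus_coords J) (M_coords n)) (carrier (torus J) \<times> M_Omega_e n)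
       (M_coords n) (M_Omega_e n)
       (\<lambda>(z, p). \<alpha> z p)"

text \<open>The Lie algebra of \<open>torus J\<close> is identified with the span of the fields \<open>\<xi> n (r_fun j)\<close>,
  \<open>j \<in> J\<close>, the element of coordinates \<open>exp (q j)\<close> being the exponential of \<open>r_field n J q\<close>.
  The product of the commuting flows is taken along an arbitrary enumeration of J.\<close>

definition integrates_to :: "nat \<Rightarrow> nat set \<Rightarrow> ((nat \<Rightarrow> complex) \<Rightarrow> pt \<Rightarrow> pt) \<Rightarrow> bool" where
  "integrates_to n J \<alpha> \<longleftrightarrow>
     (\<forall>a. \<forall>p\<in>M_Omega_e n.
        integral_curve n (r_field n J a) (\<lambda>t. \<alpha> (torus_exp J (\<lambda>j. t * a j)) p)) \<and>
     (\<forall>j\<in>J. complete_field n (\<xi> n (r_fun j))) \<and>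
     (\<forall>q js. \<forall>p\<in>M_Omega_e n. distinct js \<and> set js = J \<longrightarrow>
        \<alpha> (torus_exp J q) p = foldr (\<lambda>j. flow n (\<xi> n (r_fun j)) (q j)) js p)"

end

theory Submission
  imports Defs
begin

text \<open>Let \<open>j\<close> be the position of the pair \<open>(k, m)\<close>. The gradient of \<open>r_fun j\<close> is the spectral
  projection \<open>P\<close> of \<open>x\<^sub>m\<close> for the eigenvalue \<open>\<nu>\<^sub>k\<^sub>m\<close>, padded by zeros, so its Hamiltonian
  field is \<open>x' = x P - P x\<close>. Since \<open>P\<close> commutes with \<open>x\<^sub>m\<close>, the flow fixes \<open>x\<^sub>m\<close>, hence also
  \<open>P\<close>, and equals \<open>(\<nu>, x) \<mapsto> (\<nu>, g\<inverse> x g)\<close> with \<open>g = exp (q P) = 1 + (exp q - 1) P\<close>. Lagrange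
  interpolation writes \<open>P\<close> as a polynomial in \<open>x\<^sub>m\<close> whose coefficients are rational in \<open>\<nu>\<close>,
  which makes the action algebraic. The actions commute because \<open>g\<close> is block diagonal with respect
  to all larger cutoffs.\<close>

section \<open>Spectral projections\<close>

text \<open>The difficulty is that integral curves are visible only through analytic test functions,
  and that analyticity and the bracket are read through a chosen local inverse. Separation of
  eigenvalues controls that choice. A function whose values are eigenvalues of the cutoff near the
  base point, and which tends to a simple eigenvalue there, already has \<open>P\<close> as its
  gradient, so every local inverse yields the same Hamiltonian field; a curve with constant \<nu>
  must agree with the local inverse while it stays close to the base point. Existence of nearby
  eigenvalues comes from smallness of the characteristic polynomial, differentiability from an error
  estimate quadratic in the perturbation. For uniqueness of integral curves, the eigenvalue
  coordinates and the entries of the relevant cutoff are first shown to be constant along any such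
  curve; the remaining equation is linear with constant \<open>P\<close>, and conjugation by its
  exponential makes the solution constant. Algebraicity is handled by global fractions: the
  denominators that arise are differences of distinct eigenvalues and torus coordinates, and these
  vanish nowhere on the domain.\<close>

definition lagrange_mat :: "complex \<Rightarrow> complex list \<Rightarrow> complex mat \<Rightarrow> complex mat" where
  "lagrange_mat \<mu> ls A =
     foldr (\<lambda>l B. inverse (\<mu> - l) \<cdot>\<^sub>m ((A - l \<cdot>\<^sub>m 1\<^sub>m (dim_row A)) * B)) ls (1\<^sub>m (dim_row A))"

lemma lagrange_mat_simps:
  "lagrange_mat \<mu> [] A = 1\<^sub>m (dim_row A)"
  "lagrange_mat \<mu> (l # ls) A =
     inverse (\<mu> - l) \<cdot>\<^sub>m ((A - l \<cdot>\<^sub>m 1\<^sub>m (dim_row A)) * lagrange_mat \<mu> ls A)"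
  by (simp_all add: lagrange_mat_def)

lemma lagrange_mat_carrier [simp, intro]:
  "A \<in> carrier_mat m m \<Longrightarrow> lagrange_mat \<mu> ls A \<in> carrier_mat m m"
  by (induction ls) (auto simp: lagrange_mat_simps)

text \<open>A polynomial in \<open>A\<close> inherits the intertwining relations of
  \<open>A\<close>. Taking \<open>V\<close> to be \<open>A\<close> itself, a matrix of eigenvectors
  or an invertible conjugator gives commutation, diagonalization and equivariance of spectral
  projections.\<close>

lemma lagrange_mat_intertwine:
  assumes A: "A \<in> carrier_mat m m" and B: "B \<in> carrier_mat k k" and V: "V \<in> carrier_mat m k"
    and eq: "A * V = V * B"
  shows "lagrange_mat \<mu> ls A * V = V * lagrange_mat \<mu> ls B"
proof (induction ls)
  case Nil
  then show ?case using A B V by (simp add: lagrange_mat_simps)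
next
  case (Cons l ls)
  let ?L = "lagrange_mat \<mu> ls A" and ?M = "lagrange_mat \<mu> ls B"
  let ?A = "A - l \<cdot>\<^sub>m 1\<^sub>m m" and ?B = "B - l \<cdot>\<^sub>m 1\<^sub>m k"
  have L: "?L \<in> carrier_mat m m" and M: "?M \<in> carrier_mat k k"
    and A': "?A \<in> carrier_mat m m" and B': "?B \<in> carrier_mat k k"
    using A B by auto
  have eq': "?A * V = V * ?B"
  proof -
    have "?A * V = A * V - (l \<cdot>\<^sub>m 1\<^sub>m m) * V" using A V by (intro minus_mult_distrib_mat) auto
    also have "(l \<cdot>\<^sub>m 1\<^sub>m m) * V = l \<cdot>\<^sub>m V" using V by (simp add: mult_smult_assoc_mat[of _ m m])
    also have "l \<cdot>\<^sub>m V = V * (l \<cdot>\<^sub>m 1\<^sub>m k)" using V by (simp add: mult_smult_distrib[of _ m k _ k])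
    also have "A * V - V * (l \<cdot>\<^sub>m 1\<^sub>m k) = V * ?B"
      unfolding eq using B V by (intro mult_minus_distrib_mat[symmetric]) auto
    finally show ?thesis .
  qed
  have "lagrange_mat \<mu> (l # ls) A * V = inverse (\<mu> - l) \<cdot>\<^sub>m (?A * ?L * V)"
    using A V A' L by (simp add: lagrange_mat_simps mult_smult_assoc_mat[of _ m m])
  also have "?A * ?L * V = ?A * (V * ?M)"
    using A' L V Cons by (simp add: assoc_mult_mat[of _ m m])
  also have "\<dots> = (V * ?B) * ?M"
    using A' M V eq' by (simp add: assoc_mult_mat[of _ m m, symmetric])
  also have "\<dots> = V * (?B * ?M)"
    using V B' M by (simp add: assoc_mult_mat[of _ m k _ k])
  also have "inverse (\<mu> - l) \<cdot>\<^sub>m (V * (?B * ?M)) = V * lagrange_mat \<mu> (l # ls) B"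
    using B V B' M by (simp add: lagrange_mat_simps mult_smult_distrib[of _ m k _ k])
  finally show ?case .
qed

lemma lagrange_mat_diag:
  "lagrange_mat \<mu> ls (mat_diag m d) = mat_diag m (\<lambda>i. \<Prod>l\<leftarrow>ls. (d i - l) / (\<mu> - l))"
proof (induction ls)
  case Nil
  then show ?case by (simp add: lagrange_mat_simps mat_diag_def one_mat_def)
next
  case (Cons l ls)
  have "mat_diag m d - l \<cdot>\<^sub>m 1\<^sub>m m = mat_diag m (\<lambda>i. d i - l)"
    by (auto simp: mat_diag_def intro!: eq_matI)
  moreover have "dim_row (mat_diag m d) = m" by (simp add: mat_diag_def)
  ultimately show ?case
    by (auto simp: lagrange_mat_simps Cons) (auto simp: mat_diag_def field_simps intro!: eq_matI)
qed

text \<open>If the eigenvalues of \<open>A\<close> are the distinct numbers \<open>d 0, \<dots>, d (m - 1)\<close>, this is the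
  projection onto the eigenspace of \<open>d i\<close> along the other eigenspaces.\<close>

definition eproj :: "nat \<Rightarrow> (nat \<Rightarrow> complex) \<Rightarrow> nat \<Rightarrow> complex mat \<Rightarrow> complex mat" where
  "eproj m d i A = lagrange_mat (d i) (map d (filter (\<lambda>k. k \<noteq> i) [0..<m])) A"

lemma eproj_carrier [simp, intro]: "A \<in> carrier_mat m m \<Longrightarrow> eproj m d i A \<in> carrier_mat m m"
  by (simp add: eproj_def lagrange_mat_carrier)

lemma eproj_dim [simp]:
  assumes "A \<in> carrier_mat m m"
  shows "dim_row (eproj m d i A) = m" "dim_col (eproj m d i A) = m"
  using eproj_carrier[OF assms, of d i] by auto

lemma eproj_intertwine:
  assumes "A \<in> carrier_mat m m" "B \<in> carrier_mat m m" "V \<in> carrier_mat m m" "A * V = V * B"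
  shows "eproj m d i A * V = V * eproj m d i B"
  unfolding eproj_def using lagrange_mat_intertwine assms by blast

text \<open>The interpolation polynomial is 1 at the node \<open>d i\<close> and 0 at the other
  nodes; distinctness of the nodes keeps its denominators nonzero.\<close>

lemma eproj_diag:
  assumes "inj_on d {..<m}" "i < m"
  shows "eproj m d i (mat_diag m d) = mat_diag m (\<lambda>k. if k = i then 1 else 0)"
proof -
  have "(\<Prod>l\<leftarrow>map d (filter (\<lambda>k. k \<noteq> i) [0..<m]). (d k - l) / (d i - l)) = (if k = i then 1 else 0)"
    if k: "k < m" for k
  proof (cases "k = i")
    case True
    have "\<forall>l\<in>set (map d (filter (\<lambda>k. k \<noteq> i) [0..<m])). (d k - l) / (d i - l) = 1"
      using assms True by (auto simp: inj_on_def)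
    then have "(\<Prod>l\<leftarrow>map d (filter (\<lambda>k. k \<noteq> i) [0..<m]). (d k - l) / (d i - l)) = 
       (\<Prod>l\<leftarrow>map d (filter (\<lambda>k. k \<noteq> i) [0..<m]). 1)"
      by (intro arg_cong[of _ _ prod_list] map_cong) auto
    then show ?thesis using True by (simp add: map_replicate_const)
  next
    case False
    then have "0 \<in> set (map (\<lambda>l. (d k - l) / (d i - l)) (map d (filter (\<lambda>k. k \<noteq> i) [0..<m])))"
      using k by (auto simp: image_iff intro!: bexI[of _ k])
    then show ?thesis using False by (simp add: prod_list_zero_iff)
  qed
  then show ?thesis
    unfolding eproj_def lagrange_mat_diag by (auto simp: mat_diag_def intro!: eq_matI)
qed

lemma conj_mult_mat:
  fixes A :: "complex mat"
  assumes "A \<in> carrier_mat m m" "B \<in> carrier_mat m m" "V \<in> carrier_mat m m" "W \<in> carrier_mat m m"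
    and "W * V = 1\<^sub>m m"
  shows "V * A * W * (V * B * W) = V * (A * B) * W" and "V * A * W * V = V * A"
proof -
  have "V * A * W * (V * B * W) = V * A * (W * V) * (B * W)"
    using assms(1-4) by (simp add: assoc_mult_mat[of _ m m _ m _ m])
  then show "V * A * W * (V * B * W) = V * (A * B) * W"
    using assms by (simp add: assoc_mult_mat[of _ m m _ m _ m])
  have "V * A * W * V = V * A * (W * V)"
    using assms(1-4) by (simp add: assoc_mult_mat[of _ m m _ m _ m])
  then show "V * A * W * V = V * A" using assms by simp
qed

text \<open>Multiplied by \<open>V\<close>, the diagonalization becomes an intertwining relation,
  which carries the diagonal case over to \<open>A\<close>; \<open>V * W = 1\<^sub>m m\<close> then
  removes \<open>V\<close> on the right.\<close>

lemma eproj_eq: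
  assumes "similar_mat_wit A (mat_diag m d) V W" "A \<in> carrier_mat m m"
    and "inj_on d {..<m}" "i < m"
  shows "eproj m d i A = V * mat_diag m (\<lambda>k. if k = i then 1 else 0) * W"
proof -
  note w = similar_mat_witD2[OF assms(2,1)]
  have "A * V = V * mat_diag m d"
    using conj_mult_mat(2)[OF w(5,5,6,7,2)] unfolding w(3)[symmetric] .
  then have "eproj m d i A * V = V * mat_diag m (\<lambda>k. if k = i then 1 else 0)"
    using w eproj_intertwine[of A m "mat_diag m d" V d i] eproj_diag[OF assms(3,4)] by simp
  then have "eproj m d i A * V * W = V * mat_diag m (\<lambda>k. if k = i then 1 else 0) * W" by simp
  moreover have "eproj m d i A * V * W = eproj m d i A"
    using w(1,6,7) assms(2) by (simp add: assoc_mult_mat[of _ m m _ m _ m] right_mult_one_mat[of _ m m])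
  ultimately show ?thesis by simp
qed

lemma eproj_idem:
  assumes "similar_mat A (mat_diag m d)" "A \<in> carrier_mat m m" "inj_on d {..<m}" "i < m"
  shows "eproj m d i A * eproj m d i A = eproj m d i A"
proof -
  obtain V W where s: "similar_mat_wit A (mat_diag m d) V W"
    using assms(1) unfolding similar_mat_def by blast
  note w = similar_mat_witD2[OF assms(2) s]
  let ?E = "mat_diag m (\<lambda>k. if k = i then 1 else 0) :: complex mat"
  have E: "?E \<in> carrier_mat m m" "?E * ?E = ?E"
    by (simp, unfold mat_diag_diag) (auto simp: mat_diag_def)
  have "V * ?E * W * (V * ?E * W) = V * ?E * W"
    using conj_mult_mat(1)[OF E(1) E(1) w(6,7,2)] unfolding E(2) .
  then show ?thesis unfolding eproj_eq[OF s assms(2-4)] .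
qed

lemma eproj_commute:
  "A \<in> carrier_mat m m \<Longrightarrow> eproj m d i A * A = A * eproj m d i A"
  by (rule eproj_intertwine) auto

section \<open>Spectra and diagonalization\<close>

lemma spectrum_diag:
  fixes d :: "nat \<Rightarrow> complex"
  shows "spectrum (mat_diag m d) = d ` {..<m}"
proof -
  have u: "upper_triangular (mat_diag m d)" by (auto simp: mat_diag_def)
  have "diag_mat (mat_diag m d) = map d [0..<m]" by (auto simp: diag_mat_def mat_diag_def)
  then show ?thesis
    unfolding spectrum_root_char_poly[OF mat_diag_dim] char_poly_upper_triangular[OF mat_diag_dim u]
    by (auto simp: poly_prod_list prod_list_zero_iff o_def image_iff)
qed

lemma spectrum_similar: "similar_mat A B \<Longrightarrow> spectrum A = spectrum B" for A B :: "complex mat"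
  by (metis char_poly_similar similar_matD spectrum_root_char_poly insert_subset)

text \<open>Eigenvectors for distinct eigenvalues are independent, so the matrix with these columns
  diagonalizes \<open>A\<close>. This is how a nearby matrix is recognized as part of a point of the
  variety from its eigenvalues alone.\<close>

lemma similar_diag_of_distinct_eigenvalues:
  fixes A :: "complex mat"
  assumes A: "A \<in> carrier_mat m m" and inj: "inj_on d {..<m}"
    and ev: "\<And>i. i < m \<Longrightarrow> d i \<in> spectrum A"
  shows "similar_mat A (mat_diag m d)"
proof -
  have "\<forall>i. \<exists>v. i < m \<longrightarrow> v \<in> carrier_vec m \<and> v \<noteq> 0\<^sub>v m \<and> A *\<^sub>v v = d i \<cdot>\<^sub>v v"
    using ev A unfolding spectrum_def eigenvalue_def eigenvector_def by force
  then obtain v where v: "\<And>i. i < m \<Longrightarrow> v i \<in> carrier_vec m \<and> v i \<noteq> 0\<^sub>v m \<and> A *\<^sub>v v i = d i \<cdot>\<^sub>v v i"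
    by metis
  define V where "V = Matrix.mat m m (\<lambda>(a, i). v i $ a)"
  have V: "V \<in> carrier_mat m m" by (simp add: V_def)
  have colV: "col V i = v i" if "i < m" for i
    using v[OF that] that by (auto simp: V_def intro!: eq_vecI)
  have AV: "A * V = V * mat_diag m d"
  proof (rule eq_matI)
    fix a i assume ai: "a < dim_row (V * mat_diag m d)" "i < dim_col (V * mat_diag m d)"
    then have ai: "a < m" "i < m" using V by (auto simp: mat_diag_def)
    have "(A * V) $$ (a, i) = (A *\<^sub>v v i) $ a"
      using ai A V colV by simp
    also have "\<dots> = d i * v i $ a" using v[OF ai(2)] ai by (metis carrier_vecD index_smult_vec(1))
    also have "\<dots> = (V * mat_diag m d) $$ (a, i)"
      using ai mat_diag_mult_right[OF V, of d] by (simp add: V_def)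
    finally show "(A * V) $$ (a, i) = (V * mat_diag m d) $$ (a, i)" .
  qed (use A V in \<open>auto simp: mat_diag_def\<close>)
  have "det V \<noteq> 0"
  proof
    assume "det V = 0"
    then obtain u where u: "u \<in> carrier_vec m" "u \<noteq> 0\<^sub>v m" "V *\<^sub>v u = 0\<^sub>v m"
      using det_0_iff_vec_prod_zero[OF V] by auto
    have "u $ i = 0" if i: "i < m" for i
    proof -
      \<comment> \<open>The spectral projection isolates one coordinate of a kernel vector: applied
        to \<open>V *\<^sub>v u\<close>, which is zero, it leaves \<open>u $ i\<close> times the
        nonzero eigenvector \<open>v i\<close>.\<close>
      let ?E = "mat_diag m (\<lambda>k. if k = i then 1 else 0) :: complex mat"
      have "eproj m d i A * V = V * ?E"
        using eproj_intertwine[OF A mat_diag_dim V AV] eproj_diag[OF inj i] by simp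
      then have "V *\<^sub>v (?E *\<^sub>v u) = eproj m d i A *\<^sub>v (V *\<^sub>v u)"
        using V u(1) A by (simp add: assoc_mult_mat_vec[of _ m m _ m, symmetric])
      also have "\<dots> = 0\<^sub>v m" using u A by (auto simp: scalar_prod_def intro!: eq_vecI)
      finally have z: "V *\<^sub>v (?E *\<^sub>v u) = 0\<^sub>v m" .
      have E: "?E *\<^sub>v u = vec m (\<lambda>k. if k = i then u $ i else 0)"
        using u i by (auto simp: mat_diag_def scalar_prod_def if_distrib[of "\<lambda>x. x * _"] 
            intro!: eq_vecI cong: if_cong)
      have "V *\<^sub>v (?E *\<^sub>v u) = u $ i \<cdot>\<^sub>v v i"
        unfolding E using V v[OF i] i
        by (intro eq_vecI) (auto simp: V_def scalar_prod_def if_distrib[of "\<lambda>x. _ * x"] cong: if_cong)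
      then have "u $ i \<cdot>\<^sub>v v i = 0\<^sub>v m" using z by simp
      then show "u $ i = 0"
        using v[OF i] by (metis (no_types, opaque_lifting) carrier_vecD eq_vecI index_smult_vec(1,2) 
            index_zero_vec(1,2) mult_eq_0_iff)
    qed
    then have "u = 0\<^sub>v m" using u by (intro eq_vecI) auto
    then show False using u by simp
  qed
  then obtain W where W: "W \<in> carrier_mat m m" "W * V = 1\<^sub>m m" "V * W = 1\<^sub>m m"
    using det_non_zero_imp_unit[OF V, of "()"] by (auto simp: Units_def ring_mat_def)
  have "A = V * mat_diag m d * W"
    using A V W by (simp add: AV[symmetric] assoc_mult_mat[of _ m m _ m _ m])
  then show ?thesis using A V W by (intro similar_matI[of _ _ V W m]) auto
qed

section \<open>Gradients and curves of matrices\<close>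

lemma mat_trace_mult:
  assumes "G \<in> carrier_mat n n" "Y \<in> carrier_mat n n"
  shows "mat_trace (G * Y) = (\<Sum>i<n. \<Sum>k<n. G $$ (i, k) * Y $$ (k, i))"
  using assms unfolding mat_trace_def
  by (auto simp: scalar_prod_def lessThan_atLeast0 intro!: sum.cong)

lemma mat_trace_comm:
  assumes "A \<in> carrier_mat n n" "B \<in> carrier_mat n n"
  shows "mat_trace (A * B) = mat_trace (B * A)"
  unfolding mat_trace_mult[OF assms] mat_trace_mult[OF assms(2,1)]
  by (subst sum.swap) (simp add: mult.commute)

lemma mat_trace_minus:
  assumes "A \<in> carrier_mat n n" "B \<in> carrier_mat n n"
  shows "mat_trace (A - B) = mat_trace A - mat_trace B"
  using assms by (simp add: mat_trace_def sum_subtractf)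

lemma mat_norm_eq: "A \<in> carrier_mat n n \<Longrightarrow> mat_norm A = (\<Sum>i<n. \<Sum>j<n. cmod (A $$ (i, j)))"
  by (auto simp: mat_norm_def)

lemma mat_norm_diff:
  "A \<in> carrier_mat n n \<Longrightarrow> B \<in> carrier_mat n n \<Longrightarrow>
    mat_norm (A - B) = (\<Sum>i<n. \<Sum>j<n. cmod (A $$ (i, j) - B $$ (i, j)))"
  by (auto simp: mat_norm_def)

lemma mat_norm_nonneg: "0 \<le> mat_norm A"
  by (auto simp: mat_norm_def intro!: sum_nonneg)

lemma entry_le_mat_norm:
  assumes "A \<in> carrier_mat n n" "i < n" "j < n"
  shows "cmod (A $$ (i, j)) \<le> mat_norm A"
proof -
  have "cmod (A $$ (i, j)) \<le> (\<Sum>j<n. cmod (A $$ (i, j)))"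
    using assms by (intro member_le_sum) auto
  also have "\<dots> \<le> mat_norm A"
    unfolding mat_norm_eq[OF assms(1)] using assms
    by (intro member_le_sum[where f = "\<lambda>i. \<Sum>j<n. cmod (A $$ (i, j))"]) (auto intro: sum_nonneg)
  finally show ?thesis .
qed

lemma mat_norm_mult:
  assumes A: "A \<in> carrier_mat n n" and B: "B \<in> carrier_mat n n"
  shows "mat_norm (A * B) \<le> mat_norm A * mat_norm B"
proof -
  have "mat_norm (A * B) = (\<Sum>i<n. \<Sum>j<n. cmod (\<Sum>k<n. A $$ (i, k) * B $$ (k, j)))"
    using A B by (simp add: mat_norm_eq[of _ n] scalar_prod_def lessThan_atLeast0)
  also have "\<dots> \<le> (\<Sum>i<n. \<Sum>j<n. \<Sum>k<n. cmod (A $$ (i, k)) * cmod (B $$ (k, j)))"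
    by (intro sum_mono sum_norm_le) (simp add: norm_mult)
  also have "\<dots> = (\<Sum>i<n. \<Sum>k<n. cmod (A $$ (i, k)) * (\<Sum>j<n. cmod (B $$ (k, j))))"
    by (rule sum.cong[OF refl], subst sum.swap) (simp add: sum_distrib_left)
  also have "\<dots> \<le> (\<Sum>i<n. \<Sum>k<n. cmod (A $$ (i, k)) * mat_norm B)"
    unfolding mat_norm_eq[OF B]
    by (intro sum_mono mult_left_mono member_le_sum[where f = "\<lambda>i. \<Sum>j<n. cmod (B $$ (i, j))"])
      (auto intro: sum_nonneg)
  also have "\<dots> = mat_norm A * mat_norm B"
    by (simp add: mat_norm_eq[OF A] sum_distrib_right)
  finally show ?thesis .
qed

text \<open>Neighbourhoods within the matrices of one fixed size, as a filter. They are not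
  punctured: a property that holds eventually holds at \<open>x\<close> as well, which matters for
  germs of functions.\<close>

definition mat_nhds :: "nat \<Rightarrow> complex mat \<Rightarrow> complex mat filter" where
  "mat_nhds n x = inf (filtercomap (\<lambda>y. mat_norm (y - x)) (nhds 0)) (principal (carrier_mat n n))"

lemma eventually_mat_nhds:
  "eventually P (mat_nhds n x) \<longleftrightarrow>
     (\<exists>\<delta>>0. \<forall>y\<in>carrier_mat n n. mat_norm (y - x) < \<delta> \<longrightarrow> P y)"
proof -
  have "eventually P (mat_nhds n x) \<longleftrightarrow>
      (\<exists>Q. (\<exists>d>0. \<forall>t. dist t 0 < d \<longrightarrow> Q t) \<and> (\<forall>y. Q (mat_norm (y - x)) \<longrightarrow> y \<in> carrier_mat n n \<longrightarrow> P y))"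
    unfolding mat_nhds_def eventually_inf_principal eventually_filtercomap eventually_nhds_metric ..
  also have "\<dots> \<longleftrightarrow> (\<exists>\<delta>>0. \<forall>y\<in>carrier_mat n n. mat_norm (y - x) < \<delta> \<longrightarrow> P y)"
  proof safe
    fix Q :: "real \<Rightarrow> bool" and d
    assume "\<forall>y. Q (mat_norm (y - x)) \<longrightarrow> y \<in> carrier_mat n n \<longrightarrow> P y" "0 < (d::real)"
      and "\<forall>t. dist t 0 < d \<longrightarrow> Q t"
    then show "\<exists>\<delta>>0. \<forall>y\<in>carrier_mat n n. mat_norm (y - x) < \<delta> \<longrightarrow> P y"
      using mat_norm_nonneg by (intro exI[of _ d]) (auto simp: dist_real_def)
  next
    fix \<delta> :: real
    assume "\<delta> > 0" "\<forall>y\<in>carrier_mat n n. mat_norm (y - x) < \<delta> \<longrightarrow> P y"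
    then show "\<exists>Q. (\<exists>d>0. \<forall>t. dist t 0 < d \<longrightarrow> Q t) \<and>
        (\<forall>y. Q (mat_norm (y - x)) \<longrightarrow> y \<in> carrier_mat n n \<longrightarrow> P y)"
      by (intro exI[of _ "\<lambda>t. t < \<delta>"] conjI exI[of _ \<delta>]) (auto simp: dist_real_def)
  qed
  finally show ?thesis .
qed

lemma mat_norm_diff_self [simp]: "x \<in> carrier_mat n n \<Longrightarrow> mat_norm (x - x) = 0"
  by (simp add: mat_norm_def)

lemma eventually_mat_nhds_self:
  "eventually P (mat_nhds n x) \<Longrightarrow> x \<in> carrier_mat n n \<Longrightarrow> P x"
  unfolding eventually_mat_nhds using mat_norm_diff_self by metis

lemma eventually_mat_nhds_carrier: "eventually (\<lambda>y. y \<in> carrier_mat n n) (mat_nhds n x)"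
  unfolding eventually_mat_nhds by (auto intro: exI[of _ 1])

text \<open>Triangle inequality with half the radius. A local inverse must have gradients at all
  points near the base point, so a property known near \<open>x\<close> has to be moved to
  neighbourhoods of nearby points.\<close>

lemma eventually_eventually_mat_nhds:
  assumes "eventually P (mat_nhds n x)" "x \<in> carrier_mat n n"
  shows "eventually (\<lambda>y. eventually P (mat_nhds n y)) (mat_nhds n x)"
proof -
  obtain \<delta> where d: "\<delta> > 0" "\<And>y. y \<in> carrier_mat n n \<Longrightarrow> mat_norm (y - x) < \<delta> \<Longrightarrow> P y"
    using assms unfolding eventually_mat_nhds by auto
  have "eventually P (mat_nhds n y)" if y: "y \<in> carrier_mat n n" "mat_norm (y - x) < \<delta> / 2" for y
    unfolding eventually_mat_nhds
  proof (intro exI[of _ "\<delta> / 2"] conjI ballI impI)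
    fix z assume z: "z \<in> carrier_mat n n" "mat_norm (z - y) < \<delta> / 2"
    have "mat_norm (z - x) \<le>
        (\<Sum>i<n. \<Sum>j<n. cmod (z $$ (i, j) - y $$ (i, j)) + cmod (y $$ (i, j) - x $$ (i, j)))"
      unfolding mat_norm_diff[OF z(1) assms(2)]
      by (intro sum_mono order_trans[OF _ norm_triangle_ineq]) simp
    also have "\<dots> = mat_norm (z - y) + mat_norm (y - x)"
      by (simp add: mat_norm_diff[OF z(1) y(1)] mat_norm_diff[OF y(1) assms(2)] sum.distrib)
    finally show "P z" using d(2) z y by simp
  qed (use d in auto)
  then show ?thesis
    using d(1) by (subst eventually_mat_nhds) (auto intro!: exI[of _ "\<delta> / 2"])
qed

lemma tendsto_mat_entry:
  assumes "x \<in> carrier_mat n n" "i < n" "j < n"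
  shows "((\<lambda>y. y $$ (i, j)) \<longlongrightarrow> x $$ (i, j)) (mat_nhds n x)"
proof (rule tendstoI)
  fix e :: real assume e: "e > 0"
  show "eventually (\<lambda>y. dist (y $$ (i, j)) (x $$ (i, j)) < e) (mat_nhds n x)"
    unfolding eventually_mat_nhds
  proof (intro exI[of _ e] conjI ballI impI e)
    fix y assume y: "y \<in> carrier_mat n n" "mat_norm (y - x) < e"
    then show "dist (y $$ (i, j)) (x $$ (i, j)) < e"
      using entry_le_mat_norm[OF minus_carrier_mat[OF assms(1)], of i j y] assms by (simp add: dist_norm)
  qed
qed

lemma filterlim_mat_nhds:
  assumes "x \<in> carrier_mat n n" "\<And>s. X s \<in> carrier_mat n n"
    and "\<And>i j. i < n \<Longrightarrow> j < n \<Longrightarrow> ((\<lambda>s. X s $$ (i, j)) \<longlongrightarrow> x $$ (i, j)) F"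
  shows "filterlim X (mat_nhds n x) F"
proof -
  have "((\<lambda>s. \<Sum>i<n. \<Sum>j<n. cmod (X s $$ (i, j) - x $$ (i, j))) \<longlongrightarrow> (\<Sum>i<n. \<Sum>j<n. cmod (0::complex))) F"
    using assms(3) by (intro tendsto_sum tendsto_norm) (auto simp: LIM_zero_iff)
  moreover have "mat_norm (X s - x) = (\<Sum>i<n. \<Sum>j<n. cmod (X s $$ (i, j) - x $$ (i, j)))" for s
    using assms(1) assms(2)[of s] by (rule mat_norm_diff[rotated])
  ultimately have "((\<lambda>s. mat_norm (X s - x)) \<longlongrightarrow> 0) F" by simp
  then show ?thesis
    unfolding mat_nhds_def filterlim_inf filterlim_principal filterlim_filtercomap_iff
    using assms(2) by (simp add: o_def)
qed

section \<open>Differentiable curves of matrices and the chain rule\<close>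

definition has_mat_deriv :: "nat \<Rightarrow> (complex \<Rightarrow> complex mat) \<Rightarrow> complex mat \<Rightarrow> complex \<Rightarrow> bool" where
  "has_mat_deriv n X X' q \<longleftrightarrow> (\<forall>s. X s \<in> carrier_mat n n) \<and> X' \<in> carrier_mat n n \<and>
     (\<forall>i<n. \<forall>j<n. ((\<lambda>s. X s $$ (i, j)) has_field_derivative X' $$ (i, j)) (at q))"

lemma has_mat_deriv_const:
  "A \<in> carrier_mat n n \<Longrightarrow> has_mat_deriv n (\<lambda>s. A) (0\<^sub>m n n) q"
  by (auto simp: has_mat_deriv_def)

lemma has_mat_deriv_line:
  assumes "A \<in> carrier_mat n n" "B \<in> carrier_mat n n" "(f has_field_derivative f') (at q)"
  shows "has_mat_deriv n (\<lambda>s. A + f s \<cdot>\<^sub>m B) (f' \<cdot>\<^sub>m B) q"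
  using assms by (auto simp: has_mat_deriv_def intro!: derivative_eq_intros)

lemma has_mat_deriv_mult:
  assumes "has_mat_deriv n X X' q" "has_mat_deriv n Y Y' q"
  shows "has_mat_deriv n (\<lambda>s. X s * Y s) (X' * Y q + X q * Y') q"
proof -
  have c: "X s \<in> carrier_mat n n" "Y s \<in> carrier_mat n n"
    "X' \<in> carrier_mat n n" "Y' \<in> carrier_mat n n" for s
    using assms by (auto simp: has_mat_deriv_def)
  have e: "(A * B) $$ (i, j) = (\<Sum>k<n. A $$ (i, k) * B $$ (k, j))"
    if "A \<in> carrier_mat n n" "B \<in> carrier_mat n n" "i < n" "j < n" for A B :: "complex mat" and i j
    using that by (simp add: scalar_prod_def lessThan_atLeast0)
  have "((\<lambda>s. \<Sum>k<n. X s $$ (i, k) * Y s $$ (k, j)) has_field_derivative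
     (\<Sum>k<n. X' $$ (i, k) * Y q $$ (k, j) + X q $$ (i, k) * Y' $$ (k, j))) (at q)"
    if "i < n" "j < n" for i j
    using assms that unfolding has_mat_deriv_def
    by (intro DERIV_sum) (auto intro!: derivative_eq_intros)
  moreover have "(X' * Y q + X q * Y') $$ (i, j) = 
     (\<Sum>k<n. X' $$ (i, k) * Y q $$ (k, j) + X q $$ (i, k) * Y' $$ (k, j))"
     if "i < n" "j < n" for i j
  proof -
    have "(X' * Y q + X q * Y') $$ (i, j) = (X' * Y q) $$ (i, j) + (X q * Y') $$ (i, j)"
      using that c(1)[of q] c(4) by (intro index_add_mat(1)) auto
    then show ?thesis using that c by (simp only: e sum.distrib)
  qed
  moreover have "(X s * Y s) $$ (i, j) = (\<Sum>k<n. X s $$ (i, k) * Y s $$ (k, j))" 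
    if "i < n" "j < n" for i j s
    using that c by (simp only: e)
  moreover have "X s * Y s \<in> carrier_mat n n" "X' * Y q + X q * Y' \<in> carrier_mat n n" for s
    using c by (meson add_carrier_mat mult_carrier_mat)+
  ultimately show ?thesis
    unfolding has_mat_deriv_def by (simp del: index_mult_mat(1) index_add_mat(1))
qed

lemma has_mat_deriv_filterlim:
  assumes "has_mat_deriv n X X' q"
  shows "filterlim X (mat_nhds n (X q)) (at q)"
  using assms unfolding has_mat_deriv_def
  by (intro filterlim_mat_nhds) (auto intro: isContD[OF DERIV_isCont])

lemma mat_trace_has_deriv:
  assumes "G \<in> carrier_mat n n" "has_mat_deriv n X X' q"
  shows "((\<lambda>s. mat_trace (G * X s)) has_field_derivative mat_trace (G * X')) (at q)"
proof -
  have "((\<lambda>s. \<Sum>i<n. \<Sum>k<n. G $$ (i, k) * X s $$ (k, i)) has_field_derivative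
     (\<Sum>i<n. \<Sum>k<n. G $$ (i, k) * X' $$ (k, i))) (at q)"
    using assms(2) unfolding has_mat_deriv_def
    by (intro DERIV_sum DERIV_cmult) auto
  then show ?thesis
    using assms by (simp add: mat_trace_mult[of _ n] has_mat_deriv_def)
qed

text \<open>After the linear part \<open>mat_trace (G * X s)\<close> is subtracted, what remains is
  of smaller order than \<open>mat_norm (X s - X q)\<close>, and that norm is at most of the order
  of the increment of the parameter.\<close>

lemma has_gradient_chain:
  assumes f: "has_gradient n f (X q) G" and X: "has_mat_deriv n X X' q"
  shows "((\<lambda>s. f (X s)) has_field_derivative mat_trace (G * X')) (at q)"
proof -
  have G: "G \<in> carrier_mat n n" using f by (simp add: has_gradient_def)
  have Xc: "\<And>s. X s \<in> carrier_mat n n" "X' \<in> carrier_mat n n"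
    using X by (auto simp: has_mat_deriv_def)
  define h where "h s = f (X s) - mat_trace (G * X s)" for s
  define K where "K = mat_norm X'"
  have hd: "h s - h q = f (X s) - f (X q) - mat_trace (G * (X s - X q))" for s
    using mat_trace_minus[OF mult_carrier_mat[OF G Xc(1)[of s]] mult_carrier_mat[OF G Xc(1)[of q]]]
    by (simp add: h_def mult_minus_distrib_mat[OF G Xc(1) Xc(1)])
  have R: "((\<lambda>s. mat_norm (X s - X q) / cmod (s - q)) \<longlongrightarrow> K) (at q)"
  proof -
    have "((\<lambda>s. \<Sum>i<n. \<Sum>j<n. cmod ((X s $$ (i, j) - X q $$ (i, j)) / (s - q))) \<longlongrightarrow>
       (\<Sum>i<n. \<Sum>j<n. cmod (X' $$ (i, j)))) (at q)"
      using X by (intro tendsto_sum tendsto_norm) (auto simp: has_mat_deriv_def has_field_derivative_iff)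
    moreover have "mat_norm (X s - X q) / cmod (s - q) =
       (\<Sum>i<n. \<Sum>j<n. cmod ((X s $$ (i, j) - X q $$ (i, j)) / (s - q)))" for s
      unfolding mat_norm_diff[OF Xc(1)[of s] Xc(1)[of q]] by (simp add: norm_divide sum_divide_distrib)
    ultimately show ?thesis using Xc by (simp add: K_def mat_norm_eq[of _ n])
  qed
  have K: "K \<ge> 0" by (simp add: K_def mat_norm_nonneg)
  have "(h has_field_derivative 0) (at q)"
    unfolding has_field_derivative_iff
  proof (rule tendstoI)
    fix e :: real assume e: "e > 0"
    \<comment> \<open>The difference quotients of the norm tend to \<open>K\<close>, hence are
      eventually below \<open>K + 1\<close>; the extra 1 also keeps the denominator positive when
      \<open>X'\<close> is zero.\<close>
    define \<epsilon> where "\<epsilon> = e / (K + 1)"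
    have \<epsilon>: "\<epsilon> > 0" using e K by (simp add: \<epsilon>_def)
    have "eventually (\<lambda>y. cmod (f y - f (X q) - mat_trace (G * (y - X q))) \<le> \<epsilon> * mat_norm (y - X q))
       (mat_nhds n (X q))"
      using f \<epsilon> unfolding has_gradient_def eventually_mat_nhds by blast
    then have 1: "eventually (\<lambda>s. cmod (h s - h q) \<le> \<epsilon> * mat_norm (X s - X q)) (at q)"
      unfolding hd using has_mat_deriv_filterlim[OF X] by (rule eventually_compose_filterlim)
    have 2: "eventually (\<lambda>s. mat_norm (X s - X q) / cmod (s - q) < K + 1) (at q)"
      using R by (rule order_tendstoD) simp
    show "eventually (\<lambda>s. dist ((h s - h q) / (s - q)) 0 < e) (at q)"
      using 1 2 eventually_neq_at_within[of q q UNIV]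
    proof eventually_elim
      case (elim s)
      have "cmod (h s - h q) / cmod (s - q) \<le> \<epsilon> * (mat_norm (X s - X q) / cmod (s - q))"
        using elim(1) by (simp add: divide_right_mono)
      also have "\<dots> < \<epsilon> * (K + 1)" using elim(2) \<epsilon> by (rule mult_strict_left_mono)
      also have "\<dots> = e" using K by (simp add: \<epsilon>_def)
      finally show ?case by (simp add: norm_divide)
    qed
  qed
  from DERIV_add[OF this mat_trace_has_deriv[OF G X]] show ?thesis by (simp add: h_def)
qed

text \<open>Directional derivatives along matrix units determine all entries of the gradient. This
  makes the definite description in \<open>gradient\<close> meaningful.\<close>

lemma has_gradient_unique:
  assumes "has_gradient n f x G" "has_gradient n f x H" "x \<in> carrier_mat n n"
  shows "G = H"
proof -
  have c: "G \<in> carrier_mat n n" "H \<in> carrier_mat n n" using assms by (auto simp: has_gradient_def)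
  have "G $$ (a, b) = H $$ (a, b)" if ab: "a < n" "b < n" for a b
  proof -
    \<comment> \<open>The trace form transposes indices: the unit at \<open>(b, a)\<close> reads off
      the entry at \<open>(a, b)\<close>.\<close>
    define v where "v = Matrix.mat n n (\<lambda>(i, j). if i = b \<and> j = a then 1 else 0 :: complex)"
    have v: "v \<in> carrier_mat n n" by (simp add: v_def)
    have d: "has_mat_deriv n (\<lambda>s. x + s \<cdot>\<^sub>m v) (1 \<cdot>\<^sub>m v) 0"
      using assms(3) v by (intro has_mat_deriv_line) auto
    have x0: "x + 0 \<cdot>\<^sub>m v = x" using assms(3) v by auto
    have "mat_trace (G * (1 \<cdot>\<^sub>m v)) = mat_trace (H * (1 \<cdot>\<^sub>m v))"
      using assms(1,2) by (intro DERIV_unique[OF has_gradient_chain has_gradient_chain, OF _ d _ d]) (simp_all add: x0)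
    moreover have "mat_trace (A * (1 \<cdot>\<^sub>m v)) = A $$ (a, b)" if A: "A \<in> carrier_mat n n" for A
    proof -
      have "mat_trace (A * (1 \<cdot>\<^sub>m v)) = (\<Sum>i<n. \<Sum>k<n. if i = a then if k = b then A $$ (i, k) else 0 else 0)"
        using A v by (auto simp: mat_trace_mult[of _ n] v_def intro!: sum.cong)
      also have "\<dots> = (\<Sum>i<n. if i = a then \<Sum>k<n. if k = b then A $$ (i, k) else 0 else 0)"
        by (intro sum.cong) auto
      also have "\<dots> = A $$ (a, b)" using ab by simp
      finally show ?thesis .
    qed
    ultimately show ?thesis using c by simp
  qed
  then show ?thesis using c by (intro eq_matI) auto
qed

lemma gradient_eq:
  "has_gradient n f x G \<Longrightarrow> x \<in> carrier_mat n n \<Longrightarrow> gradient n f x = G"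
  unfolding gradient_def using has_gradient_unique by blast

text \<open>A gradient depends only on the germ of the function; the two functions also agree at
  \<open>x\<close>, since the neighbourhoods contain \<open>x\<close>.\<close>

lemma has_gradient_cong:
  assumes "eventually (\<lambda>y. f y = g y) (mat_nhds n x)" "x \<in> carrier_mat n n" "has_gradient n f x G"
  shows "has_gradient n g x G"
  unfolding has_gradient_def
proof (intro conjI allI impI)
  fix \<epsilon> :: real assume "\<epsilon> > 0"
  then have "eventually (\<lambda>y. cmod (f y - f x - mat_trace (G * (y - x))) \<le> \<epsilon> * mat_norm (y - x)) (mat_nhds n x)"
    using assms(3) unfolding has_gradient_def eventually_mat_nhds by blast
  with assms(1) have "eventually (\<lambda>y. cmod (g y - g x - mat_trace (G * (y - x))) \<le> \<epsilon> * mat_norm (y - x)) (mat_nhds n x)"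
    by eventually_elim (simp add: eventually_mat_nhds_self[OF assms(1,2)])
  then show "\<exists>\<delta>>0. \<forall>y\<in>carrier_mat n n. mat_norm (y - x) < \<delta> \<longrightarrow>
      cmod (g y - g x - mat_trace (G * (y - x))) \<le> \<epsilon> * mat_norm (y - x)"
    unfolding eventually_mat_nhds .
qed (use assms(3) in \<open>simp add: has_gradient_def\<close>)

lemma has_gradient_entry:
  assumes "x \<in> carrier_mat n n" "a < n" "b < n"
  shows "\<exists>G. has_gradient n (\<lambda>y. y $$ (a, b)) x G"
proof -
  define G where "G = Matrix.mat n n (\<lambda>(i, j). if i = b \<and> j = a then 1 else 0 :: complex)"
  have G: "G \<in> carrier_mat n n" by (simp add: G_def)
  have "mat_trace (G * v) = v $$ (a, b)" if v: "v \<in> carrier_mat n n" for v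
  proof -
    have "mat_trace (G * v) = (\<Sum>i<n. \<Sum>k<n. if i = b then if k = a then v $$ (k, i) else 0 else 0)"
      unfolding mat_trace_mult[OF G v] by (auto simp: G_def intro!: sum.cong)
    also have "\<dots> = (\<Sum>i<n. if i = b then \<Sum>k<n. if k = a then v $$ (k, i) else 0 else 0)"
      by (intro sum.cong) auto
    also have "\<dots> = v $$ (a, b)" using assms by simp
    finally show ?thesis .
  qed
  then have "has_gradient n (\<lambda>y. y $$ (a, b)) x G"
    unfolding has_gradient_def using assms G
    by (auto simp: minus_carrier_mat intro!: exI[of _ 1] mult_nonneg_nonneg mat_norm_nonneg)
  then show ?thesis ..
qed

section \<open>Perturbation of simple eigenvalues\<close>

definition pad :: "nat \<Rightarrow> nat \<Rightarrow> complex mat \<Rightarrow> complex mat" where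
  "pad n m A = Matrix.mat n n (\<lambda>(i, j). if i < m \<and> j < m then A $$ (i, j) else 0)"

lemma pad_carrier [simp, intro]: "pad n m A \<in> carrier_mat n n"
  by (simp add: pad_def)

lemma cutoff_carrier [simp, intro]: "cutoff m x \<in> carrier_mat m m"
  by (simp add: cutoff_def)

lemma pad_dim [simp]: "dim_row (pad n m A) = n" "dim_col (pad n m A) = n"
  by (simp_all add: pad_def)

lemma cutoff_dim [simp]: "dim_row (cutoff m x) = m" "dim_col (cutoff m x) = m"
  by (simp_all add: cutoff_def)

lemma sum_pad:
  fixes f :: "nat \<Rightarrow> 'a :: comm_monoid_add"
  assumes "m \<le> n"
  shows "(\<Sum>k<n. if k < m then f k else 0) = (\<Sum>k<m. f k)"
proof -
  have "(\<Sum>k<n. if k < m then f k else 0) = (\<Sum>k\<in>{..<n} \<inter> {k. k < m}. f k)"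
    by (simp add: sum.If_cases)
  also have "{..<n} \<inter> {k. k < m} = {..<m}" using assms by auto
  finally show ?thesis .
qed

text \<open>Padding is adjoint to \<open>cutoff\<close> for the trace form, so a function of the
  cutoff alone has the padded matrix as its gradient.\<close>

lemma mat_trace_pad:
  assumes "m \<le> n" "A \<in> carrier_mat m m" "y \<in> carrier_mat n n"
  shows "mat_trace (pad n m A * y) = mat_trace (A * cutoff m y)"
proof -
  have "mat_trace (pad n m A * y) =
      (\<Sum>i<n. \<Sum>k<n. if i < m then if k < m then A $$ (i, k) * y $$ (k, i) else 0 else 0)"
    unfolding mat_trace_mult[OF pad_carrier assms(3)] by (intro sum.cong refl) (auto simp: pad_def)
  also have "\<dots> = (\<Sum>i<n. if i < m then \<Sum>k<n. if k < m then A $$ (i, k) * y $$ (k, i) else 0 else 0)"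
    by (intro sum.cong) auto
  also have "\<dots> = (\<Sum>i<m. \<Sum>k<m. A $$ (i, k) * y $$ (k, i))"
    by (simp only: sum_pad[OF assms(1)])
  also have "\<dots> = mat_trace (A * cutoff m y)"
    unfolding mat_trace_mult[OF assms(2) cutoff_carrier] by (simp add: cutoff_def)
  finally show ?thesis .
qed

lemma cutoff_minus:
  "m \<le> n \<Longrightarrow> x \<in> carrier_mat n n \<Longrightarrow> y \<in> carrier_mat n n \<Longrightarrow> cutoff m (y - x) = cutoff m y - cutoff m x"
  by (auto simp: cutoff_def intro!: eq_matI)

lemma mat_norm_cutoff_le:
  assumes "m \<le> n" "x \<in> carrier_mat n n"
  shows "mat_norm (cutoff m x) \<le> mat_norm x"
proof -
  have "mat_norm (cutoff m x) = (\<Sum>i<m. \<Sum>j<m. cmod (x $$ (i, j)))"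
    unfolding mat_norm_eq[OF cutoff_carrier] by (simp add: cutoff_def)
  also have "\<dots> \<le> (\<Sum>i<m. \<Sum>j<n. cmod (x $$ (i, j)))"
    using assms by (intro sum_mono sum_mono2) auto
  also have "\<dots> \<le> (\<Sum>i<n. \<Sum>j<n. cmod (x $$ (i, j)))"
    using assms by (intro sum_mono2 sum_nonneg) auto
  finally show ?thesis by (simp add: mat_norm_eq[OF assms(2)])
qed

text \<open>A Gershgorin argument. In an eigenvector for \<mu> the rows other than \<open>k\<close>
  force the entries other than \<open>k\<close> to be smaller than the largest one by the factor
  \<open>mat_norm E / c\<close>; inserted into row \<open>k\<close>, this leaves an error that is
  quadratic in \<open>E\<close>.\<close>

lemma eigenvalue_diag_perturbation:
  assumes E: "E \<in> carrier_mat m m" and k: "k < m"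
    and ev: "\<mu> \<in> spectrum (mat_diag m d + E)"
    and sep: "\<And>i. i < m \<Longrightarrow> i \<noteq> k \<Longrightarrow> c \<le> cmod (\<mu> - d i)"
    and small: "mat_norm E < c"
  shows "cmod (\<mu> - d k - E $$ (k, k)) \<le> (mat_norm E)\<^sup>2 / c"
proof -
  have c: "c > 0" using small mat_norm_nonneg[of E] by linarith
  obtain v where v: "v \<in> carrier_vec m" "v \<noteq> 0\<^sub>v m" "(mat_diag m d + E) *\<^sub>v v = \<mu> \<cdot>\<^sub>v v"
    using ev E unfolding spectrum_def eigenvalue_def eigenvector_def by auto
  have row: "(\<mu> - d i) * v $ i = (\<Sum>j<m. E $$ (i, j) * v $ j)" if i: "i < m" for i
  proof -
    have "\<mu> * v $ i = ((mat_diag m d + E) *\<^sub>v v) $ i" using v i by simp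
    also have "\<dots> = (\<Sum>j<m. (if i = j then d j else 0) * v $ j + E $$ (i, j) * v $ j)"
      using v(1) E i by (simp add: scalar_prod_def lessThan_atLeast0 mat_diag_def distrib_right)
    also have "\<dots> = d i * v $ i + (\<Sum>j<m. E $$ (i, j) * v $ j)"
      using i by (simp add: sum.distrib if_distrib[of "\<lambda>x. x * _"] cong: if_cong)
    finally show ?thesis by (simp add: algebra_simps)
  qed
  define M where "M = Max ((\<lambda>i. cmod (v $ i)) ` {..<m})"
  have M: "cmod (v $ i) \<le> M" if "i < m" for i
    using that by (auto simp: M_def)
  have "M \<in> (\<lambda>i. cmod (v $ i)) ` {..<m}"
    unfolding M_def using k by (intro Max_in) auto
  then obtain i0 where i0: "i0 < m" "M = cmod (v $ i0)" by auto
  have "\<exists>i<m. v $ i \<noteq> 0" using v(1,2) by (metis carrier_vecD eq_vecI index_zero_vec)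
  then have M0: "M > 0" using M by (metis norm_le_zero_iff not_le order_trans)
  have rowE: "(\<Sum>j<m. cmod (E $$ (i, j))) \<le> mat_norm E" if "i < m" for i
    unfolding mat_norm_eq[OF E] using that
    by (intro member_le_sum[where f = "\<lambda>i. \<Sum>j<m. cmod (E $$ (i, j))"]) (auto intro: sum_nonneg)
  have off: "cmod (v $ i) \<le> mat_norm E * M / c" if i: "i < m" "i \<noteq> k" for i
  proof -
    have "c * cmod (v $ i) \<le> cmod (\<mu> - d i) * cmod (v $ i)"
      using sep[OF i] by (rule mult_right_mono) simp
    also have "\<dots> = cmod (\<Sum>j<m. E $$ (i, j) * v $ j)"
      using row[OF i(1)] by (metis norm_mult)
    also have "\<dots> \<le> (\<Sum>j<m. cmod (E $$ (i, j)) * M)"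
      using M by (intro sum_norm_le) (simp add: norm_mult mult_left_mono)
    also have "\<dots> \<le> mat_norm E * M"
      using rowE[OF i(1)] M0 by (simp add: sum_distrib_right[symmetric])
    finally show ?thesis using c by (simp add: field_simps)
  qed
  \<comment> \<open>A maximal entry at another position would satisfy
    \<open>c * M \<le> mat_norm E * M\<close>, against the smallness of \<open>E\<close>.\<close>
  have "i0 = k"
  proof (rule ccontr)
    assume "i0 \<noteq> k"
    then have "M \<le> mat_norm E * M / c" using off[OF i0(1)] i0(2) by simp
    then have "c * M \<le> mat_norm E * M" using c by (simp add: field_simps)
    then show False using small M0 by simp
  qed
  then have Mk: "M = cmod (v $ k)" using i0 by simp
  \<comment> \<open>Row \<open>k\<close> of the eigenvector equation with its diagonal term moved to
    the left. Each remaining summand has one factor from \<open>E\<close> and one off-maximal entry,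
    itself of order \<open>mat_norm E\<close>.\<close>
  have "(\<mu> - d k - E $$ (k, k)) * v $ k = (\<Sum>j\<in>{..<m} - {k}. E $$ (k, j) * v $ j)"
    using row[OF k] k by (simp add: sum.remove[of _ k] algebra_simps)
  then have "cmod (\<mu> - d k - E $$ (k, k)) * M = cmod (\<Sum>j\<in>{..<m} - {k}. E $$ (k, j) * v $ j)"
    by (metis Mk norm_mult)
  also have "\<dots> \<le> (\<Sum>j\<in>{..<m} - {k}. cmod (E $$ (k, j)) * (mat_norm E * M / c))"
    using off by (intro sum_norm_le) (simp only: norm_mult, intro mult_left_mono, auto)
  also have "\<dots> \<le> (\<Sum>j<m. cmod (E $$ (k, j)) * (mat_norm E * M / c))"
    using c M0 mat_norm_nonneg[of E] by (intro sum_mono2) auto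
  also have "\<dots> \<le> mat_norm E * (mat_norm E * M / c)"
    unfolding sum_distrib_right[symmetric]
    using rowE[OF k] c M0 mat_norm_nonneg[of E] by (intro mult_right_mono) auto
  also have "\<dots> = (mat_norm E)\<^sup>2 / c * M" by (simp add: power2_eq_square)
  finally show ?thesis using M0 by (rule mult_right_le_imp_le)
qed

text \<open>Conjugation by \<open>V\<close> reduces this to the diagonal case with perturbation
  \<open>W * (B - A) * V\<close>. By cyclicity of the trace, the diagonal entry of that perturbation
  at \<open>k\<close> is the trace of the spectral projection times \<open>B - A\<close>.\<close>

lemma eigenvalue_perturbation:
  assumes A: "A \<in> carrier_mat m m" and B: "B \<in> carrier_mat m m" and inj: "inj_on d {..<m}"
    and s: "similar_mat_wit A (mat_diag m d) V W" and k: "k < m"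
    and ev: "\<mu> \<in> spectrum B"
    and sep: "\<And>i. i < m \<Longrightarrow> i \<noteq> k \<Longrightarrow> c \<le> cmod (\<mu> - d i)"
    and small: "mat_norm W * mat_norm V * mat_norm (B - A) < c"
  shows "cmod (\<mu> - d k - mat_trace (eproj m d k A * (B - A))) \<le>
    (mat_norm W * mat_norm V * mat_norm (B - A))\<^sup>2 / c"
proof -
  note w = similar_mat_witD2[OF A s]
  define C where "C = B - A"
  have C: "C \<in> carrier_mat m m" using A by (simp add: C_def minus_carrier_mat)
  define E where "E = W * C * V"
  have E: "E \<in> carrier_mat m m" using w C by (simp add: E_def)
  let ?e = "mat_diag m (\<lambda>i. if i = k then 1 else 0) :: complex mat"
  have D: "mat_diag m d = W * A * V"
    using similar_mat_witD2(3)[OF _ similar_mat_wit_sym[OF s]] mat_diag_dim by blast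
  have "mat_diag m d + E = W * (A + C) * V"
    unfolding D E_def using w(4,6,7) C
    by (simp add: mult_add_distrib_mat[of _ m m _ m] add_mult_distrib_mat[of _ m m _ _ m])
  also have "A + C = B" unfolding C_def using A B by auto
  finally have "similar_mat (mat_diag m d + E) B"
    using w(1,2,6,7) B E by (intro similar_matI[of _ _ W V m]) auto
  then have "\<mu> \<in> spectrum (mat_diag m d + E)" using ev spectrum_similar by blast
  moreover have le: "mat_norm E \<le> mat_norm W * mat_norm V * mat_norm C"
  proof -
    have "mat_norm E \<le> mat_norm (W * C) * mat_norm V"
      unfolding E_def using w C by (intro mat_norm_mult) auto
    also have "\<dots> \<le> mat_norm W * mat_norm C * mat_norm V"
      using w C by (intro mult_right_mono mat_norm_mult mat_norm_nonneg) auto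
    finally show ?thesis by (simp add: ac_simps)
  qed
  ultimately have "cmod (\<mu> - d k - E $$ (k, k)) \<le> (mat_norm E)\<^sup>2 / c"
    using small unfolding C_def[symmetric]
    by (intro eigenvalue_diag_perturbation[OF E k _ sep]) auto
  also have "\<dots> \<le> (mat_norm W * mat_norm V * mat_norm C)\<^sup>2 / c"
    using le small mat_norm_nonneg[of E] unfolding C_def[symmetric]
    by (intro divide_right_mono power_mono) auto
  also have "E $$ (k, k) = mat_trace (?e * E)"
  proof -
    have "mat_trace (?e * E) = (\<Sum>i<m. (if i = k then 1 else 0) * E $$ (i, i))"
      unfolding mat_diag_mult_left[OF E] by (simp add: mat_trace_def)
    also have "\<dots> = (\<Sum>i<m. if i = k then E $$ (k, k) else 0)"
      by (intro sum.cong) auto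
    also have "\<dots> = E $$ (k, k)" using k by simp
    finally show ?thesis ..
  qed
  also have "mat_trace (?e * E) = mat_trace (eproj m d k A * C)"
  proof -
    have assoc: "e * (W * C * V) = e * W * C * V" "V * (e * W * C) = V * e * W * C"
      "e * W * C \<in> carrier_mat m m"
      if "e \<in> carrier_mat m m" for e
      using that w(6,7) C by (simp_all add: assoc_mult_mat[of _ m m _ m _ m])
    have "mat_trace (?e * E) = mat_trace (V * (?e * W * C))"
      unfolding E_def assoc(1)[OF mat_diag_dim] by (rule mat_trace_comm[OF assoc(3)[OF mat_diag_dim] w(6)])
    then show ?thesis unfolding assoc(2)[OF mat_diag_dim] eproj_eq[OF s A inj k] .
  qed
  finally show ?thesis unfolding C_def .
qed

text \<open>The quadratic error estimate turns continuity at \<open>x\<close> into differentiability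
  there. Since \<open>f\<close> is otherwise only asked to take eigenvalues near \<open>x\<close>,
  the gradient does not depend on how the local inverse was chosen.\<close>

lemma eigenvalue_has_gradient:
  assumes x: "x \<in> carrier_mat n n" and m: "m \<le> n" and inj: "inj_on d {..<m}"
    and s: "similar_mat (cutoff m x) (mat_diag m d)" and k: "k < m"
    and ev: "eventually (\<lambda>y. f y \<in> spectrum (cutoff m y)) (mat_nhds n x)"
    and lim: "(f \<longlongrightarrow> d k) (mat_nhds n x)" and fx: "f x = d k"
  shows "has_gradient n f x (pad n m (eproj m d k (cutoff m x)))"
proof -
  let ?P = "eproj m d k (cutoff m x)"
  obtain V W where s: "similar_mat_wit (cutoff m x) (mat_diag m d) V W"
    using s unfolding similar_mat_def by blast
  \<comment> \<open>Half the gap between \<open>d k\<close> and the other eigenvalues: once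
    \<open>f y\<close> is within \<open>c\<close> of \<open>d k\<close>, it is still at distance at
    least \<open>c\<close> from all the others. With no other eigenvalue, any positive
    \<open>c\<close> will do.\<close>
  have "\<exists>c>0. \<forall>i\<in>{..<m} - {k}. 2 * c \<le> cmod (d k - d i)"
  proof (cases "{..<m} - {k} = {}")
    case False
    let ?S = "(\<lambda>i. cmod (d k - d i)) ` ({..<m} - {k})"
    have "Min ?S \<in> ?S" using False by (intro Min_in) auto
    then have "Min ?S > 0" using inj k by (auto simp: inj_on_def)
    then show ?thesis by (intro exI[of _ "Min ?S / 2"]) (auto intro: Min_le)
  qed (auto intro: exI[of _ 1])
  then obtain c where c: "c > 0" "\<And>i. i < m \<Longrightarrow> i \<noteq> k \<Longrightarrow> 2 * c \<le> cmod (d k - d i)" by auto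
  define K where "K = mat_norm W * mat_norm V"
  have K: "K \<ge> 0" by (simp add: K_def mat_norm_nonneg)
  show ?thesis
    unfolding has_gradient_def
  proof (intro conjI allI impI pad_carrier)
    fix \<epsilon> :: real assume e: "\<epsilon> > 0"
    \<comment> \<open>The first bound makes the conjugated perturbation smaller than
      \<open>c\<close>; the second turns the quadratic error into at most \<epsilon> times the norm
      of the increment.\<close>
    define \<eta> where "\<eta> = min (c / (K + 1)) (\<epsilon> * c / (K + 1)\<^sup>2)"
    have eta: "\<eta> > 0" using c e K by (simp add: \<eta>_def)
    have 1: "eventually (\<lambda>y. dist (f y) (d k) < c) (mat_nhds n x)"
      using lim c(1) by (rule tendstoD)
    have 2: "eventually (\<lambda>y. mat_norm (y - x) < \<eta>) (mat_nhds n x)"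
      unfolding eventually_mat_nhds using eta by auto
    have "eventually (\<lambda>y. cmod (f y - f x - mat_trace (pad n m ?P * (y - x))) \<le> \<epsilon> * mat_norm (y - x))
      (mat_nhds n x)"
      using 1 2 ev eventually_mat_nhds_carrier
    proof eventually_elim
      case (elim y)
      let ?N = "mat_norm (y - x)"
      have N: "?N \<ge> 0" by (rule mat_norm_nonneg)
      have "c \<le> cmod (f y - d i)" if "i < m" "i \<noteq> k" for i
        using c(2)[OF that] elim(1) norm_triangle_ineq4[of "f y - d i" "f y - d k"]
        by (simp add: dist_norm norm_minus_commute)
      moreover have le: "mat_norm (cutoff m y - cutoff m x) \<le> ?N"
        using mat_norm_cutoff_le[OF m minus_carrier_mat[OF x]] cutoff_minus[OF m x elim(4)] by metis
      moreover have "K * mat_norm (cutoff m y - cutoff m x) < c"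
      proof -
        have "K * mat_norm (cutoff m y - cutoff m x) \<le> (K + 1) * ?N"
          using le K N by (intro mult_mono) (auto simp: mat_norm_nonneg)
        also have "\<dots> < (K + 1) * (c / (K + 1))"
          using elim(2) K unfolding \<eta>_def by (intro mult_strict_left_mono) auto
        finally show ?thesis using K by simp
      qed
      ultimately have "cmod (f y - d k - mat_trace (?P * (cutoff m y - cutoff m x))) \<le>
          (K * mat_norm (cutoff m y - cutoff m x))\<^sup>2 / c"
        using eigenvalue_perturbation[OF cutoff_carrier cutoff_carrier inj s k elim(3)]
        unfolding K_def by blast
      also have "\<dots> \<le> ((K + 1) * ?N)\<^sup>2 / c"
        using le K N c by (intro divide_right_mono power_mono mult_mono) (auto simp: mat_norm_nonneg)
      also have "\<dots> = ((K + 1)\<^sup>2 / c * ?N) * ?N" by (simp add: power2_eq_square)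
      also have "\<dots> \<le> \<epsilon> * ?N"
      proof (rule mult_right_mono[OF _ N])
        have "(K + 1)\<^sup>2 / c * ?N \<le> (K + 1)\<^sup>2 / c * (\<epsilon> * c / (K + 1)\<^sup>2)"
          using elim(2) c K unfolding \<eta>_def by (intro mult_left_mono) auto
        also have "\<dots> = \<epsilon>" using c K by (simp add: field_simps)
        finally show "(K + 1)\<^sup>2 / c * ?N \<le> \<epsilon>" .
      qed
      also have "mat_trace (?P * (cutoff m y - cutoff m x)) = mat_trace (pad n m ?P * (y - x))"
        using mat_trace_pad[OF m eproj_carrier[OF cutoff_carrier] minus_carrier_mat[OF x]]
          cutoff_minus[OF m x elim(4)] by metis
      finally show ?case by (simp add: fx)
    qed
    then show "\<exists>\<delta>>0. \<forall>y\<in>carrier_mat n n. mat_norm (y - x) < \<delta> \<longrightarrow>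
        cmod (f y - f x - mat_trace (pad n m ?P * (y - x))) \<le> \<epsilon> * mat_norm (y - x)"
      unfolding eventually_mat_nhds .
  qed
qed

section \<open>Eigenvalues of nearby matrices\<close>

lemma tendsto_char_poly_cutoff:
  assumes x: "x \<in> carrier_mat n n" and m: "m \<le> n"
  shows "((\<lambda>y. poly (char_poly (cutoff m y)) \<mu>) \<longlongrightarrow> poly (char_poly (cutoff m x)) \<mu>) (mat_nhds n x)"
proof -
  have e: "poly (char_poly (cutoff m y)) \<mu> =
      (\<Sum>p\<in>{p. p permutes {0..<m}}. signof p * (\<Prod>i = 0..<m. (if i = p i then \<mu> else 0) - y $$ (i, p i)))" for y
  proof -
    have c: "- char_matrix (cutoff m y) \<mu> \<in> carrier_mat m m" by (simp add: char_matrix_def)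
    show ?thesis
      unfolding char_poly_matrix[OF cutoff_carrier] det_def'[OF c]
    proof (intro sum.cong refl arg_cong2[of _ _ _ _ times] prod.cong)
      fix p i assume "p \<in> {p. p permutes {0..<m}}" and i: "i \<in> {0..<m}"
      then have "p i < m" by (metis atLeastLessThan_iff mem_Collect_eq permutes_in_image)
      then show "(- char_matrix (cutoff m y) \<mu>) $$ (i, p i) = (if i = p i then \<mu> else 0) - y $$ (i, p i)"
        using i by (auto simp: char_matrix_def cutoff_def)
    qed
  qed
  have "p i < n" if "p permutes {0..<m}" "i \<in> {0..<m}" for p i
    using permutes_in_image[OF that(1), of i] that(2) m by auto
  then show ?thesis
    unfolding e using x m
    by (intro tendsto_sum tendsto_mult tendsto_prod tendsto_diff tendsto_const tendsto_mat_entry) auto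
qed

text \<open>The characteristic polynomial of the cutoff of \<open>y\<close>, evaluated at \<mu>, is
  the product of the differences from \<mu> to its roots. If all roots were at distance at least
  \<epsilon>, its modulus would be at least \<open>\<epsilon> ^ m\<close>, whereas it tends to
  0.\<close>

lemma eventually_eigenvalue_near:
  assumes x: "x \<in> carrier_mat n n" and m: "m \<le> n" and \<mu>: "\<mu> \<in> spectrum (cutoff m x)" and e: "\<epsilon> > 0"
  shows "eventually (\<lambda>y. \<exists>a\<in>spectrum (cutoff m y). cmod (a - \<mu>) < \<epsilon>) (mat_nhds n x)"
proof -
  have "poly (char_poly (cutoff m x)) \<mu> = 0"
    using \<mu> by (simp add: spectrum_root_char_poly[OF cutoff_carrier])
  then have "((\<lambda>y. poly (char_poly (cutoff m y)) \<mu>) \<longlongrightarrow> 0) (mat_nhds n x)"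
    using tendsto_char_poly_cutoff[OF x m, of \<mu>] by simp
  then have "eventually (\<lambda>y. cmod (poly (char_poly (cutoff m y)) \<mu>) < \<epsilon> ^ m) (mat_nhds n x)"
    using e by (auto dest!: tendstoD[where e = "\<epsilon> ^ m"] simp: dist_norm)
  then show ?thesis
  proof eventually_elim
    case (elim y)
    obtain as where as: "char_poly (cutoff m y) = (\<Prod>a\<leftarrow>as. [:- a, 1:])" "length as = m"
      using char_poly_factorized[OF cutoff_carrier] by blast
    have spec: "set as \<subseteq> spectrum (cutoff m y)"
      unfolding spectrum_root_char_poly[OF cutoff_carrier] as(1)
      by (auto simp: poly_prod_list prod_list_zero_iff o_def image_iff)
    have "cmod (poly (char_poly (cutoff m y)) \<mu>) = (\<Prod>a\<leftarrow>as. cmod (a - \<mu>))"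
      unfolding as(1)
    proof (induction as)
      case (Cons a as)
      have "poly (\<Prod>a\<leftarrow>a # as. [:- a, 1:]) \<mu> = (\<mu> - a) * poly (\<Prod>a\<leftarrow>as. [:- a, 1:]) \<mu>"
        by (simp add: algebra_simps)
      then show ?case using Cons by (simp add: norm_mult norm_minus_commute del: mult_pCons_left)
    qed simp
    moreover have "\<epsilon> ^ length as \<le> (\<Prod>a\<leftarrow>as. cmod (a - \<mu>))" if "\<forall>a\<in>set as. \<epsilon> \<le> cmod (a - \<mu>)"
      using that e by (induction as) (auto intro!: mult_mono)
    ultimately have "\<exists>a\<in>set as. cmod (a - \<mu>) < \<epsilon>" using elim as(2) by force
    then show ?case using spec by blast
  qed
qed

section \<open>The one-parameter actions\<close>

lemma tri_Suc: "tri (Suc m) = tri m + Suc m"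
  by (simp add: tri_def)

lemma tri_mono: "m \<le> k \<Longrightarrow> tri m \<le> tri k"
  unfolding tri_def by (intro div_le_mono mult_le_mono) auto

lemma le_tri: "m \<le> tri m"
  by (induction m) (auto simp: tri_Suc)

text \<open>For positive \<open>j\<close> this is the \<open>m\<close> with
  \<open>j \<in> I_block m\<close>: the first triangular number reaching \<open>j\<close> closes the
  block of \<open>j\<close>.\<close>

definition blk :: "nat \<Rightarrow> nat" where
  "blk j = (LEAST m. j \<le> tri m)"

text \<open>Counted from 0, whereas the index k of \<open>nu_entry\<close> starts at 1.\<close>

definition pos :: "nat \<Rightarrow> nat" where
  "pos j = j - tri (blk j - 1) - 1"

lemma blk_eq:
  assumes "k < m"
  shows "blk (tri (m - 1) + Suc k) = m" "pos (tri (m - 1) + Suc k) = k"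
proof -
  obtain m' where m: "m = Suc m'" using assms by (cases m) auto
  show b: "blk (tri (m - 1) + Suc k) = m"
    unfolding blk_def
  proof (rule Least_equality)
    fix l assume l: "tri (m - 1) + Suc k \<le> tri l"
    show "m \<le> l"
    proof (rule ccontr)
      assume "\<not> m \<le> l"
      then have "tri l \<le> tri (m - 1)" by (intro tri_mono) auto
      then show False using l by simp
    qed
  qed (use assms m in \<open>simp add: tri_Suc\<close>)
  show "pos (tri (m - 1) + Suc k) = k" unfolding pos_def b by simp
qed

lemma blk_cases:
  assumes "j \<in> I (tri n)"
  obtains m k where "m \<in> I n" "k < m" "j = tri (m - 1) + Suc k" "blk j = m" "pos j = k"
proof -
  define m where "m = blk j"
  have ex: "j \<le> tri n" and j1: "j \<ge> 1" using assms by (auto simp: I_def)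
  have jm: "j \<le> tri m" unfolding m_def blk_def using ex by (rule LeastI)
  have mn: "m \<le> n" unfolding m_def blk_def using ex by (rule Least_le)
  have m0: "m \<noteq> 0" using jm j1 by (intro notI) (simp add: tri_def)
  then have "\<not> j \<le> tri (m - 1)" unfolding m_def blk_def by (intro not_less_Least) auto
  moreover have "tri m = tri (m - 1) + m" using m0 tri_Suc[of "m - 1"] by simp
  ultimately obtain k where k: "k < m" "j = tri (m - 1) + Suc k"
    using jm m0 by (metis add_less_cancel_left less_Suc_eq_le less_iff_Suc_add not_le_imp_less add_Suc_right not_less_eq)
  show thesis
    by (rule that[OF _ k]) (use m0 mn k blk_eq[OF k(1)] in \<open>auto simp: I_def\<close>)
qed

lemma blk_le: "j \<in> I (tri n) \<Longrightarrow> blk j \<le> n"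
  by (metis blk_cases I_def atLeastAtMost_iff)

lemma pos_less: "j \<in> I (tri n) \<Longrightarrow> pos j < blk j"
  by (metis blk_cases)

lemma blk_in: "j \<in> I (tri n) \<Longrightarrow> blk j \<in> I n"
  by (metis blk_cases)

lemma blk_pos: "j \<in> I (tri n) \<Longrightarrow> tri (blk j - 1) + Suc (pos j) = j"
  by (metis blk_cases)

lemma index_in: "m \<in> I n \<Longrightarrow> k < m \<Longrightarrow> tri (m - 1) + Suc k \<in> I (tri n)"
proof -
  assume m: "m \<in> I n" and k: "k < m"
  have "tri (m - 1) + Suc k \<le> tri m" using k tri_Suc[of "m - 1"] by simp
  also have "\<dots> \<le> tri n" using m by (intro tri_mono) (auto simp: I_def)
  finally show ?thesis by (auto simp: I_def)
qed

lemma blk_mono: "i \<le> j \<Longrightarrow> blk i \<le> blk j"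
  unfolding blk_def
  by (rule Least_le) (metis LeastI le_tri order_trans)

abbreviation nu_ev :: "(nat \<Rightarrow> complex) \<Rightarrow> nat \<Rightarrow> nat \<Rightarrow> complex" where
  "nu_ev \<nu> m \<equiv> \<lambda>i. nu_entry \<nu> (Suc i) m"

lemma inj_nu_ev:
  "\<nu> \<in> e_Omega n \<Longrightarrow> m \<in> I n \<Longrightarrow> inj_on (nu_ev \<nu> m) {..<m}"
proof -
  assume "\<nu> \<in> e_Omega n" "m \<in> I n"
  then have "inj_on (\<lambda>k. nu_entry \<nu> k m) (I m)" by (simp add: e_Omega_def)
  moreover have "Suc ` {..<m} \<subseteq> I m" by (auto simp: I_def)
  ultimately have "inj_on (\<lambda>k. nu_entry \<nu> k m) (Suc ` {..<m})" by (rule inj_on_subset)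
  then show ?thesis by (simp add: inj_on_def)
qed

lemma nu_ev_image: "nu_ev \<nu> m ` {..<m} = (\<lambda>k. nu_entry \<nu> k m) ` I m"
proof -
  have "I m = Suc ` {..<m}" by (simp add: I_def lessThan_atLeast0 image_Suc_atLeastLessThan atLeastLessThanSuc_atLeastAtMost)
  then show ?thesis by (simp add: image_image)
qed

lemma spectrum_nu: "similar_mat (nu_diag \<nu> m) A \<Longrightarrow> spectrum A = (\<lambda>k. nu_entry \<nu> k m) ` I m"
  using spectrum_similar[of "nu_diag \<nu> m" A] by (simp add: nu_diag_def spectrum_diag flip: nu_ev_image)

text \<open>Similarity to the diagonal matrices determines the spectra of the cutoffs, so the
  conditions defining \<open>M_Omega\<close> follow from those defining \<open>e_Omega\<close>.
  Membership thus reduces to similarity.\<close>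

lemma M_Omega_eI:
  assumes nu: "\<nu> \<in> e_Omega n" and x: "x \<in> carrier_mat n n"
    and sim: "\<And>m. m \<in> I n \<Longrightarrow> similar_mat (nu_diag \<nu> m) (cutoff m x)"
  shows "(\<nu>, x) \<in> M_Omega_e n"
proof -
  have sp: "spectrum (cutoff m x) = (\<lambda>k. nu_entry \<nu> k m) ` I m" if "m \<in> I n" for m
    using sim[OF that] by (rule spectrum_nu)
  have "card (spectrum (cutoff m x)) = m" if "m \<in> I n" for m
    using nu that unfolding sp[OF that] by (subst card_image) (auto simp: e_Omega_def I_def)
  moreover have "spectrum (cutoff m x) \<inter> spectrum (cutoff (m + 1) x) = {}" if "m \<in> I (n - 1)" for m
  proof -
    have m: "m \<in> I n" "m + 1 \<in> I n" using that by (auto simp: I_def)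
    show ?thesis unfolding sp[OF m(1)] sp[OF m(2)] using nu that by (auto simp: e_Omega_def)
  qed
  ultimately show ?thesis using assms by (auto simp: M_Omega_e_def M_Omega_def)
qed

lemma M_Omega_eD:
  assumes "p \<in> M_Omega_e n"
  shows "fst p \<in> e_Omega n" "snd p \<in> carrier_mat n n"
    "\<And>m. m \<in> I n \<Longrightarrow> similar_mat (cutoff m (snd p)) (mat_diag m (nu_ev (fst p) m))"
  using assms by (auto simp: M_Omega_e_def M_Omega_def nu_diag_def intro: similar_mat_sym)

section \<open>Block calculus for cutoffs, padding and their exponentials\<close>

lemma cutoff_cutoff: "k \<le> m \<Longrightarrow> cutoff k (cutoff m x) = cutoff k x"
  by (auto simp: cutoff_def intro!: eq_matI)

lemma pad_pad: "k \<le> m \<Longrightarrow> m \<le> n \<Longrightarrow> pad n m (pad m k A) = pad n k A"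
  by (auto simp: pad_def intro!: eq_matI)

lemma pad_self: "A \<in> carrier_mat m m \<Longrightarrow> pad m m A = A"
  by (auto simp: pad_def intro!: eq_matI)

lemma mat_mult_entry:
  "A \<in> carrier_mat n n \<Longrightarrow> B \<in> carrier_mat n n \<Longrightarrow> i < n \<Longrightarrow> j < n \<Longrightarrow>
    (A * B) $$ (i, j) = (\<Sum>k<n. A $$ (i, k) * B $$ (k, j))"
  by (auto simp: scalar_prod_def lessThan_atLeast0)

lemma pad_mult:
  assumes "m \<le> n" "A \<in> carrier_mat m m" "B \<in> carrier_mat m m"
  shows "pad n m A * pad n m B = pad n m (A * B)"
proof (rule eq_matI)
  fix i j assume "i < dim_row (pad n m (A * B))" "j < dim_col (pad n m (A * B))"
  then have ij: "i < n" "j < n" by auto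
  have "(pad n m A * pad n m B) $$ (i, j) =
      (\<Sum>k<n. if k < m then if i < m \<and> j < m then A $$ (i, k) * B $$ (k, j) else 0 else 0)"
    using mat_mult_entry[OF pad_carrier pad_carrier ij] ij
    by (auto simp: pad_def intro!: sum.cong)
  also have "\<dots> = (\<Sum>k<m. if i < m \<and> j < m then A $$ (i, k) * B $$ (k, j) else 0)"
    using assms(1) by (rule sum_pad)
  also have "\<dots> = pad n m (A * B) $$ (i, j)"
    using ij mat_mult_entry[OF assms(2,3)] by (auto simp: pad_def)
  finally show "(pad n m A * pad n m B) $$ (i, j) = pad n m (A * B) $$ (i, j)" .
qed auto

text \<open>Taking the upper left block is multiplicative only if the corner contribution vanishes:
  either the upper right block of \<open>A\<close> or the lower left block of \<open>B\<close> has
  to be zero.\<close>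

lemma cutoff_mult:
  assumes "m \<le> n" "A \<in> carrier_mat n n" "B \<in> carrier_mat n n"
    and "(\<forall>i<m. \<forall>k\<in>{m..<n}. A $$ (i, k) = 0) \<or> (\<forall>k\<in>{m..<n}. \<forall>j<m. B $$ (k, j) = 0)"
  shows "cutoff m (A * B) = cutoff m A * cutoff m B"
proof (rule eq_matI)
  fix i j assume "i < dim_row (cutoff m A * cutoff m B)" "j < dim_col (cutoff m A * cutoff m B)"
  then have ij: "i < m" "j < m" by auto
  have "cutoff m (A * B) $$ (i, j) = (\<Sum>k<n. A $$ (i, k) * B $$ (k, j))"
    using ij assms(1) mat_mult_entry[OF assms(2,3), of i j] by (simp add: cutoff_def)
  also have "\<dots> = (\<Sum>k<n. if k < m then A $$ (i, k) * B $$ (k, j) else 0)"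
    using assms(4) ij by (intro sum.cong) (auto simp: not_less)
  also have "\<dots> = (\<Sum>k<m. A $$ (i, k) * B $$ (k, j))"
    using assms(1) by (rule sum_pad)
  also have "\<dots> = (cutoff m A * cutoff m B) $$ (i, j)"
    using ij mat_mult_entry[OF cutoff_carrier cutoff_carrier ij] by (simp add: cutoff_def)
  finally show "cutoff m (A * B) $$ (i, j) = (cutoff m A * cutoff m B) $$ (i, j)" .
qed auto

text \<open>For \<open>\<zeta> = exp q\<close> and idempotent \<open>P\<close> this is the exponential of \<open>q\<close> times \<open>P\<close>, padded by zeros.\<close>

definition expproj :: "nat \<Rightarrow> nat \<Rightarrow> complex mat \<Rightarrow> complex \<Rightarrow> complex mat" where
  "expproj n m P \<zeta> = 1\<^sub>m n + (\<zeta> - 1) \<cdot>\<^sub>m pad n m P"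

lemma expproj_carrier [simp, intro]: "expproj n m P \<zeta> \<in> carrier_mat n n"
  by (simp add: expproj_def)

lemma expproj_dim [simp]: "dim_row (expproj n m P \<zeta>) = n" "dim_col (expproj n m P \<zeta>) = n"
  by (simp_all add: expproj_def)

lemma expproj_one [simp]: "expproj n m P 1 = 1\<^sub>m n"
  by (auto simp: expproj_def intro!: eq_matI)

text \<open>For an idempotent the cross terms collapse, because \<open>(\<zeta> - 1) + (\<eta> - 1)
  + (\<zeta> - 1) * (\<eta> - 1) = \<zeta> * \<eta> - 1\<close>.\<close>

lemma expproj_mult:
  assumes "m \<le> n" "P \<in> carrier_mat m m" "P * P = P"
  shows "expproj n m P \<zeta> * expproj n m P \<eta> = expproj n m P (\<zeta> * \<eta>)"
proof -
  define Q where "Q = pad n m P"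
  have Q: "Q \<in> carrier_mat n n" "Q * Q = Q"
    using pad_mult[OF assms(1,2,2)] assms(3) by (auto simp: Q_def)
  have "(1\<^sub>m n + (\<zeta> - 1) \<cdot>\<^sub>m Q) * (1\<^sub>m n + (\<eta> - 1) \<cdot>\<^sub>m Q) =
      1\<^sub>m n * (1\<^sub>m n + (\<eta> - 1) \<cdot>\<^sub>m Q) + ((\<zeta> - 1) \<cdot>\<^sub>m Q) * (1\<^sub>m n + (\<eta> - 1) \<cdot>\<^sub>m Q)"
    using Q(1) by (intro add_mult_distrib_mat[of _ n n _ _ n]) auto
  also have "((\<zeta> - 1) \<cdot>\<^sub>m Q) * (1\<^sub>m n + (\<eta> - 1) \<cdot>\<^sub>m Q) =
      ((\<zeta> - 1) \<cdot>\<^sub>m Q) * 1\<^sub>m n + ((\<zeta> - 1) \<cdot>\<^sub>m Q) * ((\<eta> - 1) \<cdot>\<^sub>m Q)"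
    using Q(1) by (intro mult_add_distrib_mat[of _ n n _ n]) auto
  also have "((\<zeta> - 1) \<cdot>\<^sub>m Q) * ((\<eta> - 1) \<cdot>\<^sub>m Q) = ((\<zeta> - 1) * (\<eta> - 1)) \<cdot>\<^sub>m Q"
    using Q by (simp add: mult_smult_assoc_mat[of _ n n _ n] mult_smult_distrib[of _ n n _ n]) auto
  also have "((\<zeta> - 1) \<cdot>\<^sub>m Q) * 1\<^sub>m n = (\<zeta> - 1) \<cdot>\<^sub>m Q" using Q by simp
  also have "1\<^sub>m n * (1\<^sub>m n + (\<eta> - 1) \<cdot>\<^sub>m Q) = 1\<^sub>m n + (\<eta> - 1) \<cdot>\<^sub>m Q" using Q by simp
  also have "1\<^sub>m n + (\<eta> - 1) \<cdot>\<^sub>m Q + ((\<zeta> - 1) \<cdot>\<^sub>m Q + ((\<zeta> - 1) * (\<eta> - 1)) \<cdot>\<^sub>m Q) =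
      1\<^sub>m n + (\<zeta> * \<eta> - 1) \<cdot>\<^sub>m Q"
    using Q(1) by (intro eq_matI) (auto simp: algebra_simps)
  finally show ?thesis unfolding expproj_def Q_def .
qed

lemma cutoff_expproj:
  "m \<le> k \<Longrightarrow> k \<le> n \<Longrightarrow> cutoff k (expproj n m P \<zeta>) = expproj k m P \<zeta>"
  by (auto simp: expproj_def cutoff_def pad_def intro!: eq_matI)

text \<open>For \<open>k\<close> at least \<open>m\<close> the matrices \<open>expproj\<close> are
  block diagonal with respect to \<open>k\<close>, so the cutoff passes through the
  conjugation.\<close>

lemma cutoff_conj_expproj:
  assumes "m \<le> k" "k \<le> n" "x \<in> carrier_mat n n"
  shows "cutoff k (expproj n m P \<zeta> * x * expproj n m P \<eta>) =
    expproj k m P \<zeta> * cutoff k x * expproj k m P \<eta>"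
proof -
  have "cutoff k (expproj n m P \<zeta> * x * expproj n m P \<eta>) =
      cutoff k (expproj n m P \<zeta> * x) * cutoff k (expproj n m P \<eta>)"
    using assms by (intro cutoff_mult[where n = n]) (auto simp: expproj_def pad_def)
  also have "cutoff k (expproj n m P \<zeta> * x) = cutoff k (expproj n m P \<zeta>) * cutoff k x"
    using assms by (intro cutoff_mult[where n = n]) (auto simp: expproj_def pad_def)
  finally show ?thesis using assms by (simp add: cutoff_expproj)
qed

text \<open>Multiplication by \<open>expproj\<close> can be carried out inside a larger block. It
  lets a conjugation of a projection in the \<open>k\<close> by \<open>k\<close> block be read as a
  conjugation of its padding.\<close>

lemma expproj_mult_pad:
  assumes "m \<le> k" "k \<le> n" "P \<in> carrier_mat m m" "A \<in> carrier_mat k k"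
  shows "expproj n m P \<zeta> * pad n k A = pad n k (expproj k m P \<zeta> * A)"
    and "pad n k A * expproj n m P \<zeta> = pad n k (A * expproj k m P \<zeta>)"
proof -
  let ?Q = "pad k m P"
  have p: "pad n m P = pad n k ?Q" using assms by (simp add: pad_pad)
  have Q: "?Q \<in> carrier_mat k k" by simp
  have "expproj n m P \<zeta> * pad n k A = pad n k A + (\<zeta> - 1) \<cdot>\<^sub>m (pad n k ?Q * pad n k A)"
    unfolding expproj_def p
    by (subst add_mult_distrib_mat[of _ n n _ _ n])
       (auto simp: mult_smult_assoc_mat[of _ n n _ n] left_mult_one_mat[of _ n n])
  also have "\<dots> = pad n k (A + (\<zeta> - 1) \<cdot>\<^sub>m (?Q * A))"
    unfolding pad_mult[OF assms(2) Q assms(4)] using assms(4) by (auto simp: pad_def intro!: eq_matI)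
  also have "A + (\<zeta> - 1) \<cdot>\<^sub>m (?Q * A) = expproj k m P \<zeta> * A"
    unfolding expproj_def using assms(4)
    by (subst add_mult_distrib_mat[of _ k k _ _ k])
       (auto simp: mult_smult_assoc_mat[of _ k k _ k] left_mult_one_mat[of _ k k])
  finally show "expproj n m P \<zeta> * pad n k A = pad n k (expproj k m P \<zeta> * A)" .
  have "pad n k A * expproj n m P \<zeta> = pad n k A + (\<zeta> - 1) \<cdot>\<^sub>m (pad n k A * pad n k ?Q)"
    unfolding expproj_def p
    by (subst mult_add_distrib_mat[of _ n n _ n])
       (auto simp: mult_smult_distrib[of _ n n _ n] right_mult_one_mat[of _ n n])
  also have "\<dots> = pad n k (A + (\<zeta> - 1) \<cdot>\<^sub>m (A * ?Q))"
    unfolding pad_mult[OF assms(2,4) Q] using assms(4) by (auto simp: pad_def intro!: eq_matI)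
  also have "A + (\<zeta> - 1) \<cdot>\<^sub>m (A * ?Q) = A * expproj k m P \<zeta>"
    unfolding expproj_def using assms(4)
    by (subst mult_add_distrib_mat[of _ k k _ k])
       (auto simp: mult_smult_distrib[of _ k k _ k] right_mult_one_mat[of _ k k])
  finally show "pad n k A * expproj n m P \<zeta> = pad n k (A * expproj k m P \<zeta>)" .
qed

lemma conj_conj_mat:
  fixes g :: "complex mat"
  assumes c: "g \<in> carrier_mat n n" "g' \<in> carrier_mat n n" "h \<in> carrier_mat n n" "h' \<in> carrier_mat n n"
    "x \<in> carrier_mat n n" and gg: "g * g' = 1\<^sub>m n"
  shows "(g' * h' * g) * (g' * x * g) * (g' * h * g) = g' * (h' * x * h) * g"
proof -
  have cc: "h' * x \<in> carrier_mat n n" using c by simp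
  show ?thesis
    unfolding conj_mult_mat(1)[OF c(4,5,2,1) gg] conj_mult_mat(1)[OF cc c(3,2,1) gg] ..
qed

text \<open>The spectral projection \<open>P\<close> attached to position \<open>j\<close>. It
  depends on the point only through \<nu> and the cutoff of size \<open>blk j\<close>, which is why
  actions that fix both leave it unchanged.\<close>

definition rproj :: "nat \<Rightarrow> pt \<Rightarrow> complex mat" where
  "rproj j p = eproj (blk j) (nu_ev (fst p) (blk j)) (pos j) (cutoff (blk j) (snd p))"

text \<open>Written in the torus coordinate \<zeta> instead of its logarithm, so that the formula is
  rational and the period of the flow is built in.\<close>

definition act :: "nat \<Rightarrow> nat \<Rightarrow> complex \<Rightarrow> pt \<Rightarrow> pt" where
  "act n j \<zeta> p = (fst p,
     expproj n (blk j) (rproj j p) (inverse \<zeta>) * snd p * expproj n (blk j) (rproj j p) \<zeta>)"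

lemma fst_act [simp]: "fst (act n j \<zeta> p) = fst p"
  by (simp add: act_def)

lemma rproj_carrier [simp, intro]: "rproj j p \<in> carrier_mat (blk j) (blk j)"
  by (simp add: rproj_def eproj_carrier)

lemma rproj_idem:
  assumes "p \<in> M_Omega_e n" "j \<in> I (tri n)"
  shows "rproj j p * rproj j p = rproj j p"
  unfolding rproj_def
  using M_Omega_eD[OF assms(1)] assms(2) by (intro eproj_idem inj_nu_ev[of _ n]) (auto intro: blk_in pos_less)

lemma rproj_commute:
  "rproj j p * cutoff (blk j) (snd p) = cutoff (blk j) (snd p) * rproj j p"
  unfolding rproj_def by (rule eproj_commute) simp

lemma expproj_commute:
  assumes "P \<in> carrier_mat m m" "A \<in> carrier_mat m m" "P * A = A * P"
  shows "expproj m m P \<zeta> * A = A * expproj m m P \<zeta>"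
  unfolding expproj_def pad_self[OF assms(1)] using assms
  by (simp add: add_mult_distrib_mat[of _ m m _ _ m] mult_add_distrib_mat[of _ m m _ m]
      mult_smult_assoc_mat[of _ m m _ m] mult_smult_distrib[of _ m m _ m])

lemma expproj_inverse:
  assumes "p \<in> M_Omega_e n" "j \<in> I (tri n)" "\<zeta> \<noteq> 0" "blk j \<le> k"
  shows "expproj k (blk j) (rproj j p) \<zeta> * expproj k (blk j) (rproj j p) (inverse \<zeta>) = 1\<^sub>m k"
    and "expproj k (blk j) (rproj j p) (inverse \<zeta>) * expproj k (blk j) (rproj j p) \<zeta> = 1\<^sub>m k"
  using assms by (simp_all add: expproj_mult[OF assms(4) rproj_carrier rproj_idem[OF assms(1,2)]])

lemma snd_act_carrier: "snd (act n j \<zeta> p) \<in> carrier_mat n n"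
  by (simp add: act_def carrier_matI)

lemma cutoff_act_ge:
  assumes "snd p \<in> carrier_mat n n" "blk j \<le> k" "k \<le> n"
  shows "cutoff k (snd (act n j \<zeta> p)) =
    expproj k (blk j) (rproj j p) (inverse \<zeta>) * cutoff k (snd p) * expproj k (blk j) (rproj j p) \<zeta>"
  unfolding act_def snd_conv using cutoff_conj_expproj[OF assms(2,3,1)] .

text \<open>At size \<open>blk j\<close> the conjugating matrix commutes with the cutoff, being
  built from a polynomial in it; smaller cutoffs are cutoffs of that one.\<close>

lemma cutoff_act_le:
  assumes p: "p \<in> M_Omega_e n" and j: "j \<in> I (tri n)" and z: "\<zeta> \<noteq> 0" and k: "k \<le> blk j"
  shows "cutoff k (snd (act n j \<zeta> p)) = cutoff k (snd p)"
proof -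
  let ?m = "blk j" and ?P = "rproj j p"
  let ?g = "expproj ?m ?m ?P \<zeta>" and ?g' = "expproj ?m ?m ?P (inverse \<zeta>)"
  let ?X = "cutoff ?m (snd p)"
  have "cutoff ?m (snd (act n j \<zeta> p)) = ?g' * ?X * ?g"
    using M_Omega_eD(2)[OF p] blk_le[OF j] by (intro cutoff_act_ge) auto
  also have "\<dots> = ?X * ?g' * ?g"
    using expproj_commute[OF rproj_carrier cutoff_carrier rproj_commute] by simp
  also have "\<dots> = ?X * (?g' * ?g)" by (rule assoc_mult_mat[of _ ?m ?m _ ?m _ ?m]) auto
  also have "\<dots> = ?X" by (simp add: expproj_inverse(2)[OF p j z] right_mult_one_mat[of _ ?m ?m])
  finally have "cutoff k (cutoff ?m (snd (act n j \<zeta> p))) = cutoff k ?X" by simp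
  then show ?thesis using k by (simp add: cutoff_cutoff)
qed

text \<open>The eigenvalue data stay fixed. Cutoffs of size at least \<open>blk j\<close> are
  conjugated and smaller ones do not move, so all required similarities survive.\<close>

lemma act_in:
  assumes p: "p \<in> M_Omega_e n" and j: "j \<in> I (tri n)" and z: "\<zeta> \<noteq> 0"
  shows "act n j \<zeta> p \<in> M_Omega_e n"
proof -
  note D = M_Omega_eD[OF p]
  have "(fst p, snd (act n j \<zeta> p)) \<in> M_Omega_e n"
  proof (rule M_Omega_eI[OF D(1) snd_act_carrier])
    fix m assume m: "m \<in> I n"
    have s: "similar_mat (nu_diag (fst p) m) (cutoff m (snd p))"
      using similar_mat_sym[OF D(3)[OF m]] by (simp add: nu_diag_def)
    show "similar_mat (nu_diag (fst p) m) (cutoff m (snd (act n j \<zeta> p)))"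
    proof (cases "blk j \<le> m")
      case True
      have "similar_mat (cutoff m (snd (act n j \<zeta> p))) (cutoff m (snd p))"
        by (rule similar_matI[OF _ expproj_inverse(2)[OF p j z True] expproj_inverse(1)[OF p j z True] 
           cutoff_act_ge[OF D(2) True]]) (use m in \<open>auto simp: I_def\<close>)
      then show ?thesis using s similar_mat_sym similar_mat_trans by blast
    next
      case False
      then show ?thesis using s cutoff_act_le[OF p j z, of m] by simp
    qed
  qed
  then show ?thesis by (metis fst_act prod.collapse)
qed

lemma rproj_act_le:
  assumes "p \<in> M_Omega_e n" "j \<in> I (tri n)" "\<zeta> \<noteq> 0" "blk i \<le> blk j"
  shows "rproj i (act n j \<zeta> p) = rproj i p"
  unfolding rproj_def fst_act cutoff_act_le[OF assms] ..

text \<open>The larger cutoff is conjugated, and a polynomial in it with unchanged coefficients is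
  conjugated along with it.\<close>

lemma rproj_act_ge:
  assumes p: "p \<in> M_Omega_e n" and j: "j \<in> I (tri n)" and z: "\<zeta> \<noteq> 0"
    and i: "blk j \<le> blk i" "blk i \<le> n"
  shows "rproj i (act n j \<zeta> p) =
    expproj (blk i) (blk j) (rproj j p) (inverse \<zeta>) * rproj i p * expproj (blk i) (blk j) (rproj j p) \<zeta>"
proof -
  let ?k = "blk i"
  let ?g = "expproj ?k (blk j) (rproj j p) \<zeta>" and ?g' = "expproj ?k (blk j) (rproj j p) (inverse \<zeta>)"
  let ?X = "cutoff ?k (snd p)" and ?d = "nu_ev (fst p) ?k"
  note inv = expproj_inverse[OF p j z i(1)]
  have g: "?g \<in> carrier_mat ?k ?k" "?g' \<in> carrier_mat ?k ?k" and X: "?X \<in> carrier_mat ?k ?k" by auto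
  have Y: "?g' * ?X * ?g \<in> carrier_mat ?k ?k" using g X by (meson mult_carrier_mat)
  have "?g' * ?X * ?g * ?g' = ?g' * ?X"
    using conj_mult_mat(2)[OF X X g(2,1) inv(1)] by (metis (no_types, lifting) assoc_mult_mat g X inv(1) mult_carrier_mat right_mult_one_mat)
  then have "eproj ?k ?d (pos i) (?g' * ?X * ?g) * ?g' = ?g' * eproj ?k ?d (pos i) ?X"
    by (rule eproj_intertwine[OF Y X g(2)])
  then have "eproj ?k ?d (pos i) (?g' * ?X * ?g) * ?g' * ?g = ?g' * eproj ?k ?d (pos i) ?X * ?g" by simp
  also have "eproj ?k ?d (pos i) (?g' * ?X * ?g) * ?g' * ?g = eproj ?k ?d (pos i) (?g' * ?X * ?g)"
    using assoc_mult_mat[OF eproj_carrier[OF Y] g(2,1)] inv(2) right_mult_one_mat[OF eproj_carrier[OF Y]]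
    by simp
  finally show ?thesis
    unfolding rproj_def[of i] fst_act cutoff_act_ge[OF M_Omega_eD(2)[OF p] i] .
qed

lemma act_one: "p \<in> M_Omega_e n \<Longrightarrow> act n j 1 p = p"
  using M_Omega_eD(2)[of p n] by (auto simp: act_def prod_eq_iff)

text \<open>The action does not move its own projection, so both factors are built from the same
  idempotent and multiply as torus coordinates do.\<close>

lemma act_act:
  assumes p: "p \<in> M_Omega_e n" and j: "j \<in> I (tri n)" and z: "\<zeta> \<noteq> 0" "\<eta> \<noteq> 0"
  shows "act n j \<eta> (act n j \<zeta> p) = act n j (\<eta> * \<zeta>) p"
proof -
  let ?e = "expproj n (blk j) (rproj j p)"
  have r: "rproj j (act n j \<zeta> p) = rproj j p" by (rule rproj_act_le[OF p j z(1)]) simp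
  have m: "?e a * ?e b = ?e (a * b)" for a b
    by (rule expproj_mult[OF blk_le[OF j] rproj_carrier rproj_idem[OF p j]])
  have x: "snd p \<in> carrier_mat n n" using M_Omega_eD[OF p] by simp
  have "?e (inverse \<eta>) * (?e (inverse \<zeta>) * snd p * ?e \<zeta>) * ?e \<eta> =
     (?e (inverse \<eta>) * ?e (inverse \<zeta>)) * snd p * (?e \<zeta> * ?e \<eta>)"
  proof -
    have "A * (B * x * C) * D = (A * B) * x * (C * D)" 
      if "A \<in> carrier_mat n n" "B \<in> carrier_mat n n" "C \<in> carrier_mat n n" "D \<in> carrier_mat n n"
        "x \<in> carrier_mat n n" for A B C D x :: "complex mat"
      using that by (simp add: assoc_mult_mat[of _ n n _ n _ n])
    from this[OF expproj_carrier expproj_carrier expproj_carrier expproj_carrier x] show ?thesis .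
  qed
  then show ?thesis
    unfolding act_def[of n j \<eta>] act_def[of n j "\<eta> * \<zeta>"] fst_act r
    by (simp add: act_def m mult.commute)
qed

text \<open>Let \<open>g\<close> belong to the smaller block and \<open>h\<close> to the larger one.
  Acting by \<open>g\<close> first replaces \<open>h\<close> by its conjugate under
  \<open>g\<close>, and the inner factors cancel, leaving the conjugate of the
  \<open>h\<close>-moved matrix by \<open>g\<close>. In the other order \<open>g\<close> is
  unaffected by \<open>h\<close>, which gives the same matrix.\<close>

lemma act_commute_le:
  assumes p: "p \<in> M_Omega_e n" and j: "j \<in> I (tri n)" and i: "i \<in> I (tri n)"
    and z: "\<zeta> \<noteq> 0" "\<eta> \<noteq> 0" and le: "blk j \<le> blk i"
  shows "act n i \<eta> (act n j \<zeta> p) = act n j \<zeta> (act n i \<eta> p)"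
proof -
  let ?g = "\<lambda>z. expproj n (blk j) (rproj j p) z" and ?h = "\<lambda>z. expproj n (blk i) (rproj i p) z"
  let ?u = "\<lambda>z. expproj (blk i) (blk j) (rproj j p) z"
  note x = M_Omega_eD(2)[OF p]
  have gg: "?g \<zeta> * ?g (inverse \<zeta>) = 1\<^sub>m n" "?g (inverse \<zeta>) * ?g \<zeta> = 1\<^sub>m n"
    using expproj_inverse[OF p j z(1) blk_le[OF j]] by auto
  have conj: "expproj n (blk i) (rproj i (act n j \<zeta> p)) w = ?g (inverse \<zeta>) * ?h w * ?g \<zeta>" for w
  proof -
    have c: "?u (inverse \<zeta>) * rproj i p \<in> carrier_mat (blk i) (blk i)"
      by (rule mult_carrier_mat[OF expproj_carrier rproj_carrier])
    have "pad n (blk i) (rproj i (act n j \<zeta> p)) = ?g (inverse \<zeta>) * pad n (blk i) (rproj i p) * ?g \<zeta>"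
      unfolding rproj_act_ge[OF p j z(1) le blk_le[OF i]]
        expproj_mult_pad(1)[OF le blk_le[OF i] rproj_carrier rproj_carrier]
        expproj_mult_pad(2)[OF le blk_le[OF i] rproj_carrier c] ..
    moreover have "g' * (1\<^sub>m n + c \<cdot>\<^sub>m Q) * g = 1\<^sub>m n + c \<cdot>\<^sub>m (g' * Q * g)"
      if "g \<in> carrier_mat n n" "g' \<in> carrier_mat n n" "Q \<in> carrier_mat n n" "g' * g = 1\<^sub>m n"
      for g g' Q :: "complex mat" and c
      using that by (simp add: mult_add_distrib_mat[of _ n n _ n] add_mult_distrib_mat[of _ n n _ _ n]
         mult_smult_assoc_mat[of _ n n _ n] mult_smult_distrib[of _ n n _ n] right_mult_one_mat[of _ n n])
    ultimately show ?thesis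
      unfolding expproj_def[of n "blk i"] using gg(2) by (metis expproj_carrier pad_carrier)
  qed
  have "act n i \<eta> (act n j \<zeta> p) = (fst p, (?g (inverse \<zeta>) * ?h (inverse \<eta>) * ?g \<zeta>) *
      (?g (inverse \<zeta>) * snd p * ?g \<zeta>) * (?g (inverse \<zeta>) * ?h \<eta> * ?g \<zeta>))"
    unfolding act_def[of n i] conj fst_act by (simp add: act_def)
  also have "\<dots> = (fst p, ?g (inverse \<zeta>) * (?h (inverse \<eta>) * snd p * ?h \<eta>) * ?g \<zeta>)"
    using conj_conj_mat[OF expproj_carrier expproj_carrier expproj_carrier expproj_carrier x gg(1)] by simp
  also have "\<dots> = act n j \<zeta> (act n i \<eta> p)"
    unfolding act_def[of n j] rproj_act_le[OF p i z(2) le] by (simp add: act_def)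
  finally show ?thesis .
qed

lemma act_commute:
  assumes "p \<in> M_Omega_e n" "j \<in> I (tri n)" "i \<in> I (tri n)" "\<zeta> \<noteq> 0" "\<eta> \<noteq> 0"
  shows "act n i \<eta> (act n j \<zeta> p) = act n j \<zeta> (act n i \<eta> p)"
  using act_commute_le assms by (metis linear)

section \<open>Local inverses of the projection\<close>

text \<open>Differentiability implies continuity. \<open>is_local_inv\<close> provides only
  gradients, while identifying eigenvalues needs their limits.\<close>

lemma has_gradient_tendsto:
  assumes f: "has_gradient n f x G" and x: "x \<in> carrier_mat n n"
  shows "(f \<longlongrightarrow> f x) (mat_nhds n x)"
proof -
  have G: "G \<in> carrier_mat n n" using f by (simp add: has_gradient_def)
  have tr: "cmod (mat_trace (G * y)) \<le> mat_norm G * mat_norm y" if y: "y \<in> carrier_mat n n" for y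
  proof -
    have c: "G * y \<in> carrier_mat n n" using G y by simp
    have "cmod (mat_trace (G * y)) \<le> (\<Sum>i<n. cmod ((G * y) $$ (i, i)))"
      using norm_sum[of "\<lambda>i. (G * y) $$ (i, i)" "{..<n}"] carrier_matD(1)[OF c] unfolding mat_trace_def by simp
    also have "\<dots> \<le> (\<Sum>i<n. \<Sum>k<n. cmod ((G * y) $$ (i, k)))"
      by (intro sum_mono member_le_sum) auto
    also have "\<dots> \<le> mat_norm G * mat_norm y"
      using mat_norm_mult[OF G y] by (simp only: mat_norm_eq[OF c])
    finally show ?thesis .
  qed
  show ?thesis
  proof (rule tendstoI)
    fix e :: real assume e: "e > 0"
    define K where "K = mat_norm G + 1"
    have K: "K > 0" using mat_norm_nonneg[of G] by (simp add: K_def)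
    have "eventually (\<lambda>y. cmod (f y - f x - mat_trace (G * (y - x))) \<le> 1 * mat_norm (y - x)) (mat_nhds n x)"
      using f unfolding has_gradient_def eventually_mat_nhds by (auto dest!: spec[of _ 1])
    moreover have "eventually (\<lambda>y. mat_norm (y - x) < e / K) (mat_nhds n x)"
      unfolding eventually_mat_nhds using e K by (metis divide_pos_pos)
    ultimately show "eventually (\<lambda>y. dist (f y) (f x) < e) (mat_nhds n x)"
    proof eventually_elim
      case (elim y)
      have "cmod (f y - f x) \<le> cmod (f y - f x - mat_trace (G * (y - x))) + cmod (mat_trace (G * (y - x)))"
        by (metis diff_add_cancel norm_triangle_ineq)
      also have "\<dots> \<le> K * mat_norm (y - x)"
        using add_mono[OF elim(1) tr[OF minus_carrier_mat[OF x], of y]] unfolding K_def by (simp only: distrib_right add.commute)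
      also have "\<dots> < e" using elim(2) K by (simp add: field_simps)
      finally show ?case by (simp add: dist_norm)
    qed
  qed
qed

text \<open>\<epsilon> is half the smallest nonzero distance between values, with 1 inserted to
  cover the case of no nonzero distance. Discs of radius \<epsilon> around different values are then
  disjoint.\<close>

lemma finite_separation:
  fixes \<nu> :: "nat \<Rightarrow> complex"
  assumes "finite S"
  shows "\<exists>\<epsilon>>0. \<forall>i\<in>S. \<forall>j\<in>S. cmod (\<nu> i - \<nu> j) < 2 * \<epsilon> \<longrightarrow> \<nu> i = \<nu> j"
proof -
  let ?D = "(\<lambda>(i, j). cmod (\<nu> i - \<nu> j)) ` (S \<times> S) - {0}"
  have fin: "finite ?D" using assms by simp
  define \<epsilon> where "\<epsilon> = Min (insert 1 ?D) / 2"
  have "Min (insert 1 ?D) \<in> insert 1 ?D" using fin by (intro Min_in) auto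
  then have "\<epsilon> > 0" by (auto simp: \<epsilon>_def)
  moreover have sep: "2 * \<epsilon> \<le> cmod (\<nu> i - \<nu> j)" if "i \<in> S" "j \<in> S" "\<nu> i \<noteq> \<nu> j" for i j
  proof -
    have "cmod (\<nu> i - \<nu> j) \<in> insert 1 ?D" using that by force
    then have "Min (insert 1 ?D) \<le> cmod (\<nu> i - \<nu> j)" using fin by (intro Min_le) auto
    then show ?thesis by (simp add: \<epsilon>_def)
  qed
  ultimately show ?thesis using leD[OF sep] by (intro exI[of _ \<epsilon>]) blast
qed

lemma nu_ev_pos: "j \<in> I (tri n) \<Longrightarrow> nu_ev \<nu> (blk j) (pos j) = \<nu> j"
  unfolding nu_entry_def by (simp only: blk_pos)

lemma nu_ev_in_spectrum:
  assumes "p \<in> M_Omega_e n" "j \<in> I (tri n)"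
  shows "fst p j \<in> spectrum (cutoff (blk j) (snd p))"
proof -
  have "spectrum (cutoff (blk j) (snd p)) = nu_ev (fst p) (blk j) ` {..<blk j}"
    using spectrum_similar[OF M_Omega_eD(3)[OF assms(1) blk_in[OF assms(2)]]] by (simp add: spectrum_diag)
  moreover have "fst p j = nu_ev (fst p) (blk j) (pos j)"
    by (simp only: nu_ev_pos[OF assms(2)])
  ultimately show ?thesis using pos_less[OF assms(2)] by auto
qed

lemma spectrum_cutoffE:
  assumes "p \<in> M_Omega_e n" "j \<in> I (tri n)" "a \<in> spectrum (cutoff (blk j) (snd p))"
  obtains i where "i \<in> I (tri n)" "blk i = blk j" "a = fst p i"
proof -
  have "spectrum (cutoff (blk j) (snd p)) = nu_ev (fst p) (blk j) ` {..<blk j}"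
    using spectrum_similar[OF M_Omega_eD(3)[OF assms(1) blk_in[OF assms(2)]]] by (simp add: spectrum_diag)
  then obtain k where "k < blk j" "a = fst p (tri (blk j - 1) + Suc k)"
    using assms(3) by (auto simp: nu_entry_def)
  then show thesis using that index_in[OF blk_in[OF assms(2)]] blk_eq by metis
qed

lemma e_Omega_eqD:
  assumes "\<nu> \<in> e_Omega n" "i \<in> I (tri n)" "j \<in> I (tri n)" "blk i = blk j" "\<nu> i = \<nu> j"
  shows "i = j"
proof -
  have "inj_on (nu_ev \<nu> (blk j)) {..<blk j}" using assms(1) blk_in[OF assms(3)] by (rule inj_nu_ev)
  moreover have "nu_ev \<nu> (blk j) (pos i) = nu_ev \<nu> (blk j) (pos j)"
    using assms(5) blk_pos[OF assms(2)] blk_pos[OF assms(3)] by (simp add: nu_entry_def assms(4))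
  ultimately have "pos i = pos j"
    using pos_less[OF assms(2)] pos_less[OF assms(3)] assms(4) by (auto dest: inj_onD)
  then show ?thesis using blk_pos[OF assms(2)] blk_pos[OF assms(3)] assms(4) by metis
qed

lemma e_OmegaI:
  assumes "\<nu> \<in> I (tri n) \<rightarrow>\<^sub>E UNIV"
    and 1: "\<And>i j. i \<in> I (tri n) \<Longrightarrow> j \<in> I (tri n) \<Longrightarrow> blk i = blk j \<Longrightarrow> \<nu> i = \<nu> j \<Longrightarrow> i = j"
    and 2: "\<And>i j. i \<in> I (tri n) \<Longrightarrow> j \<in> I (tri n) \<Longrightarrow> blk j = Suc (blk i) \<Longrightarrow> \<nu> i \<noteq> \<nu> j"
  shows "\<nu> \<in> e_Omega n"
proof -
  have ix: "tri (m - 1) + k \<in> I (tri n) \<and> blk (tri (m - 1) + k) = m" if "m \<in> I n" "k \<in> I m" for m k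
    using index_in[OF that(1), of "k - 1"] blk_eq[of "k - 1" m] that(2) by (auto simp: I_def)
  have "inj_on (\<lambda>k. nu_entry \<nu> k m) (I m)" if m: "m \<in> I n" for m
    unfolding inj_on_def nu_entry_def using ix[OF m] 1 by (metis add_left_cancel)
  moreover have "nu_entry \<nu> i m \<noteq> nu_entry \<nu> j (m + 1)"
    if "m \<in> I (n - 1)" "i \<in> I m" "j \<in> I (m + 1)" for m i j
  proof -
    have "m \<in> I n" "m + 1 \<in> I n" using that(1) by (auto simp: I_def)
    then show ?thesis
      unfolding nu_entry_def using ix[OF _ that(2)] ix[OF _ that(3)] by (intro 2) auto
  qed
  ultimately show ?thesis using assms(1) by (auto simp: e_Omega_def)
qed

lemma e_Omega_neqD:
  assumes "\<nu> \<in> e_Omega n" "i \<in> I (tri n)" "j \<in> I (tri n)" "blk j = Suc (blk i)"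
  shows "\<nu> i \<noteq> \<nu> j"
proof -
  have "blk i \<in> I (n - 1)" "Suc (pos i) \<in> I (blk i)" "Suc (pos j) \<in> I (blk i + 1)"
    using blk_in[OF assms(2)] blk_in[OF assms(3)] pos_less[OF assms(2)] pos_less[OF assms(3)] assms(4)
    by (auto simp: I_def)
  then have "nu_entry \<nu> (Suc (pos i)) (blk i) \<noteq> nu_entry \<nu> (Suc (pos j)) (blk i + 1)"
    using assms(1) unfolding e_Omega_def by blast
  then show ?thesis using blk_pos[OF assms(2)] blk_pos[OF assms(3)] assms(4) by (simp add: nu_entry_def)
qed

text \<open>Near \<open>snd p\<close> each eigenvalue \<open>fst p j\<close> is continued by the unique eigenvalue
  of the corresponding cutoff in a small disc around \<open>fst p j\<close>.\<close>

lemma local_inv_exists: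
  assumes p: "p \<in> M_Omega_e n"
  shows "\<exists>\<sigma>. is_local_inv n p \<sigma>"
proof -
  define \<nu> x where "\<nu> = fst p" and "x = snd p"
  note D = M_Omega_eD[OF p, folded \<nu>_def x_def]
  let ?J = "I (tri n)"
  have finJ: "finite ?J" by (simp add: I_def)
  obtain \<epsilon> where e: "\<epsilon> > 0" and sep: "\<And>i j. i \<in> ?J \<Longrightarrow> j \<in> ?J \<Longrightarrow> cmod (\<nu> i - \<nu> j) < 2 * \<epsilon> \<Longrightarrow> \<nu> i = \<nu> j"
    using finite_separation[OF finJ, of \<nu>] by metis
  define near where "near y j a \<longleftrightarrow> a \<in> spectrum (cutoff (blk j) y) \<and> cmod (a - \<nu> j) < \<epsilon>" for y j a
  define good where "good y \<longleftrightarrow> y \<in> carrier_mat n n \<and> (\<forall>j\<in>?J. \<exists>a. near y j a)" for y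
  define ev where "ev y j = (SOME a. near y j a)" for y j
  define \<sigma> where "\<sigma> y = (restrict (ev y) ?J, y)" for y
  have close: "\<nu> i = \<nu> j" if "cmod (a - \<nu> i) < \<epsilon>" "cmod (a - \<nu> j) < \<epsilon>" "i \<in> ?J" "j \<in> ?J" for a i j
    using sep[OF that(3,4)] that(1,2) norm_triangle_ineq4[of "a - \<nu> j" "a - \<nu> i"] by simp
  have ev: "near y j (ev y j)" if "good y" "j \<in> ?J" for y j
    using that unfolding good_def ev_def by (metis someI_ex)
  \<comment> \<open>If two continued eigenvalues coincide, their discs meet, so the original
    eigenvalues coincide as well; the conditions on \<nu> therefore pass to the
    continuation.\<close>
  have in_e: "restrict (ev y) ?J \<in> e_Omega n" if y: "good y" for y
  proof (rule e_OmegaI)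
    fix i j assume ij: "i \<in> ?J" "j \<in> ?J"
    have *: "\<nu> i = \<nu> j" if "restrict (ev y) ?J i = restrict (ev y) ?J j"
      using close[of "ev y i" i j] ev[OF y ij(1)] ev[OF y ij(2)] that ij by (auto simp: near_def)
    show "i = j" if "blk i = blk j" "restrict (ev y) ?J i = restrict (ev y) ?J j"
      using e_Omega_eqD[OF D(1) ij that(1)] * that(2) by blast
    show "restrict (ev y) ?J i \<noteq> restrict (ev y) ?J j" if "blk j = Suc (blk i)"
      using e_Omega_neqD[OF D(1) ij that] * by blast
  qed auto
  have \<sigma>: "\<sigma> y \<in> M_Omega_e n" if y: "good y" for y
    unfolding \<sigma>_def
  proof (rule M_Omega_eI[OF in_e[OF y]])
    fix m assume m: "m \<in> I n"
    let ?d = "nu_ev (restrict (ev y) ?J) m"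
    have "?d i \<in> spectrum (cutoff m y)" if i: "i < m" for i
      using ev[OF y index_in[OF m i]] index_in[OF m i] blk_eq(1)[OF i]
      by (simp add: nu_entry_def near_def del: add_Suc_right)
    then have "similar_mat (cutoff m y) (mat_diag m ?d)"
      by (intro similar_diag_of_distinct_eigenvalues inj_nu_ev[OF in_e[OF y] m]) auto
    then show "similar_mat (nu_diag (restrict (ev y) ?J) m) (cutoff m y)"
      by (simp add: nu_diag_def similar_mat_sym)
  qed (use y in \<open>simp add: good_def\<close>)
  \<comment> \<open>The continued values exhaust the spectrum of the cutoff, so \<open>a\<close>
    continues some \<open>\<nu> i\<close> in the same block; disjointness of the discs gives
    \<open>\<nu> i = \<nu> j\<close>, and distinctness within the block gives
    \<open>i = j\<close>.\<close>
  have uniq: "a = ev y j" if y: "good y" and j: "j \<in> ?J" and a: "near y j a" for y j a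
  proof -
    obtain i where i: "i \<in> ?J" "blk i = blk j" "a = fst (\<sigma> y) i"
      using spectrum_cutoffE[OF \<sigma>[OF y] j, of a] a by (auto simp: near_def \<sigma>_def)
    have "\<nu> i = \<nu> j"
      using close[of a i j] ev[OF y i(1)] a i(1,3) j by (auto simp: near_def \<sigma>_def)
    then have "i = j" using e_Omega_eqD[OF D(1) i(1) j i(2)] by simp
    then show ?thesis using i by (simp add: \<sigma>_def)
  qed
  have "eventually (\<lambda>y. \<forall>j\<in>?J. \<exists>a. near y j a) (mat_nhds n x)"
  proof (intro eventually_ball_finite finJ ballI)
    fix j assume j: "j \<in> ?J"
    show "eventually (\<lambda>y. \<exists>a. near y j a) (mat_nhds n x)"
      using eventually_eigenvalue_near[OF D(2) blk_le[OF j] _ e, of "\<nu> j"] nu_ev_in_spectrum[OF p j]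
      unfolding \<nu>_def x_def near_def by (auto elim!: eventually_mono)
  qed
  then have gd: "eventually good (mat_nhds n x)"
    unfolding good_def using eventually_mat_nhds_carrier by eventually_elim auto
  have grad: "\<exists>G. has_gradient n (\<lambda>z. fst (\<sigma> z) j) y G"
    if ge: "eventually good (mat_nhds n y)" and yc: "y \<in> carrier_mat n n" and j: "j \<in> ?J" for y j
  proof -
    have y: "good y" using ge yc by (rule eventually_mat_nhds_self)
    have fev: "fst (\<sigma> z) j = ev z j" for z using j by (simp add: \<sigma>_def)
    have evj: "ev y j = nu_ev (fst (\<sigma> y)) (blk j) (pos j)"
      by (simp only: nu_ev_pos[OF j] fev)
    have "((\<lambda>z. ev z j) \<longlongrightarrow> ev y j) (mat_nhds n y)"
    proof (rule tendstoI)
      fix r :: real assume r: "r > 0"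
      \<comment> \<open>Keeps the small disc around \<open>ev y j\<close> inside the disc of radius
        \<epsilon> around \<open>\<nu> j\<close>, so that an eigenvalue found there must be
        \<open>ev z j\<close> by uniqueness.\<close>
      define r' where "r' = min r (\<epsilon> - cmod (ev y j - \<nu> j))"
      have r': "r' > 0" using r ev[OF y j] by (simp add: r'_def near_def)
      have "ev y j \<in> spectrum (cutoff (blk j) y)" using ev[OF y j] by (simp add: near_def)
      from eventually_eigenvalue_near[OF yc blk_le[OF j] this r'] ge
      show "eventually (\<lambda>z. dist (ev z j) (ev y j) < r) (mat_nhds n y)"
      proof eventually_elim
        case (elim z)
        then obtain a where a: "a \<in> spectrum (cutoff (blk j) z)" "cmod (a - ev y j) < r'" by auto
        have "cmod (a - \<nu> j) \<le> cmod (a - ev y j) + cmod (ev y j - \<nu> j)"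
          by (metis diff_add_cancel add_diff_eq norm_triangle_ineq)
        then have "near z j a" using a by (simp add: near_def r'_def)
        then have "a = ev z j" using uniq elim(2) j by blast
        then show ?case using a by (simp add: dist_norm r'_def)
      qed
    qed
    moreover have "eventually (\<lambda>z. fst (\<sigma> z) j \<in> spectrum (cutoff (blk j) z)) (mat_nhds n y)"
      using ge by eventually_elim (use ev j in \<open>auto simp: fev near_def\<close>)
    moreover have "similar_mat (cutoff (blk j) y) (mat_diag (blk j) (nu_ev (fst (\<sigma> y)) (blk j)))"
      using M_Omega_eD(3)[OF \<sigma>[OF y] blk_in[OF j]] by (simp add: \<sigma>_def)
    ultimately show ?thesis
      using eigenvalue_has_gradient[OF yc blk_le[OF j] inj_nu_ev[OF M_Omega_eD(1)[OF \<sigma>[OF y]] blk_in[OF j]]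
          _ pos_less[OF j], of "\<lambda>z. fst (\<sigma> z) j"]
      by (auto simp: fev evj[symmetric])
  qed
  have gx: "good x" using gd D(2) by (rule eventually_mat_nhds_self)
  have "restrict (ev x) ?J = \<nu>"
  proof
    fix j
    show "restrict (ev x) ?J j = \<nu> j"
    proof (cases "j \<in> ?J")
      case True
      have "near x j (\<nu> j)"
        using nu_ev_in_spectrum[OF p True] e by (simp add: near_def \<nu>_def x_def)
      then show ?thesis using uniq[OF gx True] True by simp
    next
      case False
      then show ?thesis using D(1) by (auto simp: e_Omega_def)
    qed
  qed
  then have "\<sigma> x = p" by (simp add: \<sigma>_def \<nu>_def x_def)
  moreover have "eventually (\<lambda>y. \<sigma> y \<in> M_Omega_e n \<and> snd (\<sigma> y) = y \<and>
      (\<forall>j\<in>?J. \<exists>G. has_gradient n (\<lambda>z. fst (\<sigma> z) j) y G)) (mat_nhds n x)"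
    using gd eventually_eventually_mat_nhds[OF gd D(2)] eventually_mat_nhds_carrier
    by eventually_elim (use \<sigma> grad in \<open>auto simp: \<sigma>_def\<close>)
  ultimately have "is_local_inv n p \<sigma>"
    unfolding is_local_inv_def eventually_mat_nhds x_def by blast
  then show ?thesis by blast
qed

section \<open>Gradients and curves through the chosen local inverse\<close>

lemma is_local_inv_local_inv: "p \<in> M_Omega_e n \<Longrightarrow> is_local_inv n p (local_inv n p)"
  unfolding local_inv_def using local_inv_exists by (rule someI_ex)

lemma local_inv_self: "p \<in> M_Omega_e n \<Longrightarrow> local_inv n p (snd p) = p"
  using is_local_inv_local_inv by (simp add: is_local_inv_def)

lemma eventually_local_inv:
  assumes "p \<in> M_Omega_e n"
  shows "eventually (\<lambda>y. local_inv n p y \<in> M_Omega_e n \<and> snd (local_inv n p y) = y) (mat_nhds n (snd p))"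
  using is_local_inv_local_inv[OF assms] unfolding is_local_inv_def eventually_mat_nhds by blast

lemma tendsto_local_inv:
  assumes p: "p \<in> M_Omega_e n" and j: "j \<in> I (tri n)"
  shows "((\<lambda>y. fst (local_inv n p y) j) \<longlongrightarrow> fst p j) (mat_nhds n (snd p))"
proof -
  have x: "snd p \<in> carrier_mat n n" using M_Omega_eD[OF p] by simp
  obtain G where "has_gradient n (\<lambda>y. fst (local_inv n p y) j) (snd p) G"
    using is_local_inv_local_inv[OF p] j x unfolding is_local_inv_def by (metis mat_norm_diff_self)
  from has_gradient_tendsto[OF this x] show ?thesis by (simp add: local_inv_self[OF p])
qed

lemma local_inv_gradient:
  assumes p: "p \<in> M_Omega_e n" and j: "j \<in> I (tri n)"
  shows "has_gradient n (\<lambda>y. fst (local_inv n p y) j) (snd p) (pad n (blk j) (rproj j p))"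
  unfolding rproj_def
proof (rule eigenvalue_has_gradient)
  note D = M_Omega_eD[OF p]
  have e: "nu_ev (fst p) (blk j) (pos j) = fst p j" by (rule nu_ev_pos[OF j])
  show "((\<lambda>y. fst (local_inv n p y) j) \<longlongrightarrow> nu_ev (fst p) (blk j) (pos j)) (mat_nhds n (snd p))"
    unfolding e by (rule tendsto_local_inv[OF p j])
  show "fst (local_inv n p (snd p)) j = nu_ev (fst p) (blk j) (pos j)"
    by (simp add: e local_inv_self[OF p])
  show "eventually (\<lambda>y. fst (local_inv n p y) j \<in> spectrum (cutoff (blk j) y)) (mat_nhds n (snd p))"
    using eventually_local_inv[OF p] by eventually_elim (metis nu_ev_in_spectrum j)
qed (use M_Omega_eD[OF p] blk_in[OF j] blk_le[OF j] pos_less[OF j] inj_nu_ev in auto)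

text \<open>Stands in for uniqueness of the germ. Both points over \<open>snd (c s)\<close> list
  eigenvalues of the same cutoffs, those of the curve being the constants \<open>fst p\<close>; the
  local inverse varies continuously and the constants are separated, so the lists agree.\<close>

lemma eventually_local_inv_curve:
  assumes p: "p \<in> M_Omega_e n" and c: "\<And>s. c s \<in> M_Omega_e n" "\<And>s. fst (c s) = fst p"
    and lim: "filterlim (\<lambda>s. snd (c s)) (mat_nhds n (snd p)) F"
  shows "eventually (\<lambda>s. local_inv n p (snd (c s)) = c s) F"
proof -
  let ?J = "I (tri n)"
  have finJ: "finite ?J" by (simp add: I_def)
  obtain \<epsilon> where e: "\<epsilon> > 0"
    and sep: "\<And>i j. i \<in> ?J \<Longrightarrow> j \<in> ?J \<Longrightarrow> cmod (fst p i - fst p j) < 2 * \<epsilon> \<Longrightarrow> fst p i = fst p j"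
    using finite_separation[OF finJ, of "fst p"] by metis
  have "eventually (\<lambda>y. \<forall>j\<in>?J. dist (fst (local_inv n p y) j) (fst p j) < 2 * \<epsilon>) (mat_nhds n (snd p))"
    using tendsto_local_inv[OF p] e by (intro eventually_ball_finite finJ ballI tendstoD) auto
  from eventually_compose_filterlim[OF eventually_conj[OF this eventually_local_inv[OF p]] lim]
  show ?thesis
  proof eventually_elim
    case (elim s)
    let ?q = "local_inv n p (snd (c s))"
    have q: "?q \<in> M_Omega_e n" "snd ?q = snd (c s)" using elim by auto
    have "fst ?q j = fst p j" if j: "j \<in> ?J" for j
    proof -
      have "fst ?q j \<in> spectrum (cutoff (blk j) (snd (c s)))"
        using nu_ev_in_spectrum[OF q(1) j] q(2) by simp
      then obtain i where i: "i \<in> ?J" "fst ?q j = fst p i"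
        using spectrum_cutoffE[OF c(1) j] c(2) by metis
      then show ?thesis using elim j sep[of i j] by (auto simp: dist_norm)
    qed
    moreover have "fst ?q \<in> e_Omega n" "fst p \<in> e_Omega n"
      using M_Omega_eD(1) q(1) p by auto
    ultimately have "fst ?q = fst p"
      by (intro extensionalityI[of _ ?J]) (auto simp: e_Omega_def PiE_def)
    then show ?case using q(2) c(2) by (simp add: prod_eq_iff)
  qed
qed

abbreviation bracket :: "complex mat \<Rightarrow> complex mat \<Rightarrow> complex mat" where
  "bracket x y \<equiv> x * y - y * x"

text \<open>Cyclicity of the trace moves the gradient \<open>G\<close> of the test function to the
  front, exhibiting the velocity of the Hamiltonian field as the bracket of \<open>x\<close> with
  the padded projection.\<close>

lemma xi_eq:
  assumes p: "p \<in> M_Omega_e n" and j: "j \<in> I (tri n)"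
    and \<psi>: "has_gradient n (\<psi> \<circ> local_inv n p) (snd p) G"
  shows "\<xi> n (r_fun j) \<psi> p = mat_trace (G * bracket (snd p) (pad n (blk j) (rproj j p)))"
proof -
  define V x where "V = pad n (blk j) (rproj j p)" and "x = snd p"
  have x: "x \<in> carrier_mat n n" and V: "V \<in> carrier_mat n n" and G: "G \<in> carrier_mat n n"
    using M_Omega_eD(2)[OF p] \<psi> by (auto simp: V_def x_def has_gradient_def)
  have r: "r_fun j \<circ> local_inv n p = (\<lambda>y. fst (local_inv n p y) j)"
    by (auto simp: r_fun_def split: prod.split)
  have "\<xi> n (r_fun j) \<psi> p = mat_trace (x * (V * G - G * V))"
    unfolding \<xi>_def poisson_e_def poisson_def r
    using gradient_eq[OF local_inv_gradient[OF p j]] gradient_eq[OF \<psi>] x by (simp add: x_def V_def)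
  also have "\<dots> = mat_trace (x * (V * G)) - mat_trace (x * (G * V))"
    using x V G by (simp add: mult_minus_distrib_mat[of _ n n _ n] mat_trace_minus[of _ n])
  also have "x * (V * G) = (x * V) * G" using x V G by simp
  also have "mat_trace \<dots> = mat_trace (G * (x * V))"
    using x V G by (intro mat_trace_comm[of _ n]) auto
  also have "mat_trace (x * (G * V)) = mat_trace ((G * V) * x)"
    using x V G by (intro mat_trace_comm[of _ n]) auto
  also have "(G * V) * x = G * (V * x)" using x V G by simp
  also have "mat_trace (G * (x * V)) - mat_trace (G * (V * x)) = mat_trace (G * bracket x V)"
    using x V G by (simp add: mult_minus_distrib_mat[of _ n n _ n] mat_trace_minus[of _ n])
  finally show ?thesis unfolding x_def V_def .
qed

section \<open>Integral curves\<close>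

definition mact :: "nat \<Rightarrow> (nat \<Rightarrow> complex) \<Rightarrow> nat list \<Rightarrow> pt \<Rightarrow> pt" where
  "mact n z js p = foldr (\<lambda>j. act n j (z j)) js p"

lemma mact_simps [simp]:
  "mact n z [] p = p" "mact n z (j # js) p = act n j (z j) (mact n z js p)"
  by (simp_all add: mact_def)

lemma fst_mact [simp]: "fst (mact n z js p) = fst p"
  by (induction js) auto

lemma mact_in:
  assumes "p \<in> M_Omega_e n" "set js \<subseteq> I (tri n)" "\<And>j. j \<in> set js \<Longrightarrow> z j \<noteq> 0"
  shows "mact n z js p \<in> M_Omega_e n"
  using assms by (induction js) (auto intro: act_in)

lemma mact_cong: "(\<And>j. j \<in> set js \<Longrightarrow> z j = w j) \<Longrightarrow> mact n z js p = mact n w js p"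
  by (induction js) auto

lemma mact_one:
  assumes "p \<in> M_Omega_e n" "set js \<subseteq> I (tri n)" "\<And>j. j \<in> set js \<Longrightarrow> z j = 1"
  shows "mact n z js p = p"
  using assms by (induction js) (auto simp: act_one)

lemma act_mact_commute:
  assumes "p \<in> M_Omega_e n" "set js \<subseteq> I (tri n)" "\<And>j. j \<in> set js \<Longrightarrow> z j \<noteq> 0"
    and "i \<in> I (tri n)" "\<eta> \<noteq> 0"
  shows "mact n z js (act n i \<eta> p) = act n i \<eta> (mact n z js p)"
  using assms(2,3)
proof (induction js)
  case (Cons j js)
  then show ?case
    using act_commute[of "mact n z js p" n i j \<eta> "z j"] mact_in[OF assms(1), of js z] assms(4,5) by auto
qed simp

lemma mact_mult:
  assumes p: "p \<in> M_Omega_e n" and "set js \<subseteq> I (tri n)"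
    and "\<And>j. j \<in> set js \<Longrightarrow> z j \<noteq> 0" "\<And>j. j \<in> set js \<Longrightarrow> w j \<noteq> 0"
  shows "mact n z js (mact n w js p) = mact n (\<lambda>j. z j * w j) js p"
  using assms(2-4)
proof (induction js)
  case (Cons j js)
  then have js: "set js \<subseteq> I (tri n)" "\<And>j. j \<in> set js \<Longrightarrow> z j \<noteq> 0" "\<And>j. j \<in> set js \<Longrightarrow> w j \<noteq> 0"
    and j: "j \<in> I (tri n)" "z j \<noteq> 0" "w j \<noteq> 0" by auto
  have q: "mact n w js p \<in> M_Omega_e n" by (rule mact_in[OF p js(1,3)])
  have "mact n z (j # js) (mact n w (j # js) p) =
      act n j (z j) (act n j (w j) (mact n z js (mact n w js p)))"
    using act_mact_commute[OF q js(1,2) j(1,3)] by simp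
  also have "\<dots> = act n j (z j * w j) (mact n z js (mact n w js p))"
    by (rule act_act[OF mact_in[OF q js(1,2)] j(1,3,2)])
  also have "mact n z js (mact n w js p) = mact n (\<lambda>j. z j * w j) js p"
    using Cons.IH js by blast
  finally show ?case by simp
qed simp

lemma mact_remove1:
  assumes "p \<in> M_Omega_e n" "set js \<subseteq> I (tri n)" "\<And>j. j \<in> set js \<Longrightarrow> z j \<noteq> 0" "i \<in> set js"
  shows "mact n z js p = act n i (z i) (mact n z (remove1 i js) p)"
  using assms(2-4)
proof (induction js)
  case (Cons j js)
  show ?case
  proof (cases "i = j")
    case False
    have s: "set (remove1 i js) \<subseteq> set js" by (rule set_remove1_subset)
    have "mact n z (j # js) p = act n j (z j) (act n i (z i) (mact n z (remove1 i js) p))"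
      using Cons False by auto
    also have "\<dots> = act n i (z i) (act n j (z j) (mact n z (remove1 i js) p))"
      using Cons.prems False s by (intro act_commute mact_in assms(1)) auto
    finally show ?thesis using False by simp
  qed simp
qed simp

text \<open>By commutativity any factor can be pulled to the front. Independence of the order is
  what reconciles the sorted order used in the construction with arbitrary enumerations.\<close>

lemma mact_distinct_cong:
  assumes "p \<in> M_Omega_e n" "set js \<subseteq> I (tri n)" "\<And>j. j \<in> set js \<Longrightarrow> z j \<noteq> 0"
    and "distinct js" "distinct ks" "set js = set ks"
  shows "mact n z js p = mact n z ks p"
  using assms(2-6)
proof (induction js arbitrary: ks)
  case (Cons j js)
  have "mact n z js p = mact n z (remove1 j ks) p"
    using Cons.prems by (intro Cons.IH) (auto simp: set_remove1_eq)
  moreover have ks: "set ks \<subseteq> I (tri n)" "\<And>i. i \<in> set ks \<Longrightarrow> z i \<noteq> 0" "j \<in> set ks"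
    using Cons.prems(1,2) unfolding Cons.prems(5) by (auto simp: Cons.prems(5)[symmetric])
  have "mact n z ks p = act n j (z j) (mact n z (remove1 j ks) p)"
    by (rule mact_remove1[OF assms(1) ks])
  ultimately show ?case by simp
qed simp

lemma rproj_mact:
  assumes "p \<in> M_Omega_e n" "set js \<subseteq> I (tri n)" "\<And>j. j \<in> set js \<Longrightarrow> z j \<noteq> 0"
    and "\<And>j. j \<in> set js \<Longrightarrow> blk i \<le> blk j"
  shows "rproj i (mact n z js p) = rproj i p"
  using assms(2-4)
proof (induction js)
  case (Cons j js)
  then show ?case
    using rproj_act_le[of "mact n z js p" n j "z j" i] mact_in[OF assms(1), of js z] by simp
qed simp

text \<open>The velocity of the combined flow at its base point, by recursion along the list so that
  the empty case can name the zero matrix of size \<open>n\<close>.\<close>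

fun hamiltonian_sum :: "nat \<Rightarrow> (nat \<Rightarrow> complex) \<Rightarrow> nat list \<Rightarrow> pt \<Rightarrow> complex mat" where
  "hamiltonian_sum n a [] p = 0\<^sub>m n n"
| "hamiltonian_sum n a (j # js) p =
     a j \<cdot>\<^sub>m bracket (snd p) (pad n (blk j) (rproj j p)) + hamiltonian_sum n a js p"

lemma bracket_carrier:
  "x \<in> carrier_mat n n \<Longrightarrow> y \<in> carrier_mat n n \<Longrightarrow> bracket x y \<in> carrier_mat n n"
  by (intro minus_carrier_mat) simp

lemma hamiltonian_sum_carrier: "snd p \<in> carrier_mat n n \<Longrightarrow> hamiltonian_sum n a js p \<in> carrier_mat n n"
  by (induction js) (auto intro!: bracket_carrier)

lemma has_mat_deriv_cong:
  "has_mat_deriv n X X' q \<Longrightarrow> X' = X'' \<Longrightarrow> (\<And>s. X s = Y s) \<Longrightarrow> has_mat_deriv n Y X'' q"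
  by (metis ext)

lemma has_mat_deriv_expproj:
  assumes "(f has_field_derivative f') (at q)"
  shows "has_mat_deriv n (\<lambda>t. expproj n m P (f t)) (f' \<cdot>\<^sub>m pad n m P) q"
  unfolding expproj_def using assms
  by (intro has_mat_deriv_line) (auto intro!: derivative_eq_intros)

text \<open>For increasing indices the factors are applied in the order of decreasing block size, so that
  every factor uses the projection at the base point.\<close>

lemma mact_deriv_0:
  assumes p: "p \<in> M_Omega_e n" and "set js \<subseteq> I (tri n)" "sorted js"
  shows "has_mat_deriv n (\<lambda>t. snd (mact n (\<lambda>j. exp (t * a j)) js p)) (hamiltonian_sum n a js p) 0"
  using assms(2,3)
proof (induction js)
  case Nil
  then show ?case using M_Omega_eD(2)[OF p] by (simp add: has_mat_deriv_const)
next
  case (Cons j js)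
  define V where "V = pad n (blk j) (rproj j p)"
  define Y where "Y t = snd (mact n (\<lambda>j. exp (t * a j)) js p)" for t
  let ?H = "hamiltonian_sum n a js p"
  let ?x = "snd p" and ?g = "expproj n (blk j) (rproj j p)"
  have js: "set js \<subseteq> I (tri n)" using Cons by auto
  have x: "?x \<in> carrier_mat n n" using M_Omega_eD(2)[OF p] .
  have V: "V \<in> carrier_mat n n" by (simp add: V_def)
  have H: "?H \<in> carrier_mat n n" using x by (rule hamiltonian_sum_carrier)
  have dY: "has_mat_deriv n Y ?H 0" unfolding Y_def using Cons by simp
  have Y0: "Y 0 = ?x" unfolding Y_def using mact_one[OF p js] by simp
  \<comment> \<open>The remaining indices are at least \<open>j\<close>, so their blocks are at
    least as large, and their actions leave this projection alone.\<close>
  have r: "rproj j (mact n (\<lambda>j. exp (t * a j)) js p) = rproj j p" for t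
    using Cons.prems by (intro rproj_mact p js) (auto intro: blk_mono)
  have d1: "has_mat_deriv n (\<lambda>t. ?g (inverse (exp (t * a j)))) (- a j \<cdot>\<^sub>m V) 0"
    unfolding V_def by (rule has_mat_deriv_expproj) (auto intro!: derivative_eq_intros)
  have d2: "has_mat_deriv n (\<lambda>t. ?g (exp (t * a j))) (a j \<cdot>\<^sub>m V) 0"
    unfolding V_def by (rule has_mat_deriv_expproj) (auto intro!: derivative_eq_intros)
  show ?case
  proof (rule has_mat_deriv_cong[OF has_mat_deriv_mult[OF has_mat_deriv_mult[OF d1 dY] d2]])
    show "?g (inverse (exp (t * a j))) * Y t * ?g (exp (t * a j)) =
        snd (mact n (\<lambda>j. exp (t * a j)) (j # js) p)" for t
      by (simp add: act_def r Y_def)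
    have aV: "(- a j \<cdot>\<^sub>m V) * ?x = - a j \<cdot>\<^sub>m (V * ?x)" "?x * (a j \<cdot>\<^sub>m V) = a j \<cdot>\<^sub>m (?x * V)"
      using x V by (simp_all add: mult_smult_assoc_mat[of _ n n _ n] mult_smult_distrib[of _ n n _ n])
    have g1: "?g (inverse (exp (0 * a j))) = 1\<^sub>m n" "?g (exp (0 * a j)) = 1\<^sub>m n" by simp_all
    have add: "- b \<cdot>\<^sub>m A + H + b \<cdot>\<^sub>m B = b \<cdot>\<^sub>m (B - A) + H"
      if "A \<in> carrier_mat n n" "B \<in> carrier_mat n n" "H \<in> carrier_mat n n" for b and A B H :: "complex mat"
      using that by (intro eq_matI) (auto simp: algebra_simps)
    have c: "V * ?x \<in> carrier_mat n n" "?x * V \<in> carrier_mat n n" using x V by auto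
    have c': "- a j \<cdot>\<^sub>m (V * ?x) + ?H \<in> carrier_mat n n" using c H by auto
    show "((- a j \<cdot>\<^sub>m V) * Y 0 + ?g (inverse (exp (0 * a j))) * ?H) * ?g (exp (0 * a j)) +
        ?g (inverse (exp (0 * a j))) * Y 0 * (a j \<cdot>\<^sub>m V) = hamiltonian_sum n a (j # js) p"
      unfolding Y0 hamiltonian_sum.simps V_def[symmetric] g1 left_mult_one_mat[OF H]
        left_mult_one_mat[OF x] aV right_mult_one_mat[OF c'] by (rule add[OF c H])
  qed
qed

lemma mat_trace_hamiltonian_sum:
  assumes "G \<in> carrier_mat n n" and x: "snd p \<in> carrier_mat n n" and "distinct js"
  shows "mat_trace (G * hamiltonian_sum n a js p) =
    (\<Sum>j\<in>set js. a j * mat_trace (G * bracket (snd p) (pad n (blk j) (rproj j p))))"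
  using assms(3)
proof (induction js)
  case Nil
  have "mat_trace (0\<^sub>m n n) = 0" by (simp add: mat_trace_def)
  then show ?case using right_mult_zero_mat[OF assms(1), of n] by simp
next
  case (Cons j js)
  let ?B = "bracket (snd p) (pad n (blk j) (rproj j p))"
  have B: "?B \<in> carrier_mat n n" using x by (intro bracket_carrier) auto
  have H: "hamiltonian_sum n a js p \<in> carrier_mat n n" using x by (rule hamiltonian_sum_carrier)
  have "mat_trace (G * (c \<cdot>\<^sub>m B + H)) = c * mat_trace (G * B) + mat_trace (G * H)"
    if "B \<in> carrier_mat n n" "H \<in> carrier_mat n n" for B H c
    using assms(1) that by (simp add: mat_trace_mult[of _ n] sum.distrib sum_distrib_left distrib_left mult.left_commute)
  from this[OF B H] show ?case using Cons by simp
qed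

text \<open>The chain rule applies to \<open>\<psi> \<circ> local_inv n p\<close> along the matrix
  part of the curve; the resulting trace splits into the Hamiltonian fields weighted by
  \<open>a\<close>.\<close>

lemma mact_analytic_deriv_0:
  assumes p: "p \<in> M_Omega_e n" and js: "set js \<subseteq> I (tri n)" "sorted js" "distinct js"
    and \<psi>: "analytic_fun n \<psi>"
  shows "((\<lambda>t. \<psi> (mact n (\<lambda>j. exp (t * a j)) js p)) has_field_derivative r_field n (set js) a \<psi> p) (at 0)"
proof -
  define c where "c t = mact n (\<lambda>j. exp (t * a j)) js p" for t
  obtain G where G: "has_gradient n (\<psi> \<circ> local_inv n p) (snd p) G"
    using \<psi> p unfolding analytic_fun_def by blast
  have x: "snd p \<in> carrier_mat n n" using M_Omega_eD(2)[OF p] .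
  have c0: "c 0 = p" unfolding c_def using mact_one[OF p js(1)] by simp
  have cin: "c t \<in> M_Omega_e n" for t unfolding c_def using js(1) by (intro mact_in p) auto
  have d: "has_mat_deriv n (\<lambda>t. snd (c t)) (hamiltonian_sum n a js p) 0"
    unfolding c_def by (rule mact_deriv_0[OF p js(1,2)])
  have "mat_trace (G * hamiltonian_sum n a js p) = r_field n (set js) a \<psi> p"
    using G x js xi_eq[OF p _ G] unfolding r_field_def
    by (subst mat_trace_hamiltonian_sum) (auto simp: has_gradient_def intro!: sum.cong)
  then have "((\<lambda>t. (\<psi> \<circ> local_inv n p) (snd (c t))) has_field_derivative r_field n (set js) a \<psi> p) (at 0)"
    using has_gradient_chain[OF _ d, of "\<psi> \<circ> local_inv n p" G] G by (simp add: c0)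
  \<comment> \<open>The actions keep \<nu> constant, so near time 0 the local inverse recovers the
    curve. The value at \<open>t = 0\<close> is added separately because the derivative is taken in
    a full neighbourhood.\<close>
  moreover have "eventually (\<lambda>t. (\<psi> \<circ> local_inv n p) (snd (c t)) = \<psi> (c t)) (nhds 0)"
  proof -
    have "eventually (\<lambda>t. local_inv n p (snd (c t)) = c t) (at 0)"
      using has_mat_deriv_filterlim[OF d] c0
      by (intro eventually_local_inv_curve[OF p cin]) (simp_all add: c_def)
    then show ?thesis
      unfolding eventually_at_filter
    proof eventually_elim
      case (elim t)
      then show ?case by (cases "t = 0") (simp_all add: c0 local_inv_self[OF p])
    qed
  qed
  ultimately show ?thesis unfolding c_def[symmetric] by (subst DERIV_cong_ev[OF refl _ refl, symmetric])
qed

text \<open>The group law makes the curve at time \<open>t + q\<close> the curve of time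
  \<open>t\<close> started at its value at \<open>q\<close>, reducing the derivative at
  \<open>q\<close> to the one at 0.\<close>

lemma mact_analytic_deriv:
  assumes p: "p \<in> M_Omega_e n" and js: "set js \<subseteq> I (tri n)" "sorted js" "distinct js"
    and \<psi>: "analytic_fun n \<psi>"
  shows "((\<lambda>t. \<psi> (mact n (\<lambda>j. exp (t * a j)) js p)) has_field_derivative
    r_field n (set js) a \<psi> (mact n (\<lambda>j. exp (q * a j)) js p)) (at q)"
proof -
  let ?q = "mact n (\<lambda>j. exp (q * a j)) js p"
  have "mact n (\<lambda>j. exp (t * a j)) js ?q = mact n (\<lambda>j. exp ((t + q) * a j)) js p" for t
    using mact_mult[OF p js(1), of "\<lambda>j. exp (t * a j)" "\<lambda>j. exp (q * a j)"]
    by (simp add: exp_add[symmetric] distrib_right)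
  moreover have "?q \<in> M_Omega_e n" using js(1) by (intro mact_in p) auto
  ultimately have "((\<lambda>t. \<psi> (mact n (\<lambda>j. exp ((t + q) * a j)) js p)) has_field_derivative
      r_field n (set js) a \<psi> ?q) (at 0)"
    using mact_analytic_deriv_0[OF _ js \<psi>, of ?q a] by simp
  then show ?thesis
    using DERIV_shift[of "\<lambda>t. \<psi> (mact n (\<lambda>j. exp (t * a j)) js p)" _ 0 q] by (simp add: add.commute)
qed

lemma r_field_single: "r_field n {j} (\<lambda>_. 1) = \<xi> n (r_fun j)"
  by (auto simp: r_field_def)

lemma act_analytic_deriv:
  assumes "p \<in> M_Omega_e n" "j \<in> I (tri n)" "analytic_fun n \<psi>"
  shows "((\<lambda>t. \<psi> (act n j (exp t) p)) has_field_derivative \<xi> n (r_fun j) \<psi> (act n j (exp q) p)) (at q)"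
  using mact_analytic_deriv[OF assms(1) _ _ _ assms(3), of "[j]" "\<lambda>_. 1" q] assms(2)
  by (simp add: r_field_single)

section \<open>Test functions and uniqueness of integral curves\<close>

lemma analytic_r_fun: "i \<in> I (tri n) \<Longrightarrow> analytic_fun n (r_fun i)"
  unfolding analytic_fun_def
proof
  fix p assume "i \<in> I (tri n)" "p \<in> M_Omega_e n"
  then have "has_gradient n (\<lambda>y. fst (local_inv n p y) i) (snd p) (pad n (blk i) (rproj i p))"
    by (intro local_inv_gradient)
  moreover have "r_fun i \<circ> local_inv n p = (\<lambda>y. fst (local_inv n p y) i)"
    by (auto simp: r_fun_def split: prod.split)
  ultimately show "\<exists>G. has_gradient n (r_fun i \<circ> local_inv n p) (snd p) G" by auto
qed

lemma analytic_entry: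
  assumes "a < n" "b < n"
  shows "analytic_fun n (\<lambda>p. snd p $$ (a, b))"
  unfolding analytic_fun_def
proof
  fix p assume p: "p \<in> M_Omega_e n"
  have x: "snd p \<in> carrier_mat n n" using M_Omega_eD(2)[OF p] .
  obtain G where G: "has_gradient n (\<lambda>y. y $$ (a, b)) (snd p) G"
    using has_gradient_entry[OF x assms] by blast
  have "eventually (\<lambda>y. y $$ (a, b) = ((\<lambda>p. snd p $$ (a, b)) \<circ> local_inv n p) y) (mat_nhds n (snd p))"
    using eventually_local_inv[OF p] by eventually_elim simp
  from has_gradient_cong[OF this x G]
  show "\<exists>G. has_gradient n ((\<lambda>p. snd p $$ (a, b)) \<circ> local_inv n p) (snd p) G" by blast
qed

lemma DERIV_zero_imp_const:
  fixes f :: "complex \<Rightarrow> complex"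
  assumes "\<And>z. (f has_field_derivative 0) (at z)"
  shows "f z = f 0"
proof -
  have d: "((\<lambda>t. f (of_real t * z)) has_derivative (\<lambda>_. 0)) (at t)" for t :: real
  proof -
    have "((\<lambda>t. of_real t * z) has_derivative (\<lambda>h. of_real h * z)) (at t)"
      by (auto intro!: derivative_eq_intros)
    from has_derivative_compose[OF this, of f "\<lambda>_. 0"] show ?thesis
      using assms[of "of_real t * z"] by (simp add: has_field_derivative_def lambda_zero[symmetric])
  qed
  have "((\<lambda>t. Re (f (of_real t * z))) has_field_derivative 0) (at t)"
    "((\<lambda>t. Im (f (of_real t * z))) has_field_derivative 0) (at t)" for t :: real
    using has_derivative_Re[OF d] has_derivative_Im[OF d]
    by (simp_all add: has_field_derivative_def lambda_zero[symmetric])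
  then have "Re (f (of_real 1 * z)) = Re (f (of_real 0 * z))" "Im (f (of_real 1 * z)) = Im (f (of_real 0 * z))"
    using DERIV_isconst_all[of "\<lambda>t. Re (f (of_real t * z))" 1 0]
      DERIV_isconst_all[of "\<lambda>t. Im (f (of_real t * z))" 1 0] by blast+
  then show ?thesis by (simp add: complex_eq_iff)
qed

lemma integral_curve_act:
  assumes "p \<in> M_Omega_e n" "j \<in> I (tri n)"
  shows "integral_curve n (\<xi> n (r_fun j)) (\<lambda>t. act n j (exp t) p)"
  unfolding integral_curve_def using act_in act_analytic_deriv assms by auto

text \<open>Any integral curve has, at each time, the same velocity against test functions as the
  explicit orbit through its current point. Conserved quantities of the orbits are therefore
  conserved along the curve, which freezes the projection and leaves a linear equation with constant
  coefficients.\<close>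

lemma integral_curve_unique:
  assumes p: "p \<in> M_Omega_e n" and j: "j \<in> I (tri n)"
    and c: "integral_curve n (\<xi> n (r_fun j)) c" and c0: "c 0 = p"
  shows "c t = act n j (exp t) p"
proof -
  let ?m = "blk j"
  have cin: "c s \<in> M_Omega_e n" for s using c by (simp add: integral_curve_def)
  have cx: "snd (c s) \<in> carrier_mat n n" for s using M_Omega_eD(2)[OF cin] .
  \<comment> \<open>Transfers derivatives along the orbit of \<open>c s\<close> at time 0 to the
    unknown curve at time \<open>s\<close>.\<close>
  have dc: "((\<lambda>s. \<psi> (c s)) has_field_derivative D) (at s)"
    if "analytic_fun n \<psi>" "((\<lambda>t. \<psi> (act n j (exp t) (c s))) has_field_derivative D) (at 0)" for \<psi> s D
  proof -
    have "D = \<xi> n (r_fun j) \<psi> (c s)"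
      using DERIV_unique[OF that(2) act_analytic_deriv[OF cin j that(1)]] act_one[OF cin] by simp
    then show ?thesis using c that(1) by (simp add: integral_curve_def)
  qed
  have fst_c: "fst (c s) = fst p" for s
  proof (rule extensionalityI[of _ "I (tri n)"])
    fix i assume i: "i \<in> I (tri n)"
    have r: "r_fun i q = fst q i" for q by (simp add: r_fun_def split: prod.split)
    have "((\<lambda>s. r_fun i (c s)) has_field_derivative 0) (at s)" for s
      by (rule dc[OF analytic_r_fun[OF i]]) (simp add: r)
    from DERIV_zero_imp_const[OF this, of s] show "fst (c s) i = fst p i" by (simp add: r c0)
  qed (use M_Omega_eD(1)[OF cin] M_Omega_eD(1)[OF p] in \<open>auto simp: e_Omega_def PiE_def\<close>)
  have cut: "cutoff ?m (snd (c s)) = cutoff ?m (snd p)" for s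
  proof (rule eq_matI)
    fix a b assume "a < dim_row (cutoff ?m (snd p))" "b < dim_col (cutoff ?m (snd p))"
    then have ab: "a < ?m" "b < ?m" by auto
    then have "a < n" "b < n" using blk_le[OF j] by auto
    have "((\<lambda>s. snd (c s) $$ (a, b)) has_field_derivative 0) (at s)" for s
    proof (rule dc[OF analytic_entry[OF \<open>a < n\<close> \<open>b < n\<close>]])
      have "snd (act n j (exp t) (c s)) $$ (a, b) = snd (c s) $$ (a, b)" for t
        using arg_cong[OF cutoff_act_le[OF cin j, of "exp t" ?m s], of "\<lambda>A. A $$ (a, b)"] ab
        by (simp add: cutoff_def)
      then show "((\<lambda>t. snd (act n j (exp t) (c s)) $$ (a, b)) has_field_derivative 0) (at 0)" by simp
    qed
    from DERIV_zero_imp_const[OF this, of s] show "cutoff ?m (snd (c s)) $$ (a, b) = cutoff ?m (snd p) $$ (a, b)"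
      using ab by (simp add: cutoff_def c0)
  qed auto
  define P V where "P = rproj j p" and "V = pad n ?m P"
  have V: "V \<in> carrier_mat n n" by (simp add: V_def)
  have rc: "rproj j (c s) = P" for s by (simp add: P_def rproj_def fst_c cut)
  have dX: "has_mat_deriv n (\<lambda>s. snd (c s)) (bracket (snd (c s)) V) s" for s
    unfolding has_mat_deriv_def
  proof (intro conjI allI impI cx bracket_carrier V)
    fix a b assume ab: "a < n" "b < n"
    have "has_mat_deriv n (\<lambda>t. snd (act n j (exp t) (c s))) (bracket (snd (c s)) V) 0"
    proof (rule has_mat_deriv_cong[OF mact_deriv_0[OF cin, of "[j]" "\<lambda>_. 1" s]])
      show "hamiltonian_sum n (\<lambda>_. 1) [j] (c s) = bracket (snd (c s)) V"
        unfolding hamiltonian_sum.simps rc V_def[symmetric] using bracket_carrier[OF cx[of s] V]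
        by (intro eq_matI) (auto simp del: index_minus_mat)
    qed (use j in auto)
    then show "((\<lambda>s. snd (c s) $$ (a, b)) has_field_derivative bracket (snd (c s)) V $$ (a, b)) (at s)"
      using ab by (intro dc[OF analytic_entry]) (auto simp: has_mat_deriv_def)
  qed
  \<comment> \<open>These are the exponentials of \<open>s\<close> times \<open>V\<close> and of its
    negative. \<open>Y\<close> below undoes the expected motion of \<open>c\<close>, so that it
    should be constant.\<close>
  define g g' where "g s = expproj n ?m P (exp s)" and "g' s = expproj n ?m P (exp (- s))" for s :: complex
  have gc: "g s \<in> carrier_mat n n" "g' s \<in> carrier_mat n n" for s by (simp_all add: g_def g'_def)
  have PP: "P * P = P" unfolding P_def by (rule rproj_idem[OF p j])
  have VV: "V * V = V" using pad_mult[OF blk_le[OF j], of P P] PP by (simp add: V_def P_def)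
  have gV: "expproj n ?m P \<zeta> * V = \<zeta> \<cdot>\<^sub>m V" "V * expproj n ?m P \<zeta> = \<zeta> \<cdot>\<^sub>m V" for \<zeta>
    unfolding expproj_def V_def[symmetric] using V VV
    by (auto simp: add_mult_distrib_mat[of _ n n _ _ n] mult_add_distrib_mat[of _ n n _ n]
      mult_smult_assoc_mat[of _ n n _ n] mult_smult_distrib[of _ n n _ n]
      left_mult_one_mat[of _ n n] right_mult_one_mat[of _ n n] algebra_simps intro!: eq_matI)
  have dg: "has_mat_deriv n g (g s * V) s" for s
  proof (rule has_mat_deriv_cong)
    show "has_mat_deriv n g (exp s \<cdot>\<^sub>m V) s"
      unfolding g_def V_def by (rule has_mat_deriv_expproj) (auto intro!: derivative_eq_intros)
  qed (simp_all add: g_def gV)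
  have dg': "has_mat_deriv n g' (- exp (- s) \<cdot>\<^sub>m V) s" for s
    unfolding g'_def V_def by (rule has_mat_deriv_expproj) (auto intro!: derivative_eq_intros)
  have dg': "has_mat_deriv n g' (- (V * g' s)) s" for s
    by (rule has_mat_deriv_cong[OF dg']) (auto simp: g'_def gV intro!: eq_matI)
  define Y where "Y s = g s * snd (c s) * g' s" for s
  have dY: "has_mat_deriv n Y (0\<^sub>m n n) s" for s
  proof (rule has_mat_deriv_cong[OF has_mat_deriv_mult[OF has_mat_deriv_mult[OF dg dX] dg']])
    have "(g * V * x + g * bracket x V) * h + g * x * - (V * h) = 0\<^sub>m n n"
      if "g \<in> carrier_mat n n" "h \<in> carrier_mat n n" "x \<in> carrier_mat n n" for g h x :: "complex mat"
    proof -
      \<comment> \<open>The derivative of \<open>g\<close> contributes \<open>g * V * x\<close>,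
        which cancels the second half of the bracket; the surviving term is cancelled by the
        derivative of the right factor.\<close>
      have "g * V * x + g * bracket x V = g * x * V"
      proof -
        have "g * bracket x V = g * x * V - g * V * x"
          using that V by (simp add: mult_minus_distrib_mat[of _ n n _ n] assoc_mult_mat[of _ n n _ n _ n])
        moreover have "A + (B - A) = B" if "A \<in> carrier_mat n n" "B \<in> carrier_mat n n" for A B :: "complex mat"
          using that by (intro eq_matI) auto
        moreover have "g * x * V \<in> carrier_mat n n" "g * V * x \<in> carrier_mat n n" using that V by auto
        ultimately show ?thesis by simp
      qed
      moreover have "g * x * - (V * h) = - (g * x * V * h)"
        using that V by (simp add: uminus_mult_right_mat assoc_mult_mat[of _ n n _ n _ n])
      moreover have "g * x * V * h \<in> carrier_mat n n" using that V by auto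
      moreover have "Z + - Z = 0\<^sub>m n n" if "Z \<in> carrier_mat n n" for Z :: "complex mat"
        using that by (intro eq_matI) auto
      ultimately show ?thesis by simp
    qed
    then show "(g s * V * snd (c s) + g s * bracket (snd (c s)) V) * g' s + g s * snd (c s) * - (V * g' s) = 0\<^sub>m n n"
      using gc cx by blast
  qed (simp add: Y_def)
  have "Y t = Y 0"
  proof (rule eq_matI)
    fix a b assume "a < dim_row (Y 0)" "b < dim_col (Y 0)"
    then have ab: "a < n" "b < n" by (auto simp: Y_def g_def g'_def)
    have "((\<lambda>s. Y s $$ (a, b)) has_field_derivative 0) (at s)" for s
      using dY[of s] ab by (auto simp: has_mat_deriv_def)
    then show "Y t $$ (a, b) = Y 0 $$ (a, b)" by (rule DERIV_zero_imp_const)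
  qed (auto simp: Y_def g_def g'_def)
  also have "Y 0 = snd p" using M_Omega_eD(2)[OF p] by (simp add: Y_def g_def g'_def c0)
  finally have Yt: "g t * snd (c t) * g' t = snd p" by (simp add: Y_def)
  have inv: "g' t * g t = 1\<^sub>m n"
    unfolding g_def g'_def P_def
    using expproj_inverse(2)[OF p j _ blk_le[OF j], of "exp t"] by (simp add: exp_minus)
  have "snd (c t) = g' t * (g t * snd (c t) * g' t) * g t"
  proof -
    have "g' * (g * x * g') * g = (g' * g) * x * (g' * g)"
      if "g \<in> carrier_mat n n" "g' \<in> carrier_mat n n" "x \<in> carrier_mat n n" for g g' x :: "complex mat"
      using that by (simp add: assoc_mult_mat[of _ n n _ n _ n])
    from this[OF gc(1) gc(2) cx, of t t t] show ?thesis
      by (simp only: inv left_mult_one_mat[OF cx] right_mult_one_mat[OF cx])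
  qed
  then have "snd (c t) = snd (act n j (exp t) p)"
    unfolding Yt by (simp add: act_def g_def g'_def P_def exp_minus)
  then show ?thesis using fst_c by (simp add: prod_eq_iff)
qed

lemma ex1_integral_curve:
  assumes "p \<in> M_Omega_e n" "j \<in> I (tri n)"
  shows "\<exists>!c. integral_curve n (\<xi> n (r_fun j)) c \<and> c 0 = p"
proof (rule ex1I)
  show "integral_curve n (\<xi> n (r_fun j)) (\<lambda>t. act n j (exp t) p) \<and> act n j (exp 0) p = p"
    using integral_curve_act[OF assms] act_one[OF assms(1)] by simp
qed (use integral_curve_unique[OF assms] in blast)

lemma flow_eq:
  assumes "p \<in> M_Omega_e n" "j \<in> I (tri n)"
  shows "flow n (\<xi> n (r_fun j)) q p = act n j (exp q) p"
proof -
  have "(THE c. integral_curve n (\<xi> n (r_fun j)) c \<and> c 0 = p) = (\<lambda>t. act n j (exp t) p)"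
    using integral_curve_act[OF assms] act_one[OF assms(1)]
    by (intro the1_equality[OF ex1_integral_curve[OF assms]]) auto
  then show ?thesis by (simp add: flow_def)
qed

section \<open>Rationality and the torus action\<close>

text \<open>One fraction valid on all of \<open>S\<close>, a stronger condition than
  \<open>regular_on\<close>. It is closed under arithmetic without any change of
  neighbourhood.\<close>

definition rational_on :: "('p \<Rightarrow> complex) set \<Rightarrow> 'p set \<Rightarrow> ('p \<Rightarrow> complex) \<Rightarrow> bool" where
  "rational_on C S f \<longleftrightarrow>
     (\<exists>P\<in>poly_fun C. \<exists>Q\<in>poly_fun C. \<forall>s\<in>S. Q s \<noteq> 0 \<and> f s = P s / Q s)"

lemma rational_on_poly: "f \<in> poly_fun C \<Longrightarrow> rational_on C S f"
  unfolding rational_on_def using poly_fun.const[of 1 C]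
  by (intro bexI[of _ f] bexI[of _ "\<lambda>_. 1"]) auto

lemma rational_on_const [simp]: "rational_on C S (\<lambda>_. a)"
  by (intro rational_on_poly poly_fun.const)

lemma rational_on_coord: "f \<in> C \<Longrightarrow> rational_on C S f"
  by (intro rational_on_poly poly_fun.coord)

lemma rational_on_cong: "(\<And>s. s \<in> S \<Longrightarrow> f s = g s) \<Longrightarrow> rational_on C S f \<Longrightarrow> rational_on C S g"
  unfolding rational_on_def by (metis (no_types, lifting))

lemma rational_on_add:
  assumes "rational_on C S f" "rational_on C S g"
  shows "rational_on C S (\<lambda>s. f s + g s)"
proof -
  obtain P Q P' Q' where *: "P \<in> poly_fun C" "Q \<in> poly_fun C" "P' \<in> poly_fun C" "Q' \<in> poly_fun C"
    "\<forall>s\<in>S. Q s \<noteq> 0 \<and> f s = P s / Q s" "\<forall>s\<in>S. Q' s \<noteq> 0 \<and> g s = P' s / Q' s"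
    using assms unfolding rational_on_def by blast
  show ?thesis
    unfolding rational_on_def
    by (intro bexI[of _ "\<lambda>s. P s * Q' s + P' s * Q s"] bexI[of _ "\<lambda>s. Q s * Q' s"])
       (use * in \<open>auto intro!: poly_fun.add poly_fun.mult simp: add_frac_eq\<close>)
qed

lemma rational_on_mult:
  assumes "rational_on C S f" "rational_on C S g"
  shows "rational_on C S (\<lambda>s. f s * g s)"
proof -
  obtain P Q P' Q' where *: "P \<in> poly_fun C" "Q \<in> poly_fun C" "P' \<in> poly_fun C" "Q' \<in> poly_fun C"
    "\<forall>s\<in>S. Q s \<noteq> 0 \<and> f s = P s / Q s" "\<forall>s\<in>S. Q' s \<noteq> 0 \<and> g s = P' s / Q' s"
    using assms unfolding rational_on_def by blast
  show ?thesis
    unfolding rational_on_def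
    by (intro bexI[of _ "\<lambda>s. P s * P' s"] bexI[of _ "\<lambda>s. Q s * Q' s"])
       (use * in \<open>auto intro!: poly_fun.mult\<close>)
qed

lemma rational_on_diff:
  assumes "rational_on C S f" "rational_on C S g"
  shows "rational_on C S (\<lambda>s. f s - g s)"
  using rational_on_add[OF assms(1) rational_on_mult[OF rational_on_const[of C S "-1"] assms(2)]] by simp

lemma rational_on_inverse:
  assumes "rational_on C S f" "\<And>s. s \<in> S \<Longrightarrow> f s \<noteq> 0"
  shows "rational_on C S (\<lambda>s. inverse (f s))"
proof -
  obtain P Q where *: "P \<in> poly_fun C" "Q \<in> poly_fun C" "\<forall>s\<in>S. Q s \<noteq> 0 \<and> f s = P s / Q s"
    using assms(1) unfolding rational_on_def by blast
  have "\<forall>s\<in>S. P s \<noteq> 0 \<and> inverse (f s) = Q s / P s" using * assms(2) by force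
  then show ?thesis unfolding rational_on_def using * by blast
qed

lemma rational_on_sum:
  assumes "finite A" "\<And>k. k \<in> A \<Longrightarrow> rational_on C S (f k)"
  shows "rational_on C S (\<lambda>s. \<Sum>k\<in>A. f k s)"
  using assms by (induction A rule: finite_induct) (auto intro: rational_on_add)

text \<open>Polynomials in functions with rational pullback again have rational pullback, so it is
  enough to test coordinates. Openness and regularity of general pullbacks are then read off from
  numerators and denominators.\<close>

lemma variety_morphismI:
  assumes F: "F \<in> S \<rightarrow> T" and D: "\<And>f. f \<in> D \<Longrightarrow> rational_on C S (f \<circ> F)"
  shows "variety_morphism C S D T F"
proof -
  have poly: "rational_on C S (f \<circ> F)" if "f \<in> poly_fun D" for f
    using that
  proof induction
    case (add f g)
    then show ?case using rational_on_add[of C S "f \<circ> F" "g \<circ> F"] by (simp add: o_def)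
  next
    case (mult f g)
    then show ?case using rational_on_mult[of C S "f \<circ> F" "g \<circ> F"] by (simp add: o_def)
  qed (use D in \<open>simp_all add: o_def\<close>)
  \<comment> \<open>The denominator vanishes nowhere on \<open>S\<close>, so a pullback and its
    numerator have the same zeros; preimages of open sets are thus cut out by polynomials.\<close>
  have "\<exists>P. P \<in> poly_fun C \<and> (\<forall>s\<in>S. f (F s) \<noteq> 0 \<longleftrightarrow> P s \<noteq> 0)" if f: "f \<in> poly_fun D" for f
  proof -
    obtain P Q where "P \<in> poly_fun C" "\<forall>s\<in>S. Q s \<noteq> 0 \<and> (f \<circ> F) s = P s / Q s"
      using poly[OF f] unfolding rational_on_def by blast
    then show ?thesis by (intro exI[of _ P]) auto
  qed
  then obtain num where num: "\<And>f. f \<in> poly_fun D \<Longrightarrow> num f \<in> poly_fun C"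
    "\<And>f s. f \<in> poly_fun D \<Longrightarrow> s \<in> S \<Longrightarrow> f (F s) \<noteq> 0 \<longleftrightarrow> num f s \<noteq> 0"
    by metis
  have op: "zariski_open C U {s \<in> U. \<exists>f\<in>Fs. f (F s) \<noteq> 0}" if "Fs \<subseteq> poly_fun D" "U \<subseteq> S" for Fs U
  proof -
    have "f (F s) \<noteq> 0 \<longleftrightarrow> num f s \<noteq> 0" if "f \<in> Fs" "s \<in> U" for f s
      using num(2) that \<open>Fs \<subseteq> poly_fun D\<close> \<open>U \<subseteq> S\<close> by blast
    then have "{s \<in> U. \<exists>f\<in>Fs. f (F s) \<noteq> 0} = {s \<in> U. \<exists>g\<in>num ` Fs. g s \<noteq> 0}" by blast
    moreover have "num ` Fs \<subseteq> poly_fun C" using num(1) that(1) by blast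
    ultimately show ?thesis unfolding zariski_open_def by blast
  qed
  show ?thesis
    unfolding variety_morphism_def
  proof (intro conjI allI impI F)
    fix V assume V: "zariski_open D T V"
    then obtain Fs where Fs: "Fs \<subseteq> poly_fun D" "V = {p \<in> T. \<exists>f\<in>Fs. f p \<noteq> 0}"
      unfolding zariski_open_def by blast
    have "S \<inter> F -` V = {s \<in> S. \<exists>f\<in>Fs. f (F s) \<noteq> 0}" using F Fs by auto
    then show "zariski_open C S (S \<inter> F -` V)" using op[OF Fs(1)] by simp
    fix f assume f: "regular_on D V f"
    show "regular_on C (S \<inter> F -` V) (f \<circ> F)"
      unfolding regular_on_def
    proof
      fix s assume s: "s \<in> S \<inter> F -` V"
      then obtain V' P Q where V': "zariski_open D V V'" "F s \<in> V'" "P \<in> poly_fun D" "Q \<in> poly_fun D"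
        "\<forall>q\<in>V'. Q q \<noteq> 0 \<and> f q = P q / Q q"
        using f unfolding regular_on_def by blast
      obtain Gs where Gs: "Gs \<subseteq> poly_fun D" "V' = {p \<in> V. \<exists>f\<in>Gs. f p \<noteq> 0}"
        using V'(1) unfolding zariski_open_def by blast
      \<comment> \<open>The preimage of the neighbourhood on which \<open>f\<close> is a fraction;
        there the pulled back denominator is nonzero and can be inverted.\<close>
      define W where "W = {s \<in> S \<inter> F -` V. \<exists>f\<in>Gs. f (F s) \<noteq> 0}"
      have W: "F t \<in> V'" "t \<in> S" if "t \<in> W" for t using that Gs by (auto simp: W_def)
      have "rational_on C W (Q \<circ> F)" "rational_on C W (P \<circ> F)"
        using poly[OF V'(4)] poly[OF V'(3)] W(2) unfolding rational_on_def by (meson)+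
      then have "rational_on C W (\<lambda>t. P (F t) * inverse (Q (F t)))"
        using V'(5) W(1) by (intro rational_on_mult rational_on_inverse) (auto simp: o_def)
      then have "rational_on C W (f \<circ> F)"
        using V'(5) W(1) by (elim rational_on_cong[rotated]) (simp add: divide_inverse)
      then obtain P' Q' where "P' \<in> poly_fun C" "Q' \<in> poly_fun C"
        "\<forall>t\<in>W. Q' t \<noteq> 0 \<and> (f \<circ> F) t = P' t / Q' t"
        unfolding rational_on_def by blast
      moreover have "zariski_open C (S \<inter> F -` V) W" unfolding W_def by (rule op[OF Gs(1)]) auto
      moreover have "s \<in> W" using s V'(2) Gs by (auto simp: W_def)
      ultimately show "\<exists>V' P Q. zariski_open C (S \<inter> F -` V) V' \<and> s \<in> V' \<and> P \<in> poly_fun C \<and>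
          Q \<in> poly_fun C \<and> (\<forall>q\<in>V'. Q q \<noteq> 0 \<and> (f \<circ> F) q = P q / Q q)" by blast
    qed
  qed
qed

section \<open>Matrices of rational functions\<close>

definition mat_rational_on :: "('p \<Rightarrow> complex) set \<Rightarrow> 'p set \<Rightarrow> nat \<Rightarrow> ('p \<Rightarrow> complex mat) \<Rightarrow> bool" where
  "mat_rational_on C S n X \<longleftrightarrow> (\<forall>s\<in>S. X s \<in> carrier_mat n n) \<and>
     (\<forall>i<n. \<forall>j<n. rational_on C S (\<lambda>s. X s $$ (i, j)))"

lemma mat_rational_onI:
  assumes "\<And>s. s \<in> S \<Longrightarrow> X s \<in> carrier_mat n n"
    and "\<And>i j. i < n \<Longrightarrow> j < n \<Longrightarrow> rational_on C S (f i j)"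
    and "\<And>i j s. i < n \<Longrightarrow> j < n \<Longrightarrow> s \<in> S \<Longrightarrow> f i j s = X s $$ (i, j)"
  shows "mat_rational_on C S n X"
  unfolding mat_rational_on_def using assms rational_on_cong by (metis (no_types, lifting))

lemma mat_rational_on_const: "A \<in> carrier_mat n n \<Longrightarrow> mat_rational_on C S n (\<lambda>_. A)"
  by (simp add: mat_rational_on_def)

lemma mat_rational_on_add:
  assumes "mat_rational_on C S n X" "mat_rational_on C S n Y"
  shows "mat_rational_on C S n (\<lambda>s. X s + Y s)"
  by (rule mat_rational_onI[where f = "\<lambda>i j s. X s $$ (i, j) + Y s $$ (i, j)"])
     (use assms in \<open>auto simp: mat_rational_on_def intro!: rational_on_add\<close>)

lemma mat_rational_on_smult:
  assumes "rational_on C S a" "mat_rational_on C S n X"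
  shows "mat_rational_on C S n (\<lambda>s. a s \<cdot>\<^sub>m X s)"
  by (rule mat_rational_onI[where f = "\<lambda>i j s. a s * X s $$ (i, j)"])
     (use assms in \<open>auto simp: mat_rational_on_def intro!: rational_on_mult\<close>)

lemma mat_rational_on_mult:
  assumes "mat_rational_on C S n X" "mat_rational_on C S n Y"
  shows "mat_rational_on C S n (\<lambda>s. X s * Y s)"
  by (rule mat_rational_onI[where f = "\<lambda>i j s. \<Sum>k<n. X s $$ (i, k) * Y s $$ (k, j)"])
     (use assms in \<open>auto simp: mat_rational_on_def mat_mult_entry[of _ n] simp del: index_mult_mat(1)
       intro!: rational_on_mult rational_on_sum\<close>)

lemma mat_rational_on_cutoff:
  assumes "m \<le> n" "mat_rational_on C S n X"
  shows "mat_rational_on C S m (\<lambda>s. cutoff m (X s))"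
  by (rule mat_rational_onI[where f = "\<lambda>i j s. X s $$ (i, j)"])
     (use assms in \<open>auto simp: mat_rational_on_def cutoff_def\<close>)

lemma mat_rational_on_pad:
  assumes "mat_rational_on C S m X"
  shows "mat_rational_on C S n (\<lambda>s. pad n m (X s))"
proof (rule mat_rational_onI[where f = "\<lambda>i j s. if i < m \<and> j < m then X s $$ (i, j) else 0"])
  show "rational_on C S (\<lambda>s. if i < m \<and> j < m then X s $$ (i, j) else 0)" for i j
    using assms by (cases "i < m \<and> j < m") (auto simp: mat_rational_on_def)
qed (auto simp: pad_def)

lemma mat_rational_on_expproj:
  assumes "mat_rational_on C S m X" "rational_on C S \<zeta>"
  shows "mat_rational_on C S n (\<lambda>s. expproj n m (X s) (\<zeta> s))"
  unfolding expproj_def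
  by (intro mat_rational_on_add mat_rational_on_const mat_rational_on_smult mat_rational_on_pad
      rational_on_diff rational_on_const assms) simp

lemma mat_rational_on_lagrange_mat:
  assumes X: "mat_rational_on C S m X" and \<mu>: "rational_on C S \<mu>"
    and d: "\<And>k. k \<in> set ks \<Longrightarrow> rational_on C S (d k)"
    and neq: "\<And>k s. k \<in> set ks \<Longrightarrow> s \<in> S \<Longrightarrow> \<mu> s \<noteq> d k s"
  shows "mat_rational_on C S m (\<lambda>s. lagrange_mat (\<mu> s) (map (\<lambda>k. d k s) ks) (X s))"
  using d neq
proof (induction ks)
  case Nil
  show ?case
    by (rule mat_rational_onI[where f = "\<lambda>i j s. if i = j then 1 else 0"])
       (use X in \<open>auto simp: lagrange_mat_simps mat_rational_on_def\<close>)
next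
  case (Cons k ks)
  have "mat_rational_on C S m (\<lambda>s. X s - d k s \<cdot>\<^sub>m 1\<^sub>m (dim_row (X s)))"
    by (rule mat_rational_onI[where f = "\<lambda>i j s. X s $$ (i, j) - d k s * (if i = j then 1 else 0)"])
       (use X Cons in \<open>auto simp: mat_rational_on_def intro!: rational_on_diff rational_on_mult minus_carrier_mat\<close>)
  then show ?case
    unfolding list.map lagrange_mat_simps using Cons \<mu>
    by (intro mat_rational_on_smult mat_rational_on_mult rational_on_inverse rational_on_diff) auto
qed

text \<open>The only denominators are differences of eigenvalues of one cutoff, nonzero by the
  distinctness required in \<open>e_Omega\<close>.\<close>

lemma mat_rational_on_rproj:
  assumes \<Phi>: "\<And>s. s \<in> S \<Longrightarrow> \<Phi> s \<in> M_Omega_e n" and j: "j \<in> I (tri n)"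
    and nu: "\<And>i. i \<in> I (tri n) \<Longrightarrow> rational_on C S (\<lambda>s. fst (\<Phi> s) i)"
    and X: "mat_rational_on C S n (\<lambda>s. snd (\<Phi> s))"
  shows "mat_rational_on C S (blk j) (\<lambda>s. rproj j (\<Phi> s))"
  unfolding rproj_def eproj_def
proof (rule mat_rational_on_lagrange_mat[OF mat_rational_on_cutoff[OF blk_le[OF j] X]])
  have r: "rational_on C S (\<lambda>s. nu_ev (fst (\<Phi> s)) (blk j) k)" if "k < blk j" for k
    unfolding nu_entry_def by (intro nu index_in blk_in j that)
  show "rational_on C S (\<lambda>s. nu_ev (fst (\<Phi> s)) (blk j) (pos j))" by (intro r pos_less[OF j])
  fix k assume k: "k \<in> set (filter (\<lambda>k. k \<noteq> pos j) [0..<blk j])"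
  then show "rational_on C S (\<lambda>s. nu_ev (fst (\<Phi> s)) (blk j) k)" by (intro r) auto
  fix s assume s: "s \<in> S"
  have "inj_on (nu_ev (fst (\<Phi> s)) (blk j)) {..<blk j}"
    using M_Omega_eD(1)[OF \<Phi>[OF s]] blk_in[OF j] by (rule inj_nu_ev)
  then show "nu_ev (fst (\<Phi> s)) (blk j) (pos j) \<noteq> nu_ev (fst (\<Phi> s)) (blk j) k"
    using k pos_less[OF j] by (auto dest: inj_onD)
qed

text \<open>Each factor uses the projection at an intermediate point; its matrix is rational by
  induction, and its eigenvalue data are still those of the starting point.\<close>

lemma mat_rational_on_mact:
  assumes \<Phi>: "\<And>s. s \<in> S \<Longrightarrow> \<Phi> s \<in> M_Omega_e n" and "set js \<subseteq> I (tri n)"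
    and nu: "\<And>i. i \<in> I (tri n) \<Longrightarrow> rational_on C S (\<lambda>s. fst (\<Phi> s) i)"
    and X: "mat_rational_on C S n (\<lambda>s. snd (\<Phi> s))"
    and "\<And>j. j \<in> set js \<Longrightarrow> rational_on C S (\<lambda>s. \<zeta> s j)" "\<And>j s. j \<in> set js \<Longrightarrow> s \<in> S \<Longrightarrow> \<zeta> s j \<noteq> 0"
  shows "mat_rational_on C S n (\<lambda>s. snd (mact n (\<zeta> s) js (\<Phi> s)))"
  using assms(2,5,6)
proof (induction js)
  case Nil
  then show ?case using X by simp
next
  case (Cons j js)
  have IH: "mat_rational_on C S n (\<lambda>s. snd (mact n (\<zeta> s) js (\<Phi> s)))" using Cons by simp
  have in': "mact n (\<zeta> s) js (\<Phi> s) \<in> M_Omega_e n" if "s \<in> S" for s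
    using Cons.prems that by (intro mact_in \<Phi>) auto
  have "mat_rational_on C S (blk j) (\<lambda>s. rproj j (mact n (\<zeta> s) js (\<Phi> s)))"
    using Cons.prems in' nu IH by (intro mat_rational_on_rproj) auto
  then show ?case
    unfolding mact_simps act_def snd_conv using Cons.prems
    by (intro mat_rational_on_mult mat_rational_on_expproj IH rational_on_inverse) auto
qed

section \<open>The torus and its action\<close>

lemma group_Cstar: "group Cstar"
proof (rule groupI)
  fix x assume "x \<in> carrier Cstar"
  then show "\<exists>y\<in>carrier Cstar. y \<otimes>\<^bsub>Cstar\<^esub> x = \<one>\<^bsub>Cstar\<^esub>"
    by (intro bexI[of _ "inverse x"]) (auto simp: Cstar_def)
qed (auto simp: Cstar_def)

lemma group_torus: "group (torus J)"
  unfolding torus_def by (rule product_group) (rule group_Cstar)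

lemma torus_simps:
  "carrier (torus J) = (\<Pi>\<^sub>E j\<in>J. - {0})"
  "z \<otimes>\<^bsub>torus J\<^esub> w = (\<lambda>j\<in>J. z j * w j)"
  by (simp_all add: torus_def product_group_def Cstar_def)

text \<open>Restricted to the variety because elements of \<open>BijGroup\<close> are extensional
  maps. The sorted enumeration is the order in which the derivative at time 0 was computed.\<close>

definition torus_action :: "nat \<Rightarrow> nat set \<Rightarrow> (nat \<Rightarrow> complex) \<Rightarrow> pt \<Rightarrow> pt" where
  "torus_action n J z = (\<lambda>p\<in>M_Omega_e n. mact n z (sorted_list_of_set J) p)"

lemma group_action_torus_action:
  assumes J: "J \<subseteq> I (tri n)"
  shows "group_action (torus J) (M_Omega_e n) (torus_action n J)"
proof -
  let ?M = "M_Omega_e n" and ?a = "torus_action n J" and ?js = "sorted_list_of_set J"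
  have finJ: "finite J" using J by (rule finite_subset) (simp add: I_def)
  then have js: "set ?js = J" "set ?js \<subseteq> I (tri n)" using J by auto
  have nz: "z j \<noteq> 0" if "z \<in> carrier (torus J)" "j \<in> set ?js" for z j
    using that js by (auto simp: torus_simps PiE_def Pi_def)
  have in_M: "?a z p \<in> ?M" if "z \<in> carrier (torus J)" "p \<in> ?M" for z p
    using mact_in[OF that(2) js(2), of z] nz[OF that(1)] that(2) by (simp add: torus_action_def)
  have mult: "?a z (?a w p) = ?a (z \<otimes>\<^bsub>torus J\<^esub> w) p"
    if "z \<in> carrier (torus J)" "w \<in> carrier (torus J)" "p \<in> ?M" for z w p
    using mact_mult[OF that(3) js(2) nz[OF that(1)] nz[OF that(2)]] in_M[OF that(2,3)] that(3)
      mact_cong[of ?js "\<lambda>j. z j * w j" "z \<otimes>\<^bsub>torus J\<^esub> w" n p] js(1)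
    by (simp add: torus_action_def torus_simps)
  have one: "?a \<one>\<^bsub>torus J\<^esub> p = p" if "p \<in> ?M" for p
    using mact_one[OF that js(2)] that finJ
    by (simp add: torus_action_def torus_def product_group_def Cstar_def)
  interpret group "torus J" by (rule group_torus)
  have bij: "?a z \<in> Bij ?M" if z: "z \<in> carrier (torus J)" for z
  proof -
    \<comment> \<open>The action of the inverse torus element is the inverse map, by the already
      established multiplication and unit laws.\<close>
    have "bij_betw (?a z) ?M ?M"
      using z in_M inv_closed[OF z]
      by (intro bij_betw_byWitness[where f' = "?a (inv\<^bsub>torus J\<^esub> z)"]) (auto simp: mult one)
    then show ?thesis by (auto simp: Bij_def torus_action_def)
  qed
  have "?a (z \<otimes>\<^bsub>torus J\<^esub> w) = compose ?M (?a z) (?a w)"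
    if zw: "z \<in> carrier (torus J)" "w \<in> carrier (torus J)" for z w
  proof (rule extensionalityI[of _ ?M])
    show "?a (z \<otimes>\<^bsub>torus J\<^esub> w) p = compose ?M (?a z) (?a w) p" if p: "p \<in> ?M" for p
      using mult[OF zw p] p by (simp add: compose_eq)
  qed (auto simp: torus_action_def compose_def)
  then have "?a \<in> hom (torus J) (BijGroup ?M)"
    using bij by (auto simp: hom_def BijGroup_def)
  then show ?thesis
    unfolding group_action_def group_hom_def group_hom_axioms_def
    using group_torus group_BijGroup by blast
qed

lemma algebraic_torus_action_torus_action:
  assumes J: "J \<subseteq> I (tri n)"
  shows "algebraic_torus_action n J (torus_action n J)"
  unfolding algebraic_torus_action_def
proof (intro conjI group_action_torus_action[OF J] variety_morphismI)
  let ?C = "prod_coords (torus_coords J) (M_coords n)" and ?S = "carrier (torus J) \<times> M_Omega_e n"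
  let ?js = "sorted_list_of_set J" and ?F = "\<lambda>(z, p). torus_action n J z p"
  have finJ: "finite J" using J by (rule finite_subset) (simp add: I_def)
  then have js: "set ?js = J" "set ?js \<subseteq> I (tri n)" using J by auto
  have F: "?F s = mact n (fst s) ?js (snd s)" if "s \<in> ?S" for s
    using that by (auto simp: torus_action_def)
  have nz: "fst s j \<noteq> 0" if "s \<in> ?S" "j \<in> J" for s j
    using that by (auto simp: torus_simps PiE_def Pi_def)
  show "?F \<in> ?S \<rightarrow> M_Omega_e n"
  proof
    fix s assume s: "s \<in> ?S"
    show "?F s \<in> M_Omega_e n"
      unfolding F[OF s] using s nz[OF s] js by (intro mact_in) auto
  qed
  have z: "rational_on ?C ?S (\<lambda>s. fst s j)" if "j \<in> J" for j
  proof (rule rational_on_coord)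
    have "(\<lambda>z. z j) \<circ> fst \<in> ?C" using that unfolding prod_coords_def torus_coords_def by blast
    then show "(\<lambda>s. fst s j) \<in> ?C" by (simp add: o_def)
  qed
  have nu: "rational_on ?C ?S (\<lambda>s. fst (snd s) i)" if "i \<in> I (tri n)" for i
  proof (rule rational_on_coord)
    have "r_fun i \<circ> snd \<in> ?C" using that unfolding prod_coords_def M_coords_def by blast
    then show "(\<lambda>s. fst (snd s) i) \<in> ?C" by (simp add: o_def r_fun_def case_prod_beta)
  qed
  have X: "mat_rational_on ?C ?S n (\<lambda>s. snd (snd s))"
  proof -
    have "rational_on ?C ?S (\<lambda>s. snd (snd s) $$ (a, b))" if "a < n" "b < n" for a b
    proof (rule rational_on_coord)
      have "(\<lambda>p. snd p $$ (a, b)) \<in> M_coords n"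
        unfolding M_coords_def using that by (intro UnI2 image_eqI[of _ _ "(a, b)"]) auto
      then have "(\<lambda>p. snd p $$ (a, b)) \<circ> snd \<in> ?C" unfolding prod_coords_def by blast
      then show "(\<lambda>s. snd (snd s) $$ (a, b)) \<in> ?C" by (simp add: o_def)
    qed
    then show ?thesis using M_Omega_eD(2) by (auto simp: mat_rational_on_def)
  qed
  have Y: "mat_rational_on ?C ?S n (\<lambda>s. snd (mact n (fst s) ?js (snd s)))"
    using nu X z nz js by (intro mat_rational_on_mact) auto
  fix f assume "f \<in> M_coords n"
  then consider i where "i \<in> I (tri n)" "f = r_fun i"
    | a b where "a < n" "b < n" "f = (\<lambda>p. snd p $$ (a, b))"
    unfolding M_coords_def by auto
  then show "rational_on ?C ?S (f \<circ> ?F)"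
  proof cases
    case 1
    show ?thesis
      by (rule rational_on_cong[OF _ nu[OF 1(1)]]) (unfold comp_apply F 1(2), simp add: r_fun_def case_prod_beta)
  next
    case 2
    show ?thesis
    proof (rule rational_on_cong)
      show "rational_on ?C ?S (\<lambda>s. snd (mact n (fst s) ?js (snd s)) $$ (a, b))"
        using Y 2(1,2) by (auto simp: mat_rational_on_def)
    qed (unfold comp_apply F 2(3), rule refl)
  qed
qed

lemma integrates_to_torus_action:
  assumes J: "J \<subseteq> I (tri n)"
  shows "integrates_to n J (torus_action n J)"
  unfolding integrates_to_def
proof (intro conjI allI ballI impI)
  let ?js = "sorted_list_of_set J"
  have finJ: "finite J" using J by (rule finite_subset) (simp add: I_def)
  then have js: "set ?js = J" "set ?js \<subseteq> I (tri n)" "sorted ?js" "distinct ?js" using J by auto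
  have act: "torus_action n J (torus_exp J q) p = mact n (\<lambda>j. exp (q j)) ?js p" if "p \<in> M_Omega_e n" for q p
    using that js(1) by (auto simp: torus_action_def torus_exp_def intro!: mact_cong)
  fix p assume p: "p \<in> M_Omega_e n"
  show "integral_curve n (r_field n J a) (\<lambda>t. torus_action n J (torus_exp J (\<lambda>j. t * a j)) p)" for a
    unfolding act[OF p] integral_curve_def
    using mact_in[OF p js(2)] mact_analytic_deriv[OF p js(2-4)] js(1) by auto
  fix q js' assume js': "distinct js' \<and> set js' = J"
  \<comment> \<open>Every partial product stays in the variety, where the flow is the explicit
    action; this is needed at each stage of the induction.\<close>
  have "foldr (\<lambda>j. flow n (\<xi> n (r_fun j)) (q j)) ks p = mact n (\<lambda>j. exp (q j)) ks p" if "set ks \<subseteq> J" for ks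
    using that
  proof (induction ks)
    case (Cons j ks)
    have "mact n (\<lambda>j. exp (q j)) ks p \<in> M_Omega_e n"
      using Cons.prems J by (intro mact_in p) auto
    then show ?case using Cons J by (auto simp: flow_eq)
  qed simp
  moreover have "mact n (\<lambda>j. exp (q j)) js' p = mact n (\<lambda>j. exp (q j)) ?js p"
    using js' js J by (intro mact_distinct_cong p) auto
  ultimately show "torus_action n J (torus_exp J q) p = foldr (\<lambda>j. flow n (\<xi> n (r_fun j)) (q j)) js' p"
    using js' by (simp add: act[OF p])
next
  fix j assume "j \<in> J"
  then show "complete_field n (\<xi> n (r_fun j))"
    unfolding complete_field_def using ex1_integral_curve J by blast
qed

theorem theorem5p8:
  fixes n m :: nat
  assumes "n > 0" and "m \<in> I (n - 1)"
  shows "(\<exists>\<alpha>. algebraic_torus_action n (I_block m) \<alpha> \<and> integrates_to n (I_block m) \<alpha>) \<and>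
    (\<exists>\<alpha>. algebraic_torus_action n (I (tri (n - 1))) \<alpha> \<and> integrates_to n (I (tri (n - 1))) \<alpha>)"
proof -
  \<comment> \<open>The construction works for every set of positions inside
    \<open>I (tri n)\<close>, so only these inclusions remain.\<close>
  have sub: "I (tri k) \<subseteq> I (tri n)" if "k \<le> n" for k
    using tri_mono[OF that] by (auto simp: I_def)
  have "m \<le> n" using assms(2) by (auto simp: I_def)
  then have "I_block m \<subseteq> I (tri n)" using sub by (auto simp: I_block_def)
  then show ?thesis
    using algebraic_torus_action_torus_action integrates_to_torus_action sub[of "n - 1"] by (meson diff_le_self)
qed

end
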